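(* Let $f$ be a smooth probability density on $\mathbb{R}^n$ with respect to $\gamma$ and let $d\mu=f\,d\gamma$. Assume that $\mu$ has barycenter $b$ and covariance matrix $\Gamma\le\mathrm{Id}$ (in the sense of symmetric matrices). Then $$\delta(f)\;\ge\;\frac14\,\widetilde{\mathcal{D}}(\mu_b,\gamma)^4.$$
   Context: $\gamma$ is the standard Gaussian measure on $\mathbb{R}^n$. $\mathrm{H}(g)=\int g\log g\,d\gamma$, $\mathrm{I}(g)=\int\frac{|\nabla g|^2}{g}d\gamma$, $\delta(g)=\frac12\mathrm{I}(g)-\mathrm{H}(g)$. $f_b(x)=f(x+b)e^{-(b\cdot x+|b|^2/2)}$ and $d\mu_b=f_b\,d\gamma$. The Ornstein–Uhlenbeck semigroup is $P_tg(x)=\int g(e^{-t}x+\sqrt{1-e^{-2t}}\,y)\,d\gamma(y)$. For a probability $\nu=g\,d\gamma$ with finite second moment, $\widetilde{\mathcal{D}}(\nu,\gamma)=\sup_{\varphi}\left|\int[x\varphi-\nabla\varphi]\,d\nu\right|$ (Euclidean norm), the supremum over $\varphi=4\int_0^\infty e^{-4t}P_t\psi\,dt$ with $\psi:\mathbb{R}^n\to\mathbb{R}$ smooth ($C^1$) such that $\int\psi^2\,P_tg\,d\gamma\le1$ for every $t\ge0$ (here $g=f_b$). *)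

theory Defs
  imports "HOL-Analysis.Analysis"
begin

definition gauss_dens :: "real^'n \<Rightarrow> real" where
  "gauss_dens x = (2 * pi) powr (- real CARD('n) / 2) * exp (- (norm x)\<^sup>2 / 2)"

definition gaussian :: "(real^'n) measure" where
  "gaussian = density lborel (\<lambda>x. ennreal (gauss_dens x))"

definition partial :: "'n::finite \<Rightarrow> (real^'n \<Rightarrow> real) \<Rightarrow> real^'n \<Rightarrow> real" where
  "partial i g x = frechet_derivative g (at x) (axis i 1)"

fun iter_partial :: "'n::finite list \<Rightarrow> (real^'n \<Rightarrow> real) \<Rightarrow> real^'n \<Rightarrow> real" where
  "iter_partial [] g = g"
| "iter_partial (i # is) g = partial i (iter_partial is g)"

definition grad :: "(real^'n \<Rightarrow> real) \<Rightarrow> real^'n \<Rightarrow> real^'n" where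
  "grad g x = (\<chi> i. partial i g x)"

definition smooth_fun :: "(real^'n::finite \<Rightarrow> real) \<Rightarrow> bool" where
  "smooth_fun g \<longleftrightarrow> (\<forall>is. (\<forall>x. iter_partial is g differentiable (at x))
                           \<and> continuous_on UNIV (iter_partial is g))"

definition C1_fun :: "(real^'n::finite \<Rightarrow> real) \<Rightarrow> bool" where
  "C1_fun g \<longleftrightarrow> (\<forall>x. g differentiable (at x)) \<and> (\<forall>i. continuous_on UNIV (partial i g))"

text \<open>H(g) = int g log g d gamma, as an extended real: positive part minus negative part
  (the negative part is always finite since g log g \<ge> -1/e).\<close>
definition entropy_G :: "(real^'n::finite \<Rightarrow> real) \<Rightarrow> ereal" where
  "entropy_G g = enn2ereal (\<integral>\<^sup>+ x. ennreal (max 0 (g x * ln (g x))) \<partial>gaussian)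
     - enn2ereal (\<integral>\<^sup>+ x. ennreal (max 0 (- (g x * ln (g x)))) \<partial>gaussian)"

definition fisher_G :: "(real^'n::finite \<Rightarrow> real) \<Rightarrow> ennreal" where
  "fisher_G g = (\<integral>\<^sup>+ x. ennreal ((norm (grad g x))\<^sup>2 / g x) \<partial>gaussian)"

definition deficit :: "(real^'n::finite \<Rightarrow> real) \<Rightarrow> ereal" where
  "deficit g = (if fisher_G g = \<infinity> then \<infinity> else enn2ereal (fisher_G g) / 2 - entropy_G g)"

definition shift_dens :: "(real^'n::finite \<Rightarrow> real) \<Rightarrow> real^'n \<Rightarrow> real^'n \<Rightarrow> real" where
  "shift_dens f b x = f (x + b) * exp (- (b \<bullet> x + (norm b)\<^sup>2 / 2))"

definition OU :: "real \<Rightarrow> (real^'n::finite \<Rightarrow> real) \<Rightarrow> real^'n \<Rightarrow> real" where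
  "OU t g x = (\<integral> y. g (exp (- t) *\<^sub>R x + sqrt (1 - exp (- 2 * t)) *\<^sub>R y) \<partial>gaussian)"

definition phi_of :: "(real^'n::finite \<Rightarrow> real) \<Rightarrow> real^'n \<Rightarrow> real" where
  "phi_of \<psi> x = 4 * set_lebesgue_integral lborel {0..} (\<lambda>t. exp (- 4 * t) * OU t \<psi> x)"

definition admissible :: "(real^'n::finite \<Rightarrow> real) \<Rightarrow> (real^'n \<Rightarrow> real) \<Rightarrow> bool" where
  "admissible g \<psi> \<longleftrightarrow> C1_fun \<psi> \<and>
     (\<forall>t\<ge>0. (\<integral>\<^sup>+ x. ennreal ((\<psi> x)\<^sup>2 * OU t g x) \<partial>gaussian) \<le> 1)"

definition stein_disc :: "(real^'n::finite \<Rightarrow> real) \<Rightarrow> ereal" where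
  "stein_disc g = (SUP \<psi> \<in> {\<psi>. admissible g \<psi> \<and> (\<forall>x. phi_of \<psi> differentiable (at x))
        \<and> integrable (density gaussian (\<lambda>x. ennreal (g x)))
             (\<lambda>x. phi_of \<psi> x *\<^sub>R x - grad (phi_of \<psi>) x)}.
      ereal (norm (\<integral> x. (phi_of \<psi> x *\<^sub>R x - grad (phi_of \<psi>) x)
                    \<partial>density gaussian (\<lambda>x. ennreal (g x)))))"

end

theory Submission
  imports Defs "HOL-Probability.Probability" "HOL-Real_Asymp.Real_Asymp"
begin

text \<open>Write \<open>P\<^sub>t\<close> for the Ornstein--Uhlenbeck semigroup, parametrised by \<open>c = exp (- t)\<close>, let
  \<open>A(c) = \<integral> |P\<^sub>t \<nabla>f|\<^sup>2 / P\<^sub>t f\<close>, and let \<open>a(c)\<close> be the analogous quantity for the derivative in one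
  unit direction \<open>u\<close>, so that \<open>A(1)\<close> is the Fisher information. After recentering at the barycenter (which does
  not change the deficit), two facts are combined on a geometric grid \<open>c = d\<^sup>k\<close>. Entropy production bounds the
  entropy by a Riemann sum of \<open>c\<^sup>2 A(c)\<close> over \<open>t\<close>. The score of \<open>P\<^sub>t f\<close> is a conditional expectation of the score
  of \<open>f\<close>, and testing the conditional variance \<open>A(1) - A(d)\<close> against the Gaussian noise in direction \<open>u\<close> gives
  \<open>A(1) - A(d) \<ge> d\<^sup>2 (1 - d\<^sup>2) a(d)\<^sup>2\<close> as soon as the variance in direction \<open>u\<close> is at most one. Summing by parts and
  refining the grid yields \<open>\<integral> 4 exp (- 4 t) a(exp (- t))\<^sup>2 dt \<le> 4 \<delta>(f)\<close>. On the other side, Gaussian integration by parts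
  and the symmetry of \<open>P\<^sub>t\<close> bound the Stein pairing in direction \<open>u\<close> by \<open>\<integral> 4 exp (- 4 t) a(exp (- t))\<^sup>1\<^sup>/\<^sup>2 dt\<close>,
  and Jensen's inequality for the probability density \<open>4 exp (- 4 t)\<close> concludes.\<close>

section \<open>The Gaussian measure\<close>

text \<open>The time grid replaces every differentiation of the Fisher information in time: finite
  decrements and monotonicity are enough. The weight in time is forced. A step starting at c carries
  c^2, because the gradient commutes with the semigroup up to the factor c, and summation by parts
  contributes another square, so the squared directional information is weighted by c^4 = exp (- 4
  t), the kernel that also defines \<open>phi_of\<close>. The constant 4 is a product of two factors
  2: the deficit is half of the quantity that dominates the sum, and 1 - d^4 = (1 + d^2) (1 - d^2)
  \<le> 2 (1 - d^2). The obstacle is regularity: a general density has no positive lower bound, no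
  upper bound and no bounded gradient, while its modifications violate the normalisation and
  possibly the covariance bound. Mass and excess variance are therefore carried through the
  estimates as explicit terms, and the covariance bound acts only in the limit. Recentering
  preserves the deficit because half of the Fisher information and the entropy both drop by half of
  the squared norm of the barycenter.\<close>

lemma gauss_dens_pos: "gauss_dens x > 0"
  by (simp add: gauss_dens_def)

lemma gauss_dens_nonneg [simp]: "0 \<le> gauss_dens x"
  using gauss_dens_pos[of x] by simp

lemma borel_measurable_gauss_dens [measurable]: "gauss_dens \<in> borel_measurable borel"
  unfolding gauss_dens_def by measurable

lemma sets_gaussian [simp, measurable_cong]: "sets gaussian = sets borel"
  by (simp add: gaussian_def)

lemma space_gaussian [simp]: "space gaussian = UNIV"
  by (simp add: gaussian_def)

lemma nn_integral_gaussian: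
  assumes [measurable]: "f \<in> borel_measurable borel"
  shows "(\<integral>\<^sup>+x. f x \<partial>gaussian) = (\<integral>\<^sup>+x. ennreal (gauss_dens x) * f x \<partial>lborel)"
  unfolding gaussian_def by (subst nn_integral_density) auto

lemma integrable_gaussian:
  fixes f :: "real^'n \<Rightarrow> 'b::{banach, second_countable_topology}"
  assumes [measurable]: "f \<in> borel_measurable borel"
  shows "integrable gaussian f \<longleftrightarrow> integrable lborel (\<lambda>x. gauss_dens x *\<^sub>R f x)"
  unfolding gaussian_def by (subst integrable_density) auto

lemma integral_gaussian:
  fixes f :: "real^'n \<Rightarrow> 'b::{banach, second_countable_topology}"
  assumes [measurable]: "f \<in> borel_measurable borel"
  shows "(\<integral>x. f x \<partial>gaussian) = (\<integral>x. gauss_dens x *\<^sub>R f x \<partial>lborel)"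
  unfolding gaussian_def by (subst integral_density) auto

lemma norm_vec_sum_sq: "(norm (x::'a::euclidean_space))\<^sup>2 = (\<Sum>b\<in>Basis. (x \<bullet> b)\<^sup>2)"
  unfolding power2_norm_eq_inner by (subst euclidean_inner) (simp add: power2_eq_square)

lemma gauss_dens_prod:
  "gauss_dens (x::real^'n) = (\<Prod>b\<in>Basis. std_normal_density (x \<bullet> b))"
proof -
  have "(\<Prod>b\<in>(Basis::(real^'n) set). std_normal_density (x \<bullet> b))
      = (\<Prod>b\<in>(Basis::(real^'n) set). 1 / sqrt (2 * pi)) * (\<Prod>b\<in>Basis. exp (- (x \<bullet> b)\<^sup>2 / 2))"
    unfolding std_normal_density_def by (rule prod.distrib)
  also have "(\<Prod>b\<in>(Basis::(real^'n) set). 1 / sqrt (2 * pi)) = (1 / sqrt (2 * pi)) ^ CARD('n)"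
    by simp
  also have "\<dots> = (2 * pi) powr (- real CARD('n) / 2)"
  proof -
    have "1 / sqrt (2 * pi) = (2 * pi) powr (- (1/2))"
      by (simp add: powr_minus_divide powr_half_sqrt)
    then show ?thesis
      by (simp add: powr_powr mult.commute flip: powr_realpow)
  qed
  also have "(\<Prod>b\<in>Basis. exp (- (x \<bullet> b)\<^sup>2 / 2)) = exp (- (norm x)\<^sup>2 / 2)"
    by (simp add: norm_vec_sum_sq sum_negf sum_divide_distrib flip: exp_sum)
  finally show ?thesis by (simp add: gauss_dens_def)
qed

lemma prob_space_gaussian: "prob_space (gaussian :: (real^'n) measure)"
proof
  have "emeasure (gaussian :: (real^'n) measure) (space gaussian) = (\<integral>\<^sup>+x. 1 \<partial>(gaussian :: (real^'n) measure))"
    by simp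
  also have "\<dots> = (\<integral>\<^sup>+x. ennreal (gauss_dens (x::real^'n)) \<partial>lborel)"
    by (subst nn_integral_gaussian) auto
  also have "\<dots> = (\<integral>\<^sup>+x. (\<Prod>b\<in>Basis. ennreal (std_normal_density ((x::real^'n) \<bullet> b))) \<partial>lborel)"
    by (simp add: gauss_dens_prod prod_ennreal)
  also have "\<dots> = (\<Prod>b\<in>(Basis::(real^'n) set). (\<integral>\<^sup>+x. ennreal (std_normal_density x) \<partial>lborel))"
    by (rule nn_integral_lborel_prod) auto
  also have "(\<integral>\<^sup>+x. ennreal (std_normal_density x) \<partial>lborel) = 1"
    by (subst nn_integral_eq_integral)
      (auto intro: integrable_normal_density simp: integral_normal_density)
  finally show "emeasure (gaussian :: (real^'n) measure) (space gaussian) = 1"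
    by simp
qed

interpretation gaussian: prob_space "gaussian :: (real^'n) measure"
  by (rule prob_space_gaussian)

interpretation gaussian_pair: pair_prob_space "gaussian :: (real^'n) measure" "gaussian :: (real^'n) measure" ..

section \<open>Invariance of the product Gaussian under orthogonal mixing\<close>

lemma nn_integral_lborel_affine:
  fixes F :: "'a::euclidean_space \<Rightarrow> ennreal"
  assumes [measurable]: "F \<in> borel_measurable borel" and "c \<noteq> 0"
  shows "(\<integral>\<^sup>+x. F x \<partial>lborel) = ennreal (\<bar>c\<bar> ^ DIM('a)) * (\<integral>\<^sup>+x. F (t + c *\<^sub>R x) \<partial>lborel)"
  by (subst lborel_affine[OF \<open>c \<noteq> 0\<close>, of t])
    (simp add: nn_integral_density nn_integral_distr nn_integral_cmult)

lemma gauss_dens_reflect: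
  assumes "c\<^sup>2 + s\<^sup>2 = 1"
  shows "gauss_dens (c *\<^sub>R x + s *\<^sub>R y) * gauss_dens (s *\<^sub>R x - c *\<^sub>R y) = gauss_dens x * gauss_dens y"
proof -
  have "(norm (c *\<^sub>R x + s *\<^sub>R y))\<^sup>2 + (norm (s *\<^sub>R x - c *\<^sub>R y))\<^sup>2 = (c\<^sup>2 + s\<^sup>2) * ((norm x)\<^sup>2 + (norm y)\<^sup>2)"
    unfolding power2_norm_eq_inner
    by (simp add: inner_add_left inner_add_right inner_diff_left inner_diff_right inner_commute
        algebra_simps power2_eq_square)
  then have "- (norm (c *\<^sub>R x + s *\<^sub>R y))\<^sup>2 / 2 + - (norm (s *\<^sub>R x - c *\<^sub>R y))\<^sup>2 / 2 = - (norm x)\<^sup>2 / 2 + - (norm y)\<^sup>2 / 2"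
    using assms by simp
  then show ?thesis
    unfolding gauss_dens_def
    by (simp add: mult_exp_exp mult_ac flip: exp_add)
qed

text \<open>A reflection instead of a rotation: the map is its own inverse, so one invariance
  statement serves for both directions of the change of variables.\<close>

definition reflect :: "real \<Rightarrow> real \<Rightarrow> 'a::real_vector \<times> 'a \<Rightarrow> 'a \<times> 'a" where
  "reflect c s p = (c *\<^sub>R fst p + s *\<^sub>R snd p, s *\<^sub>R fst p - c *\<^sub>R snd p)"

text \<open>Two successive affine substitutions, each in one block of variables: first x is replaced
  by w = c x + s y with y fixed, then y by z = (s / c) w - (1 / c) y with w fixed. The Jacobians
  \<open>K\<close> and \<open>K'\<close> cancel. Solving for x is what requires
  \<open>c \<noteq> 0\<close>.\<close>

lemma nn_integral_reflect:
  fixes h :: "(real^'n) \<times> (real^'n) \<Rightarrow> ennreal"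
  assumes [measurable]: "h \<in> borel_measurable (borel \<Otimes>\<^sub>M borel)"
    and cs: "c\<^sup>2 + s\<^sup>2 = 1" and c: "c \<noteq> 0"
  shows "(\<integral>\<^sup>+p. h (reflect c s p) \<partial>(gaussian \<Otimes>\<^sub>M gaussian)) = (\<integral>\<^sup>+p. h p \<partial>(gaussian \<Otimes>\<^sub>M gaussian))"
proof -
  define H where "H w z = ennreal (gauss_dens w * gauss_dens z) * h (w, z)" for w z :: "real^'n"
  have [measurable]: "(\<lambda>p. H (fst p) (snd p)) \<in> borel_measurable (borel \<Otimes>\<^sub>M borel)"
    unfolding H_def by measurable
  have Hm[measurable]: "(\<lambda>x. H (f x) (g x)) \<in> borel_measurable M"
    if [measurable]: "f \<in> borel_measurable M" "g \<in> borel_measurable M" for f g and M :: "'z measure"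
    unfolding H_def by measurable
  have pair: "(\<integral>\<^sup>+p. k p \<partial>(gaussian \<Otimes>\<^sub>M gaussian)) =
      (\<integral>\<^sup>+y. \<integral>\<^sup>+x. ennreal (gauss_dens x * gauss_dens y) * k (x, y) \<partial>lborel \<partial>lborel)"
    if [measurable]: "k \<in> borel_measurable (borel \<Otimes>\<^sub>M borel)" for k :: "(real^'n) \<times> (real^'n) \<Rightarrow> ennreal"
  proof -
    have [measurable]: "(\<lambda>y. \<integral>\<^sup>+x. k (x, y) \<partial>gaussian) \<in> borel_measurable borel"
      by measurable
    have "(\<integral>\<^sup>+p. k p \<partial>(gaussian \<Otimes>\<^sub>M gaussian)) = (\<integral>\<^sup>+y. \<integral>\<^sup>+x. k (x, y) \<partial>gaussian \<partial>gaussian)"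
      by (rule gaussian_pair.nn_integral_snd[symmetric]) measurable
    also have "\<dots> = (\<integral>\<^sup>+y. ennreal (gauss_dens y) * (\<integral>\<^sup>+x. ennreal (gauss_dens x) * k (x, y) \<partial>lborel) \<partial>lborel)"
      by (simp add: nn_integral_gaussian)
    also have "\<dots> = (\<integral>\<^sup>+y. \<integral>\<^sup>+x. ennreal (gauss_dens x * gauss_dens y) * k (x, y) \<partial>lborel \<partial>lborel)"
      by (simp add: ennreal_mult mult_ac flip: nn_integral_cmult)
    finally show ?thesis .
  qed
  have rm[measurable]: "reflect c s \<in> (borel \<Otimes>\<^sub>M borel) \<rightarrow>\<^sub>M (borel \<Otimes>\<^sub>M (borel :: (real^'n) measure))"
    unfolding reflect_def by measurable
  define K where "K = ennreal (\<bar>c\<bar> ^ DIM(real^'n))"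
  define K' where "K' = ennreal (\<bar>- 1 / c\<bar> ^ DIM(real^'n))"
  have KK: "K * K' = 1"
    using c unfolding K_def K'_def
    by (subst ennreal_mult[symmetric]) (auto simp flip: power_mult_distrib abs_mult)
  have "(\<integral>\<^sup>+p. h (reflect c s p) \<partial>(gaussian \<Otimes>\<^sub>M gaussian)) =
      (\<integral>\<^sup>+y. \<integral>\<^sup>+x. H (c *\<^sub>R x + s *\<^sub>R y) (s *\<^sub>R x - c *\<^sub>R y) \<partial>lborel \<partial>lborel)"
    by (subst pair) (auto simp: H_def gauss_dens_reflect[OF cs] reflect_def)
  also have "\<dots> = K' * (K * (\<integral>\<^sup>+y. \<integral>\<^sup>+x. H (c *\<^sub>R x + s *\<^sub>R y) (s *\<^sub>R x - c *\<^sub>R y) \<partial>lborel \<partial>lborel))"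
    using KK by (simp add: mult.assoc[symmetric] mult.commute[of K'])
  also have "\<dots> = K' * (\<integral>\<^sup>+y. K * (\<integral>\<^sup>+x. H (c *\<^sub>R x + s *\<^sub>R y) (s *\<^sub>R x - c *\<^sub>R y) \<partial>lborel) \<partial>lborel)"
    by (subst nn_integral_cmult) auto
  also have "(\<lambda>y. K * (\<integral>\<^sup>+x. H (c *\<^sub>R x + s *\<^sub>R y) (s *\<^sub>R x - c *\<^sub>R y) \<partial>lborel))
     = (\<lambda>y. \<integral>\<^sup>+w. H w ((s / c) *\<^sub>R w + (- 1 / c) *\<^sub>R y) \<partial>lborel)"
  proof
    fix y :: "real^'n"
    have e: "(s / c) *\<^sub>R (s *\<^sub>R y + c *\<^sub>R x) + (- 1 / c) *\<^sub>R y = s *\<^sub>R x - c *\<^sub>R y" for x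
    proof -
      have "(s / c) *\<^sub>R (s *\<^sub>R y + c *\<^sub>R x) + (- 1 / c) *\<^sub>R y = ((s / c) * s - 1 / c) *\<^sub>R y + s *\<^sub>R x"
        using c by (simp add: algebra_simps)
      also have "(s / c) * s - 1 / c = - c"
        using c cs by (simp add: field_simps power2_eq_square)
      finally show ?thesis by simp
    qed
    show "K * (\<integral>\<^sup>+x. H (c *\<^sub>R x + s *\<^sub>R y) (s *\<^sub>R x - c *\<^sub>R y) \<partial>lborel)
      = (\<integral>\<^sup>+w. H w ((s / c) *\<^sub>R w + (- 1 / c) *\<^sub>R y) \<partial>lborel)"
      by (subst nn_integral_lborel_affine[OF _ c, where t="s *\<^sub>R y" and F="\<lambda>w. H w ((s / c) *\<^sub>R w + (- 1 / c) *\<^sub>R y)"])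
        (simp_all only: e K_def add.commute[of "s *\<^sub>R y"] e[unfolded add.commute[of "s *\<^sub>R y"]], measurable)
  qed
  also have "(\<integral>\<^sup>+y. \<integral>\<^sup>+w. H w ((s / c) *\<^sub>R w + (- 1 / c) *\<^sub>R y) \<partial>lborel \<partial>lborel)
     = (\<integral>\<^sup>+w. \<integral>\<^sup>+y. H w ((s / c) *\<^sub>R w + (- 1 / c) *\<^sub>R y) \<partial>lborel \<partial>lborel)"
    by (rule lborel_pair.Fubini') measurable
  also have "K' * \<dots> = (\<integral>\<^sup>+w. K' * (\<integral>\<^sup>+y. H w ((s / c) *\<^sub>R w + (- 1 / c) *\<^sub>R y) \<partial>lborel) \<partial>lborel)"
    by (subst nn_integral_cmult) auto
  also have "\<dots> = (\<integral>\<^sup>+w. \<integral>\<^sup>+z. H w z \<partial>lborel \<partial>lborel)"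
    unfolding K'_def
    by (subst nn_integral_lborel_affine[where c = "- 1 / c", symmetric]) (use c in auto)
  also have "\<dots> = (\<integral>\<^sup>+z. \<integral>\<^sup>+w. H w z \<partial>lborel \<partial>lborel)"
    by (rule lborel_pair.Fubini'[symmetric]) measurable
  also have "\<dots> = (\<integral>\<^sup>+p. h p \<partial>(gaussian \<Otimes>\<^sub>M gaussian))"
    by (subst pair) (auto simp: H_def)
  finally show ?thesis .
qed

lemma measurable_reflect [measurable]:
  "reflect c s \<in> (borel \<Otimes>\<^sub>M borel) \<rightarrow>\<^sub>M (borel \<Otimes>\<^sub>M (borel :: (real^'n) measure))"
  unfolding reflect_def by measurable

lemma distr_reflect:
  assumes cs: "c\<^sup>2 + s\<^sup>2 = 1" and c: "c \<noteq> 0"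
  shows "distr (gaussian \<Otimes>\<^sub>M gaussian) (borel \<Otimes>\<^sub>M borel) (reflect c s) = gaussian \<Otimes>\<^sub>M (gaussian :: (real^'n) measure)"
proof (rule measure_eqI)
  fix A assume A: "A \<in> sets (distr (gaussian \<Otimes>\<^sub>M gaussian) (borel \<Otimes>\<^sub>M borel :: ((real^'n) \<times> (real^'n)) measure) (reflect c s))"
  then have A'[measurable]: "A \<in> sets (borel \<Otimes>\<^sub>M borel)" by simp
  have A2: "A \<in> sets (gaussian \<Otimes>\<^sub>M gaussian)"
    using A' by (simp cong: sets_pair_measure_cong)
  have "emeasure (distr (gaussian \<Otimes>\<^sub>M gaussian) (borel \<Otimes>\<^sub>M borel) (reflect c s)) A
    = (\<integral>\<^sup>+p. indicator A (reflect c s p) \<partial>(gaussian \<Otimes>\<^sub>M gaussian))"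
    using A by (subst nn_integral_indicator[symmetric], simp) (subst nn_integral_distr, auto)
  also have "\<dots> = (\<integral>\<^sup>+p. indicator A p \<partial>(gaussian \<Otimes>\<^sub>M gaussian))"
    by (rule nn_integral_reflect) (use cs c in auto)
  also have "\<dots> = emeasure (gaussian \<Otimes>\<^sub>M gaussian) A"
    using A2 by simp
  finally show "emeasure (distr (gaussian \<Otimes>\<^sub>M gaussian) (borel \<Otimes>\<^sub>M borel) (reflect c s)) A = emeasure (gaussian \<Otimes>\<^sub>M gaussian) A" .
qed (simp cong: sets_pair_measure_cong)

lemma integrable_reflect:
  fixes h :: "(real^'n) \<times> (real^'n) \<Rightarrow> 'b::{banach, second_countable_topology}"
  assumes [measurable]: "h \<in> borel_measurable (borel \<Otimes>\<^sub>M borel)"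
    and "c\<^sup>2 + s\<^sup>2 = 1" and "c \<noteq> 0"
  shows "integrable (gaussian \<Otimes>\<^sub>M gaussian) (\<lambda>p. h (reflect c s p)) \<longleftrightarrow> integrable (gaussian \<Otimes>\<^sub>M gaussian) h"
  using integrable_distr_eq[of "reflect c s" "gaussian \<Otimes>\<^sub>M gaussian" "borel \<Otimes>\<^sub>M borel" h] 
  by (simp add: distr_reflect[OF assms(2,3)])

lemma integral_reflect:
  fixes h :: "(real^'n) \<times> (real^'n) \<Rightarrow> 'b::{banach, second_countable_topology}"
  assumes [measurable]: "h \<in> borel_measurable (borel \<Otimes>\<^sub>M borel)"
    and "c\<^sup>2 + s\<^sup>2 = 1" and "c \<noteq> 0"
  shows "(\<integral>p. h (reflect c s p) \<partial>(gaussian \<Otimes>\<^sub>M gaussian)) = (\<integral>p. h p \<partial>(gaussian \<Otimes>\<^sub>M gaussian))"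
  using integral_distr[of "reflect c s" "gaussian \<Otimes>\<^sub>M gaussian" "borel \<Otimes>\<^sub>M borel" h] 
  by (simp add: distr_reflect[OF assms(2,3)])

section \<open>Integration by parts and Cauchy--Schwarz\<close>

lemma distr_lborel_add: "distr lborel borel (\<lambda>x. x + a) = (lborel :: 'a::euclidean_space measure)"
proof -
  have "(\<lambda>x. x + a) = (+) a" by (simp add: fun_eq_iff add.commute)
  then show ?thesis using lborel_distr_plus[of a] by simp
qed

lemma integral_lborel_translate:
  fixes f :: "'a::euclidean_space \<Rightarrow> 'b::{banach, second_countable_topology}"
  assumes [measurable]: "f \<in> borel_measurable borel"
  shows "(\<integral>x. f (x + a) \<partial>lborel) = (\<integral>x. f x \<partial>lborel)"
  using integral_distr[of "\<lambda>x. x + a" lborel borel f] by (simp add: distr_lborel_add)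

lemma integrable_lborel_translate:
  fixes f :: "'a::euclidean_space \<Rightarrow> 'b::{banach, second_countable_topology}"
  assumes [measurable]: "f \<in> borel_measurable borel"
  shows "integrable lborel (\<lambda>x. f (x + a)) \<longleftrightarrow> integrable lborel f"
  using integrable_distr_eq[of "\<lambda>x. x + a" lborel borel f] by (simp add: distr_lborel_add)

lemma GDERIV_line:
  fixes f :: "'a::real_inner \<Rightarrow> real"
  assumes "GDERIV f x :> D"
  shows "((\<lambda>t. f (x + t *\<^sub>R v)) has_real_derivative v \<bullet> D) (at 0)"
proof -
  have "((\<lambda>t. x + t *\<^sub>R v) has_derivative (\<lambda>t. t *\<^sub>R v)) (at 0)"
    by (auto intro!: derivative_eq_intros)
  moreover have "(f has_derivative (\<lambda>k. k \<bullet> D)) (at (x + 0 *\<^sub>R v))"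
    using assms by (simp add: gderiv_def)
  ultimately have "((\<lambda>t. f (x + t *\<^sub>R v)) has_derivative (\<lambda>t. (t *\<^sub>R v) \<bullet> D)) (at 0)"
    by (rule has_derivative_compose)
  then show ?thesis
    unfolding has_field_derivative_def by (rule has_derivative_eq_rhs) (simp add: fun_eq_iff mult.commute)
qed

lemma has_real_derivative_shift_line:
  fixes k :: "'a::real_vector \<Rightarrow> real"
  assumes "\<And>x. ((\<lambda>t. k (x + t *\<^sub>R v)) has_real_derivative k' x) (at 0)"
  shows "((\<lambda>t. k (x + t *\<^sub>R v)) has_real_derivative k' (x + t *\<^sub>R v)) (at t)"
proof -
  have "((\<lambda>r. k ((x + t *\<^sub>R v) + r *\<^sub>R v)) has_real_derivative k' (x + t *\<^sub>R v)) (at (t + (-t)))"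
    using assms[of "x + t *\<^sub>R v"] by simp
  from this[THEN DERIV_shift[THEN iffD1]] show ?thesis
    by (simp add: algebra_simps)
qed

text \<open>Fubini on the fundamental theorem of calculus along segments of direction \<open>v\<close> reduces the
  claim to translation invariance, so no continuity of the derivative is required.\<close>
lemma integral_directional_derivative_eq_0:
  fixes k k' :: "'a::euclidean_space \<Rightarrow> real"
  assumes k: "integrable lborel k" and k': "integrable lborel k'"
    and deriv: "\<And>x. ((\<lambda>t. k (x + t *\<^sub>R v)) has_real_derivative k' x) (at 0)"
  shows "(\<integral>x. k' x \<partial>lborel) = 0"
proof -
  have km[measurable]: "k \<in> borel_measurable borel" "k' \<in> borel_measurable borel"
    using k k' by auto
  define h where "h t x = indicator {0..1::real} t *\<^sub>R k' (x + t *\<^sub>R v)" for t x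
  have hm[measurable]: "case_prod h \<in> borel_measurable (lborel \<Otimes>\<^sub>M lborel)"
    unfolding h_def by measurable
  have int2: "integrable lborel (\<lambda>x. h t x)" for t
    unfolding h_def using k' by (simp add: integrable_lborel_translate)
  have hi: "integrable (lborel \<Otimes>\<^sub>M lborel) (case_prod h)"
  proof (rule lborel_pair.Fubini_integrable[OF hm])
    have "(\<integral>x. norm (h t x) \<partial>lborel) = indicator {0..1} t *\<^sub>R (\<integral>x. norm (k' x) \<partial>lborel)" for t
      unfolding h_def
      using integral_lborel_translate[of "\<lambda>x. norm (k' x)" "t *\<^sub>R v"] by (simp add: abs_mult)
    then show "integrable lborel (\<lambda>t. \<integral>x. norm (case_prod h (t, x)) \<partial>lborel)"
      by simp
    show "AE t in lborel. integrable lborel (\<lambda>x. case_prod h (t, x))"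
      using int2 by simp
  qed
  have "(\<integral>x. (\<integral>t. h t x \<partial>lborel) \<partial>lborel) = (\<integral>x. k (x + v) - k x \<partial>lborel)"
  proof (rule integral_cong_AE)
    have "AE x in lborel. integrable lborel (\<lambda>t. h t x)"
      by (rule lborel_pair.AE_integrable_snd[OF hi])
    then show "AE x in lborel. (\<integral>t. h t x \<partial>lborel) = k (x + v) - k x"
    proof eventually_elim
      case (elim x)
      then have si: "set_integrable lborel {0..1} (\<lambda>t. k' (x + t *\<^sub>R v))"
        by (simp add: set_integrable_def h_def)
      have "(\<integral>t. h t x \<partial>lborel) = integral {0..1} (\<lambda>t. k' (x + t *\<^sub>R v))"
        using set_borel_integral_eq_integral(2)[OF si] by (simp add: set_lebesgue_integral_def h_def)
      also have "((\<lambda>t. k' (x + t *\<^sub>R v)) has_integral (k (x + 1 *\<^sub>R v) - k (x + 0 *\<^sub>R v))) {0..1}"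
        by (rule fundamental_theorem_of_calculus)
          (auto simp flip: has_real_derivative_iff_has_vector_derivative
            intro!: has_field_derivative_at_within has_real_derivative_shift_line deriv)
      then have "integral {0..1} (\<lambda>t. k' (x + t *\<^sub>R v)) = k (x + v) - k x"
        by (simp add: integral_unique)
      finally show ?case .
    qed
  qed (use lborel_pair.integrable_snd[OF hi] in auto)
  also have "\<dots> = 0"
    using k by (subst Bochner_Integration.integral_diff)
      (auto simp: integrable_lborel_translate integral_lborel_translate)
  also have "(\<integral>x. (\<integral>t. h t x \<partial>lborel) \<partial>lborel) = (\<integral>t. (\<integral>x. h t x \<partial>lborel) \<partial>lborel)"
    by (rule lborel_pair.Fubini_integral[OF hi])
  also have "(\<lambda>t. \<integral>x. h t x \<partial>lborel) = (\<lambda>t. indicator {0..1} t *\<^sub>R (\<integral>x. k' x \<partial>lborel))"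
    unfolding h_def by (simp add: integral_lborel_translate)
  finally show ?thesis by simp
qed

lemma has_real_derivative_gauss_dens_line:
  "((\<lambda>t. gauss_dens (x + t *\<^sub>R v)) has_real_derivative (- (v \<bullet> x) * gauss_dens x)) (at 0)"
proof -
  have e: "(norm (x + t *\<^sub>R v))\<^sup>2 = x \<bullet> x + 2 * t * (v \<bullet> x) + t\<^sup>2 * (v \<bullet> v)" for t
    unfolding power2_norm_eq_inner
    by (simp add: inner_add_left inner_add_right inner_commute algebra_simps power2_eq_square)
  show ?thesis
    unfolding gauss_dens_def e
    by (auto intro!: derivative_eq_intros simp: power2_norm_eq_inner)
qed

text \<open>The divergence form of the preceding result for \<open>h\<close> times the Gaussian
  density. Integrability is asked only of the combination
  \<open>h' x - (v \<bullet> x) * h x\<close>, never of its two terms: for the Stein pairing nothing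
  more is available.\<close>

lemma gaussian_ibp:
  fixes h h' :: "real^'n \<Rightarrow> real"
  assumes h: "integrable gaussian h" and h': "integrable gaussian (\<lambda>x. h' x - (v \<bullet> x) * h x)"
    and deriv: "\<And>x. ((\<lambda>t. h (x + t *\<^sub>R v)) has_real_derivative h' x) (at 0)"
  shows "(\<integral>x. h' x - (v \<bullet> x) * h x \<partial>gaussian) = 0"
proof -
  have [measurable]: "h \<in> borel_measurable borel" "(\<lambda>x. h' x - (v \<bullet> x) * h x) \<in> borel_measurable borel"
    using borel_measurable_integrable[OF h] borel_measurable_integrable[OF h'] 
    by (simp_all cong: measurable_cong_sets)
  have "(\<integral>x. gauss_dens x *\<^sub>R (h' x - (v \<bullet> x) * h x) \<partial>lborel) = 0"
  proof (rule integral_directional_derivative_eq_0)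
    show "integrable lborel (\<lambda>x. gauss_dens x *\<^sub>R h x)"
      using h by (simp add: integrable_gaussian)
    show "integrable lborel (\<lambda>x. gauss_dens x *\<^sub>R (h' x - (v \<bullet> x) * h x))"
      using h' by (subst integrable_gaussian[symmetric]) auto
    show "((\<lambda>t. gauss_dens (x + t *\<^sub>R v) *\<^sub>R h (x + t *\<^sub>R v)) has_real_derivative
           gauss_dens x *\<^sub>R (h' x - (v \<bullet> x) * h x)) (at 0)" for x
      using DERIV_mult[OF has_real_derivative_gauss_dens_line[of x v] deriv[of x]]
      by (simp add: algebra_simps)
  qed
  then show ?thesis by (subst integral_gaussian) auto
qed

section \<open>Gaussian moments and growth criteria for integrability\<close>

lemma integrable_gaussian_norm_sq: "integrable gaussian (\<lambda>x::real^'n. (norm x)\<^sup>2)"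
proof -
  define c :: real where "c = 1 / sqrt 2"
  have c: "c \<noteq> 0" "c\<^sup>2 = 1/2" by (auto simp: c_def power_divide)
  have "(\<integral>\<^sup>+x. ennreal (gauss_dens (x::real^'n)) \<partial>lborel) = 1"
    using prob_space.emeasure_space_1[OF prob_space_gaussian[where 'n='n]] nn_integral_gaussian[of "\<lambda>_::real^'n. 1"]
    by (simp del: space_gaussian)
  then have "ennreal (\<bar>c\<bar> ^ DIM(real^'n)) * (\<integral>\<^sup>+x. ennreal (gauss_dens (0 + c *\<^sub>R (x::real^'n))) \<partial>lborel) = 1"
    by (subst (asm) nn_integral_lborel_affine[OF _ c(1), of _ 0]) auto
  then have "(\<integral>\<^sup>+x. ennreal (gauss_dens (0 + c *\<^sub>R (x::real^'n))) \<partial>lborel) < \<infinity>"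
    by (rule contrapos_pp)
      (simp only: infinity_ennreal_def top.not_eq_extremum[symmetric] not_not ennreal_mult_top, simp)
  then have i: "integrable lborel (\<lambda>x::real^'n. 4 * gauss_dens (c *\<^sub>R x))"
    by (intro integrable_mult_right integrableI_nonneg) auto
  have "integrable lborel (\<lambda>x::real^'n. gauss_dens x *\<^sub>R (norm x)\<^sup>2)"
  proof (rule Bochner_Integration.integrable_bound[OF i])
    \<comment> \<open>Half of the Gaussian exponent absorbs the square, since r^2 / 4 \<le> exp (r^2
      / 4). What is left is a dilated Gaussian, integrable by a change of scale.\<close>
    have "gauss_dens x * (norm x)\<^sup>2 \<le> 4 * gauss_dens (c *\<^sub>R x)" for x :: "real^'n"
    proof -
      have "exp (- (norm x)\<^sup>2 / 2) * (norm x)\<^sup>2 = 4 * (exp (- (norm x)\<^sup>2 / 2) * ((norm x)\<^sup>2 / 4))"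
        by simp
      also have "\<dots> \<le> 4 * (exp (- (norm x)\<^sup>2 / 2) * exp ((norm x)\<^sup>2 / 4))"
        using exp_ge_add_one_self[of "(norm x)\<^sup>2 / 4"] by (intro mult_left_mono) (linarith, simp_all)
      also have "\<dots> = 4 * exp (- (norm (c *\<^sub>R x))\<^sup>2 / 2)"
        using c by (simp add: power_mult_distrib flip: exp_add)
      finally show ?thesis
        unfolding gauss_dens_def by (simp add: mult.assoc mult_left_mono)
    qed
    then show "AE x in lborel. norm (gauss_dens x *\<^sub>R (norm x)\<^sup>2) \<le> norm (4 * gauss_dens (c *\<^sub>R (x::real^'n)))"
      by simp
  qed simp
  then show ?thesis by (subst integrable_gaussian) auto
qed

lemma integrable_gaussian_quadratic:
  fixes f :: "real^'n \<Rightarrow> 'b::{banach, second_countable_topology}"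
  assumes [measurable]: "f \<in> borel_measurable borel" and "\<And>x. norm (f x) \<le> C * (1 + (norm x)\<^sup>2)"
  shows "integrable gaussian f"
proof (rule Bochner_Integration.integrable_bound)
  show "integrable gaussian (\<lambda>x::real^'n. C * (1 + (norm x)\<^sup>2))"
    by (intro integrable_mult_right Bochner_Integration.integrable_add integrable_gaussian_norm_sq) auto
  show "AE x in gaussian. norm (f x) \<le> norm (C * (1 + (norm x)\<^sup>2))"
    using order_trans[OF assms(2) abs_ge_self] by simp
qed simp

lemma norm_le_one_plus_sq: "norm x \<le> 1 + (norm x)\<^sup>2"
proof -
  have "0 \<le> (norm x - 1/2)\<^sup>2" by simp
  then show ?thesis by (simp add: power2_eq_square algebra_simps)
qed

lemma integrable_gaussian_linear:
  fixes f :: "real^'n \<Rightarrow> 'b::{banach, second_countable_topology}"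
  assumes [measurable]: "f \<in> borel_measurable borel" and b: "\<And>x. norm (f x) \<le> C * (1 + norm x)"
  shows "integrable gaussian f"
proof (rule integrable_gaussian_quadratic[where C="2 * \<bar>C\<bar>"])
  fix x :: "real^'n"
  have "C * (1 + norm x) \<le> \<bar>C\<bar> * (1 + norm x)" by (intro mult_right_mono) auto
  also have "\<dots> \<le> \<bar>C\<bar> * (2 * (1 + (norm x)\<^sup>2))"
  proof (rule mult_left_mono)
    show "1 + norm x \<le> 2 * (1 + (norm x)\<^sup>2)"
    proof -
      define N where "N = (norm x)\<^sup>2"
      have "norm x \<le> 1 + N" "0 \<le> N" using norm_le_one_plus_sq[of x] by (auto simp: N_def)
      then have "1 + norm x \<le> (1 + 1) * (1 + N)"
        by (intro order_trans[OF add_left_mono[of "norm x" "1 + N" 1]]) (auto simp: algebra_simps)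
      then show ?thesis unfolding N_def[symmetric] by simp
    qed
  qed simp
  finally show "norm (f x) \<le> 2 * \<bar>C\<bar> * (1 + (norm x)\<^sup>2)"
    using b[of x] by (simp add: mult_ac)
qed simp

lemma integrable_gaussian_bounded:
  fixes f :: "real^'n \<Rightarrow> 'b::{banach, second_countable_topology}"
  assumes "f \<in> borel_measurable borel" and "\<And>x. norm (f x) \<le> C"
  shows "integrable gaussian f"
  using assms by (intro gaussian.integrable_const_bound[of _ C]) (auto cong: measurable_cong_sets)

lemma gaussian_prob_UNIV [simp]: "measure gaussian (UNIV :: (real^'n) set) = 1"
  using gaussian.prob_space by simp

lemma norm_inner_le_linear: "norm (v \<bullet> x) \<le> norm v * (1 + norm x)"
proof -
  have "norm v * norm x \<le> norm v * (1 + norm x)" by (simp add: mult_left_mono)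
  then show ?thesis using Cauchy_Schwarz_ineq2[of v x] by simp
qed

lemma gaussian_mean: "(\<integral>x. v \<bullet> x \<partial>gaussian) = 0"
proof -
  have "(\<integral>x. 0 - (v \<bullet> x) * 1 \<partial>gaussian) = 0"
    by (rule gaussian_ibp)
      (auto intro!: integrable_gaussian_linear[where C="norm v"] norm_inner_le_linear[simplified])
  then show ?thesis by simp
qed

lemma integrable_gaussian_inner_sq: "integrable gaussian (\<lambda>x::real^'n. (v \<bullet> x)\<^sup>2)"
proof (rule integrable_gaussian_quadratic[where C="(norm v)\<^sup>2"])
  fix x :: "real^'n"
  have "(v \<bullet> x)\<^sup>2 \<le> (norm v * norm x)\<^sup>2"
    using Cauchy_Schwarz_ineq2[of v x] by (metis abs_ge_zero power2_abs power_mono)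
  also have "\<dots> \<le> (norm v)\<^sup>2 * (1 + (norm x)\<^sup>2)" by (simp add: power_mult_distrib algebra_simps)
  finally show "norm ((v \<bullet> x)\<^sup>2) \<le> (norm v)\<^sup>2 * (1 + (norm x)\<^sup>2)" by simp
qed simp

lemma gaussian_second_moment: "(\<integral>x. (v \<bullet> x)\<^sup>2 \<partial>gaussian) = v \<bullet> (v::real^'n)"
proof -
  have "(\<integral>x. v \<bullet> v - (v \<bullet> x) * (v \<bullet> x) \<partial>(gaussian::(real^'n) measure)) = 0"
  proof (rule gaussian_ibp)
    show "integrable gaussian (\<lambda>x::real^'n. v \<bullet> x)"
      by (rule integrable_gaussian_linear[where C="norm v"])
        (auto intro: norm_inner_le_linear[simplified])
    show "integrable gaussian (\<lambda>x::real^'n. v \<bullet> v - (v \<bullet> x) * (v \<bullet> x))"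
      using integrable_gaussian_inner_sq[of v] by (simp add: power2_eq_square)
    show "((\<lambda>t. v \<bullet> (x + t *\<^sub>R v)) has_real_derivative v \<bullet> v) (at 0)" for x
      by (auto intro!: derivative_eq_intros simp: inner_add_right)
  qed
  then show ?thesis
    using integrable_gaussian_inner_sq[of v]
    by (simp add: power2_eq_square)
qed

text \<open>The mean value inequality turns the uniform bound on the derivative into a bound on all
  difference quotients, so dominated convergence applies along every sequence tending to
  \<open>t\<close>.\<close>

lemma DERIV_integral_dominated:
  fixes h h' :: "real \<Rightarrow> 'a \<Rightarrow> real"
  assumes int: "\<And>t. integrable M (h t)"
    and deriv: "\<And>t x. ((\<lambda>t. h t x) has_real_derivative h' t x) (at t)"
    and h'm: "h' t \<in> borel_measurable M"
    and bound: "\<And>t x. \<bar>h' t x\<bar> \<le> B x" and B: "integrable M B"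
  shows "((\<lambda>t. \<integral>x. h t x \<partial>M) has_real_derivative (\<integral>x. h' t x \<partial>M)) (at t)"
  unfolding has_field_derivative_iff tendsto_at_iff_sequentially
proof (intro allI impI)
  fix X :: "nat \<Rightarrow> real" assume X: "\<forall>i. X i \<in> UNIV - {t}" "X \<longlonglongrightarrow> t"
  have "(\<lambda>i. \<integral>x. (h (X i) x - h t x) / (X i - t) \<partial>M) \<longlonglongrightarrow> (\<integral>x. h' t x \<partial>M)"
  proof (rule integral_dominated_convergence[where w=B])
    show "AE x in M. (\<lambda>i. (h (X i) x - h t x) / (X i - t)) \<longlonglongrightarrow> h' t x"
      using deriv[of _ t] X unfolding has_field_derivative_iff tendsto_at_iff_sequentially o_def by auto
    show "AE x in M. norm ((h (X i) x - h t x) / (X i - t)) \<le> B x" for i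
    proof (rule AE_I2)
      fix x
      have ne: "X i \<noteq> t" using X by auto
      have "norm (h (X i) x - h t x) \<le> B x * norm (X i - t)"
        by (rule field_differentiable_bound[where S=UNIV and f'="\<lambda>t. h' t x"])
          (use deriv bound in auto)
      then show "norm ((h (X i) x - h t x) / (X i - t)) \<le> B x"
        using ne by (simp add: norm_divide divide_le_eq)
    qed
  qed (use int h'm B in auto)
  moreover have "(\<integral>x. (h (X i) x - h t x) / (X i - t) \<partial>M) = ((\<integral>x. h (X i) x \<partial>M) - (\<integral>x. h t x \<partial>M)) / (X i - t)" for i
    by (simp only: integral_divide_zero Bochner_Integration.integral_diff[OF int int])
  ultimately show "((\<lambda>s. ((\<integral>x. h s x \<partial>M) - (\<integral>x. h t x \<partial>M)) / (s - t)) \<circ> X) \<longlonglongrightarrow> (\<integral>x. h' t x \<partial>M)"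
    by (simp only: o_def)
qed

lemma Cauchy_Schwarz_integral:
  fixes a b :: "'a \<Rightarrow> real"
  assumes [measurable]: "a \<in> borel_measurable M" "b \<in> borel_measurable M"
    and a: "integrable M (\<lambda>x. (a x)\<^sup>2)" and b: "integrable M (\<lambda>x. (b x)\<^sup>2)"
  shows "integrable M (\<lambda>x. a x * b x)"
    and "(\<integral>x. \<bar>a x * b x\<bar> \<partial>M)\<^sup>2 \<le> (\<integral>x. (a x)\<^sup>2 \<partial>M) * (\<integral>x. (b x)\<^sup>2 \<partial>M)"
    and "(\<integral>x. a x * b x \<partial>M)\<^sup>2 \<le> (\<integral>x. (a x)\<^sup>2 \<partial>M) * (\<integral>x. (b x)\<^sup>2 \<partial>M)"
proof -
  show i: "integrable M (\<lambda>x. a x * b x)"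
  proof (rule Bochner_Integration.integrable_bound)
    show "integrable M (\<lambda>x. (a x)\<^sup>2 + (b x)\<^sup>2)" using a b by simp
    have "\<bar>s * t\<bar> \<le> s\<^sup>2 + t\<^sup>2" for s t :: real
    proof -
      have "0 \<le> \<bar>s\<bar> * \<bar>t\<bar>" by simp
      moreover have "2 * (\<bar>s\<bar> * \<bar>t\<bar>) \<le> s\<^sup>2 + t\<^sup>2"
        using sum_squares_bound[of "\<bar>s\<bar>" "\<bar>t\<bar>"] by (simp add: mult.assoc)
      ultimately show ?thesis unfolding abs_mult by linarith
    qed
    then show "AE x in M. norm (a x * b x) \<le> norm ((a x)\<^sup>2 + (b x)\<^sup>2)"
      by (auto intro: order_trans)
  qed simp
  have "(\<integral>\<^sup>+x. ennreal \<bar>a x\<bar> * ennreal \<bar>b x\<bar> \<partial>M)\<^sup>2 \<le> (\<integral>\<^sup>+x. (ennreal \<bar>a x\<bar>)\<^sup>2 \<partial>M) * (\<integral>\<^sup>+x. (ennreal \<bar>b x\<bar>)\<^sup>2 \<partial>M)"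
    by (rule Cauchy_Schwarz_nn_integral) auto
  also have "(\<integral>\<^sup>+x. ennreal \<bar>a x\<bar> * ennreal \<bar>b x\<bar> \<partial>M) = ennreal (\<integral>x. \<bar>a x * b x\<bar> \<partial>M)"
    using integrable_abs[OF i] by (subst nn_integral_eq_integral[symmetric]) (auto simp: abs_mult ennreal_mult)
  also have "(\<integral>\<^sup>+x. (ennreal \<bar>a x\<bar>)\<^sup>2 \<partial>M) = ennreal (\<integral>x. (a x)\<^sup>2 \<partial>M)"
    using a by (subst nn_integral_eq_integral[symmetric]) (auto simp: ennreal_power)
  also have "(\<integral>\<^sup>+x. (ennreal \<bar>b x\<bar>)\<^sup>2 \<partial>M) = ennreal (\<integral>x. (b x)\<^sup>2 \<partial>M)"
    using b by (subst nn_integral_eq_integral[symmetric]) (auto simp: ennreal_power)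
  finally show *: "(\<integral>x. \<bar>a x * b x\<bar> \<partial>M)\<^sup>2 \<le> (\<integral>x. (a x)\<^sup>2 \<partial>M) * (\<integral>x. (b x)\<^sup>2 \<partial>M)"
    by (simp add: ennreal_power flip: ennreal_mult)
  have "(\<integral>x. a x * b x \<partial>M)\<^sup>2 \<le> (\<integral>x. \<bar>a x * b x\<bar> \<partial>M)\<^sup>2"
    using integral_abs_bound[of M "\<lambda>x. a x * b x"] by (metis abs_ge_zero power2_abs power_mono)
  with * show "(\<integral>x. a x * b x \<partial>M)\<^sup>2 \<le> (\<integral>x. (a x)\<^sup>2 \<partial>M) * (\<integral>x. (b x)\<^sup>2 \<partial>M)" by simp
qed

text \<open>Cauchy-Schwarz for \<open>sqrt g\<close> and \<open>norm h / sqrt g\<close>. Since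
  division by zero yields zero, the quotient does not see \<open>h\<close> where \<open>g\<close>
  vanishes; the last hypothesis rules out mass of \<open>h\<close> there.\<close>

lemma Cauchy_Schwarz_weighted:
  fixes g :: "'a \<Rightarrow> real" and h :: "'a \<Rightarrow> 'b::{banach, second_countable_topology}"
  assumes g: "integrable M g" and hm[measurable]: "h \<in> borel_measurable M"
    and hg: "integrable M (\<lambda>x. (norm (h x))\<^sup>2 / g x)"
    and g0: "\<And>x. 0 \<le> g x" and z: "AE x in M. g x = 0 \<longrightarrow> h x = 0"
  shows "integrable M h" and "(norm (\<integral>x. h x \<partial>M))\<^sup>2 \<le> (\<integral>x. g x \<partial>M) * (\<integral>x. (norm (h x))\<^sup>2 / g x \<partial>M)"
proof -
  have [measurable]: "g \<in> borel_measurable M" using g by auto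
  have e: "AE x in M. sqrt (g x) * (norm (h x) / sqrt (g x)) = norm (h x)"
    using z by eventually_elim auto
  have a: "integrable M (\<lambda>x. (sqrt (g x))\<^sup>2)" using g g0 by simp
  have b: "integrable M (\<lambda>x. (norm (h x) / sqrt (g x))\<^sup>2)" using hg g0 by (simp add: power_divide)
  note CS = Cauchy_Schwarz_integral[OF _ _ a b]
  have "integrable M (\<lambda>x. sqrt (g x) * (norm (h x) / sqrt (g x)))" by (rule CS(1)) measurable
  then have "integrable M (\<lambda>x. norm (h x))"
    by (rule integrable_cong_AE_imp) (use e in auto)
  then show "integrable M h" by (simp add: integrable_norm_iff)
  have "(\<integral>x. norm (h x) \<partial>M) = (\<integral>x. sqrt (g x) * (norm (h x) / sqrt (g x)) \<partial>M)"
    by (rule integral_cong_AE) (use e in auto)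
  also have "\<dots>\<^sup>2 \<le> (\<integral>x. (sqrt (g x))\<^sup>2 \<partial>M) * (\<integral>x. (norm (h x) / sqrt (g x))\<^sup>2 \<partial>M)"
    by (rule CS(3)) measurable
  finally have "(\<integral>x. norm (h x) \<partial>M)\<^sup>2 \<le> (\<integral>x. g x \<partial>M) * (\<integral>x. (norm (h x))\<^sup>2 / g x \<partial>M)"
    using g0 by (simp add: power_divide)
  moreover have "(norm (\<integral>x. h x \<partial>M))\<^sup>2 \<le> (\<integral>x. norm (h x) \<partial>M)\<^sup>2"
    by (intro power_mono integral_norm_bound) auto
  ultimately show "(norm (\<integral>x. h x \<partial>M))\<^sup>2 \<le> (\<integral>x. g x \<partial>M) * (\<integral>x. (norm (h x))\<^sup>2 / g x \<partial>M)"
    by (rule order_trans[rotated])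
qed

section \<open>The Ornstein--Uhlenbeck semigroup\<close>

abbreviation gauss2 :: "((real^'n) \<times> (real^'n)) measure" where
  "gauss2 \<equiv> gaussian \<Otimes>\<^sub>M gaussian"

lemma sets_gauss2 [measurable_cong]: "sets gauss2 = sets (borel \<Otimes>\<^sub>M borel)"
  by (simp cong: sets_pair_measure_cong)

lemma distr_fst_gauss2: "distr gauss2 borel fst = (gaussian :: (real^'n) measure)"
  using prob_space.distr_pair_fst[OF prob_space_gaussian[where 'n='n], of "gaussian :: (real^'n) measure"]
  by (simp cong: distr_cong)

lemma integrable_gauss2_fst:
  fixes f :: "real^'n \<Rightarrow> 'b::{banach, second_countable_topology}"
  assumes [measurable]: "f \<in> borel_measurable borel"
  shows "integrable gauss2 (\<lambda>p. f (fst p)) \<longleftrightarrow> integrable gaussian f"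
  using integrable_distr_eq[of fst gauss2 borel f] by (simp add: distr_fst_gauss2)

lemma integral_gauss2_fst:
  fixes f :: "real^'n \<Rightarrow> 'b::{banach, second_countable_topology}"
  assumes [measurable]: "f \<in> borel_measurable borel"
  shows "(\<integral>p. f (fst p) \<partial>gauss2) = (\<integral>x. f x \<partial>gaussian)"
  using integral_distr[of fst gauss2 borel f] by (simp add: distr_fst_gauss2)

lemma integrable_gauss2_quadratic:
  fixes f :: "(real^'n) \<times> (real^'n) \<Rightarrow> 'b::{banach, second_countable_topology}"
  assumes [measurable]: "f \<in> borel_measurable (borel \<Otimes>\<^sub>M borel)"
    and b: "\<And>x y. norm (f (x, y)) \<le> C * (1 + (norm x)\<^sup>2 + (norm y)\<^sup>2)"
  shows "integrable gauss2 f"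
proof (rule Bochner_Integration.integrable_bound)
  have 1: "integrable gauss2 (\<lambda>p::(real^'n) \<times> (real^'n). (norm (fst p))\<^sup>2)"
    using integrable_gaussian_norm_sq by (subst integrable_gauss2_fst[of "\<lambda>x. (norm x)\<^sup>2"]) auto
  then have "integrable gauss2 (\<lambda>(x,y). (norm (fst (y::real^'n,x::real^'n)))\<^sup>2)"
    by (rule gaussian_pair.integrable_product_swap)
  then have 2: "integrable gauss2 (\<lambda>p::(real^'n) \<times> (real^'n). (norm (snd p))\<^sup>2)"
    by (simp add: case_prod_beta')
  show "integrable gauss2 (\<lambda>p::(real^'n) \<times> (real^'n). C * (1 + (norm (fst p))\<^sup>2 + (norm (snd p))\<^sup>2))"
    using 1 2 by (intro integrable_mult_right Bochner_Integration.integrable_add) auto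
  show "AE p in gauss2. norm (f p) \<le> norm (C * (1 + (norm (fst p))\<^sup>2 + (norm (snd p))\<^sup>2))"
  proof (rule AE_I2)
    fix p show "norm (f p) \<le> norm (C * (1 + (norm (fst p))\<^sup>2 + (norm (snd p))\<^sup>2))"
      using b[of "fst p" "snd p"] by (simp add: order_trans[OF _ abs_ge_self])
  qed
qed simp

text \<open>In the variable c = exp (- t) the semigroup law becomes multiplication and the
  commutation with the gradient a factor c. Values in a Banach space allow the operator to act on
  gradients.\<close>

definition ou :: "real \<Rightarrow> (real^'n \<Rightarrow> 'b::{banach, second_countable_topology}) \<Rightarrow> real^'n \<Rightarrow> 'b" where
  "ou c f x = (\<integral>y. f (c *\<^sub>R x + sqrt (1 - c\<^sup>2) *\<^sub>R y) \<partial>gaussian)"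

lemma OU_eq_ou: "OU t f = ou (exp (- t)) f"
  by (simp add: OU_def ou_def fun_eq_iff flip: exp_double)

lemma borel_measurable_ou [measurable]:
  assumes [measurable]: "f \<in> borel_measurable borel"
  shows "ou c f \<in> borel_measurable borel"
  unfolding ou_def by measurable

lemma ou_one [simp]: "ou 1 f x = f x"
  by (simp add: ou_def)

lemma integrable_gauss2_rotate:
  fixes f :: "real^'n \<Rightarrow> 'b::{banach, second_countable_topology}"
  assumes [measurable]: "f \<in> borel_measurable borel" and cs: "c\<^sup>2 + s\<^sup>2 = 1" "c \<noteq> 0"
  shows "integrable gauss2 (\<lambda>p. f (c *\<^sub>R fst p + s *\<^sub>R snd p)) \<longleftrightarrow> integrable gaussian f"
  using integrable_reflect[OF _ cs, of "\<lambda>p. f (fst p)"] by (simp add: reflect_def integrable_gauss2_fst)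

lemma integral_gauss2_rotate:
  fixes f :: "real^'n \<Rightarrow> 'b::{banach, second_countable_topology}"
  assumes [measurable]: "f \<in> borel_measurable borel" and cs: "c\<^sup>2 + s\<^sup>2 = 1" "c \<noteq> 0"
  shows "(\<integral>p. f (c *\<^sub>R fst p + s *\<^sub>R snd p) \<partial>gauss2) = (\<integral>x. f x \<partial>gaussian)"
  using integral_reflect[OF _ cs, of "\<lambda>p. f (fst p)"] by (simp add: reflect_def integral_gauss2_fst)

context
  fixes c s :: real
  assumes c: "0 < c" "c \<le> 1" and s: "s = sqrt (1 - c\<^sup>2)"
begin

lemma cs_sq: "c\<^sup>2 + s\<^sup>2 = 1" "c \<noteq> 0" "0 \<le> s"
  using c s by (auto simp: power_le_one)

lemma reflect_involution: "reflect c s (reflect c s p) = (p :: 'a::real_vector \<times> 'a)"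
proof -
  have 1: "c *\<^sub>R (c *\<^sub>R x + s *\<^sub>R y) + s *\<^sub>R (s *\<^sub>R x - c *\<^sub>R y) = (c\<^sup>2 + s\<^sup>2) *\<^sub>R x" for x y :: 'a
    by (simp add: algebra_simps power2_eq_square)
  have 2: "s *\<^sub>R (c *\<^sub>R x + s *\<^sub>R y) - c *\<^sub>R (s *\<^sub>R x - c *\<^sub>R y) = (c\<^sup>2 + s\<^sup>2) *\<^sub>R y" for x y :: 'a
    by (simp add: algebra_simps power2_eq_square)
  show ?thesis
    unfolding reflect_def using 1 2 cs_sq by (simp add: prod_eq_iff)
qed

context
  fixes f :: "real^'n \<Rightarrow> 'b::{banach, second_countable_topology}"
  assumes f: "integrable gaussian f"
begin

text \<open>For an integrable but unbounded \<open>f\<close> the integral defining \<open>ou\<close>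
  need only exist at almost every point. Fubini for the rotated function on the product yields this
  together with the invariance of the Gaussian.\<close>

lemma AE_integrable_ou: "AE x in gaussian. integrable gaussian (\<lambda>y. f (c *\<^sub>R x + s *\<^sub>R y))"
  and integrable_ou: "integrable gaussian (ou c f)"
  and integral_ou: "(\<integral>x. ou c f x \<partial>gaussian) = (\<integral>x. f x \<partial>gaussian)"
proof -
  have [measurable]: "f \<in> borel_measurable borel"
    using borel_measurable_integrable[OF f] by (simp cong: measurable_cong_sets)
  have i: "integrable gauss2 (case_prod (\<lambda>x y. f (c *\<^sub>R x + s *\<^sub>R y)))"
    using f integrable_gauss2_rotate[OF _ cs_sq(1,2), of f] by (simp add: case_prod_beta')
  show "AE x in gaussian. integrable gaussian (\<lambda>y. f (c *\<^sub>R x + s *\<^sub>R y))"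
    by (rule gaussian_pair.AE_integrable_fst[OF i])
  show "integrable gaussian (ou c f)"
    using gaussian_pair.integrable_fst[OF i] by (simp add: ou_def[abs_def] s)
  show "(\<integral>x. ou c f x \<partial>gaussian) = (\<integral>x. f x \<partial>gaussian)"
    using gaussian_pair.integral_fst[OF i] integral_gauss2_rotate[OF _ cs_sq(1,2), of f]
    by (simp add: ou_def[abs_def] s case_prod_beta')
qed

end

lemma integral_ou_weight:
  fixes f :: "real^'n \<Rightarrow> real" and k :: "real^'n \<Rightarrow> 'b::{banach, second_countable_topology}"
  assumes [measurable]: "f \<in> borel_measurable borel" "k \<in> borel_measurable borel"
    and i: "integrable gauss2 (\<lambda>p. f (c *\<^sub>R fst p + s *\<^sub>R snd p) *\<^sub>R k (fst p))"
  shows "(\<integral>p. f (c *\<^sub>R fst p + s *\<^sub>R snd p) *\<^sub>R k (fst p) \<partial>gauss2) = (\<integral>x. ou c f x *\<^sub>R k x \<partial>gaussian)"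
    and "integrable gaussian (\<lambda>x. ou c f x *\<^sub>R k x)"
proof -
  have i': "integrable gauss2 (case_prod (\<lambda>x y. f (c *\<^sub>R x + s *\<^sub>R y) *\<^sub>R k x))"
    using i by (simp add: case_prod_beta')
  \<comment> \<open>Where \<open>k x = 0\<close> both sides vanish even if the slice of
    \<open>f\<close> is not integrable; elsewhere division by \<open>norm (k x)\<close> recovers
    integrability of the slice.\<close>
  have e: "(\<integral>y. f (c *\<^sub>R x + s *\<^sub>R y) *\<^sub>R k x \<partial>gaussian) = ou c f x *\<^sub>R k x" if "k x \<noteq> 0 \<Longrightarrow> integrable gaussian (\<lambda>y. f (c *\<^sub>R x + s *\<^sub>R y))" for x
    by (cases "k x = 0") (use that in \<open>auto simp: ou_def s\<close>)
  have ae: "AE x in gaussian. (\<integral>y. f (c *\<^sub>R x + s *\<^sub>R y) *\<^sub>R k x \<partial>gaussian) = ou c f x *\<^sub>R k x"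
    using gaussian_pair.AE_integrable_fst[OF i']
  proof eventually_elim
    case (elim x)
    show ?case
    proof (rule e)
      assume "k x \<noteq> 0"
      have "integrable gaussian (\<lambda>y. norm (f (c *\<^sub>R x + s *\<^sub>R y) *\<^sub>R k x) / norm (k x))"
        using elim by (intro integrable_divide integrable_norm)
      then have "integrable gaussian (\<lambda>y. norm (f (c *\<^sub>R x + s *\<^sub>R y)))" using \<open>k x \<noteq> 0\<close> by simp
      then show "integrable gaussian (\<lambda>y. f (c *\<^sub>R x + s *\<^sub>R y))" by (subst (asm) integrable_norm_iff) auto
    qed
  qed
  show "integrable gaussian (\<lambda>x. ou c f x *\<^sub>R k x)"
    by (rule integrable_cong_AE_imp[OF gaussian_pair.integrable_fst[OF i'] _ ae]) measurable
  have "(\<integral>p. f (c *\<^sub>R fst p + s *\<^sub>R snd p) *\<^sub>R k (fst p) \<partial>gauss2) = (\<integral>x. (\<integral>y. f (c *\<^sub>R x + s *\<^sub>R y) *\<^sub>R k x \<partial>gaussian) \<partial>gaussian)"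
    using gaussian_pair.integral_fst[OF i'] by (simp add: case_prod_beta')
  also have "\<dots> = (\<integral>x. ou c f x *\<^sub>R k x \<partial>gaussian)"
    by (rule integral_cong_AE) (use ae in auto)
  finally show "(\<integral>p. f (c *\<^sub>R fst p + s *\<^sub>R snd p) *\<^sub>R k (fst p) \<partial>gauss2) = (\<integral>x. ou c f x *\<^sub>R k x \<partial>gaussian)" .
qed

end

lemma ou_bound:
  fixes f :: "real^'n \<Rightarrow> 'b::{banach, second_countable_topology}"
  assumes "f \<in> borel_measurable borel" "\<And>x. norm (f x) \<le> L"
  shows "norm (ou c f x) \<le> L"
proof -
  have "norm (ou c f x) \<le> (\<integral>y. norm (f (c *\<^sub>R x + sqrt (1 - c\<^sup>2) *\<^sub>R y)) \<partial>gaussian)"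
    unfolding ou_def by (rule integral_norm_bound)
  also have "\<dots> \<le> (\<integral>y. L \<partial>(gaussian :: (real^'n) measure))"
    by (rule integral_mono) (use assms in \<open>auto intro!: integrable_gaussian_bounded[where C=L]\<close>)
  finally show ?thesis by simp
qed

text \<open>Two independent noises add up to one of variance 1 - (d c)^2. After normalisation by
  \<sigma> their coefficients \<open>a\<close> and \<open>e\<close> lie on the unit circle, so
  \<open>a *\<^sub>R z + e *\<^sub>R y\<close> is again standard Gaussian.\<close>

lemma ou_semigroup:
  fixes f :: "real^'n \<Rightarrow> 'b::{banach, second_countable_topology}"
  assumes [measurable]: "f \<in> borel_measurable borel" and b: "\<And>x. norm (f x) \<le> L"
    and c: "0 < c" "c \<le> 1" and d: "0 < d" "d \<le> 1"
  shows "ou d (ou c f) x = ou (d * c) f x"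
\<comment> \<open>At \<open>c = 1\<close> the coefficient \<open>a\<close> would be zero, which the
  rotation lemma excludes.\<close>
proof (cases "c = 1")
  case True
  then show ?thesis by (simp add: ou_def)
next
  case False
  then have c1: "c < 1" using c by simp
  have dc: "d * c < 1"
    using mult_left_le_one_le[of c d] c c1 d by linarith
  have sq: "c\<^sup>2 < 1" "d\<^sup>2 \<le> 1" "(d * c)\<^sup>2 < 1"
    using c1 dc c d by (auto simp: power_le_one abs_square_less_1 abs_mult)
  define \<sigma> where "\<sigma> = sqrt (1 - (d * c)\<^sup>2)"
  define a where "a = sqrt (1 - c\<^sup>2) / \<sigma>"
  define e where "e = c * sqrt (1 - d\<^sup>2) / \<sigma>"
  have \<sigma>: "\<sigma> > 0" "\<sigma>\<^sup>2 = 1 - (d * c)\<^sup>2" using sq by (auto simp: \<sigma>_def)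
  have a: "a \<noteq> 0" using sq \<sigma> by (simp add: a_def)
  have ae: "a\<^sup>2 + e\<^sup>2 = 1"
  proof -
    have "a\<^sup>2 + e\<^sup>2 = ((1 - c\<^sup>2) + c\<^sup>2 * (1 - d\<^sup>2)) / \<sigma>\<^sup>2"
      unfolding a_def e_def using sq by (simp add: power_divide power_mult_distrib add_divide_distrib)
    also have "(1 - c\<^sup>2) + c\<^sup>2 * (1 - d\<^sup>2) = \<sigma>\<^sup>2"
      unfolding \<sigma> by (simp add: algebra_simps power_mult_distrib)
    finally show ?thesis using \<sigma>(1) by simp
  qed
  define F where "F u = f ((d * c) *\<^sub>R x + \<sigma> *\<^sub>R u)" for u
  have [measurable]: "F \<in> borel_measurable borel" unfolding F_def by measurable
  have Fb: "norm (F u) \<le> L" for u by (simp add: F_def b)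
  have Fi: "integrable gaussian F" by (rule integrable_gaussian_bounded[OF _ Fb]) measurable
  have e: "c *\<^sub>R (d *\<^sub>R x + sqrt (1 - d\<^sup>2) *\<^sub>R y) + sqrt (1 - c\<^sup>2) *\<^sub>R z = (d * c) *\<^sub>R x + \<sigma> *\<^sub>R (a *\<^sub>R z + e *\<^sub>R y)" for y z
    using \<sigma> by (simp add: a_def e_def algebra_simps)
  have i: "integrable gauss2 (case_prod (\<lambda>z y. F (a *\<^sub>R z + e *\<^sub>R y)))"
    using Fi integrable_gauss2_rotate[OF _ ae a, of F] by (simp add: case_prod_beta')
  have "ou d (ou c f) x = (\<integral>y. \<integral>z. F (a *\<^sub>R z + e *\<^sub>R y) \<partial>gaussian \<partial>gaussian)"
    unfolding ou_def F_def e ..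
  also have "\<dots> = (\<integral>p. F (a *\<^sub>R fst p + e *\<^sub>R snd p) \<partial>gauss2)"
    using gaussian_pair.integral_snd[OF i] by (simp add: case_prod_beta')
  also have "\<dots> = (\<integral>x. F x \<partial>gaussian)"
    by (rule integral_gauss2_rotate[OF _ ae a]) measurable
  also have "\<dots> = ou (d * c) f x"
    by (simp add: F_def ou_def \<sigma>_def)
  finally show ?thesis .
qed

text \<open>For a centered probability density and a unit vector \<open>u\<close> this is the
  variance in direction \<open>u\<close> minus one. It is kept as a term because the regular
  approximations need not inherit the covariance bound.\<close>

abbreviation excess_var :: "real^'n \<Rightarrow> (real^'n \<Rightarrow> real) \<Rightarrow> real" where
  "excess_var u g \<equiv> (\<integral>x. ((u \<bullet> x)\<^sup>2 - 1) * g x \<partial>gaussian)"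

text \<open>With \<open>h\<close> the gradient of \<open>g\<close>, the Fisher information of
  \<open>ou c g\<close> itself is c^2 times this quantity; dropping the factor makes it monotone as
  an average of squared conditional scores. A scalar \<open>h\<close> gives the directional
  version.\<close>

definition fisher :: "real \<Rightarrow> (real^'n \<Rightarrow> real) \<Rightarrow> (real^'n \<Rightarrow> 'b::{banach, second_countable_topology}) \<Rightarrow> real" where
  "fisher c g h = (\<integral>x. (norm (ou c h x))\<^sup>2 / ou c g x \<partial>gaussian)"

section \<open>Decay of the Fisher information\<close>

lemma ou_lower:
  fixes f :: "real^'n \<Rightarrow> real"
  assumes [measurable]: "f \<in> borel_measurable borel" and "\<And>x. \<epsilon> \<le> f x" "\<And>x. \<bar>f x\<bar> \<le> L"
  shows "\<epsilon> \<le> ou c f x"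
proof -
  have "(\<integral>y. \<epsilon> \<partial>(gaussian :: (real^'n) measure)) \<le> ou c f x"
    unfolding ou_def
    by (rule integral_mono) (use assms in \<open>auto intro!: integrable_gaussian_bounded[where C=L]\<close>)
  then show ?thesis by simp
qed

text \<open>Conditional variance decomposition: with \<open>w = d x + s y\<close>, the vector \<open>ou d h x / ou d g x\<close> is the
  conditional expectation of the score \<open>h w / g w\<close> given \<open>x\<close>, under the law with density \<open>g w\<close>.\<close>
lemma fisher_decrement:
  fixes g :: "real^'n \<Rightarrow> real" and h :: "real^'n \<Rightarrow> 'b::euclidean_space"
  assumes [measurable]: "g \<in> borel_measurable borel" "h \<in> borel_measurable borel"
    and \<epsilon>: "0 < \<epsilon>" and g: "\<And>x. \<epsilon> \<le> g x" "\<And>x. g x \<le> M" and h: "\<And>x. norm (h x) \<le> L"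
    and d: "0 < d" "d \<le> 1" and s: "s = sqrt (1 - d\<^sup>2)"
  defines "D \<equiv> (\<lambda>p. (h (d *\<^sub>R fst p + s *\<^sub>R snd p) /\<^sub>R g (d *\<^sub>R fst p + s *\<^sub>R snd p)) - (ou d h (fst p) /\<^sub>R ou d g (fst p)))"
  shows "integrable gauss2 (\<lambda>p. g (d *\<^sub>R fst p + s *\<^sub>R snd p) * (norm (D p))\<^sup>2)"
    and "(\<integral>p. g (d *\<^sub>R fst p + s *\<^sub>R snd p) * (norm (D p))\<^sup>2 \<partial>gauss2) = fisher 1 g h - fisher d g h"
proof -
  have M: "0 < M" using \<epsilon> g[of undefined] by simp
  have L: "0 \<le> L" using h[of undefined] norm_ge_zero[of "h undefined"] by linarith
  have gb: "\<bar>g x\<bar> \<le> M" for x using g[of x] \<epsilon> by simp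
  define p where "p = ou d g"
  define G where "G = ou d h"
  have p: "\<epsilon> \<le> p x" "\<bar>p x\<bar> \<le> M" for x
    using ou_lower[of g \<epsilon> M] g(1) gb ou_bound[of g M] by (auto simp: p_def)
  have G: "norm (G x) \<le> L" for x
    using ou_bound[of h L] h by (auto simp: G_def)
  have p0: "p x > 0" "g x > 0" for x using \<epsilon> p(1)[of x] g(1)[of x] by auto
  have [measurable]: "p \<in> borel_measurable borel" "G \<in> borel_measurable borel"
    unfolding p_def G_def by auto
  define S where "S x = G x /\<^sub>R p x" for x
  have [measurable]: "S \<in> borel_measurable borel" unfolding S_def by measurable
  have Sb: "norm (S x) \<le> L / \<epsilon>" for x
  proof -
    have "norm (S x) = norm (G x) / p x" using p0(1)[of x] by (simp add: S_def divide_inverse mult.commute)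
    also have "\<dots> \<le> L / \<epsilon>" using G p \<epsilon> L p0 by (intro frac_le) auto
    finally show ?thesis .
  qed
  define W where "W q = d *\<^sub>R fst q + s *\<^sub>R snd q" for q :: "(real^'n) \<times> (real^'n)"
  have [measurable]: "W \<in> borel_measurable (borel \<Otimes>\<^sub>M borel)" unfolding W_def by measurable
  have cs: "d\<^sup>2 + s\<^sup>2 = 1" "d \<noteq> 0" using cs_sq[OF d s] by auto
  have bd: "integrable gauss2 k" if "k \<in> borel_measurable (borel \<Otimes>\<^sub>M borel)" "\<And>q. norm (k q) \<le> C"
    for k :: "(real^'n) \<times> (real^'n) \<Rightarrow> real" and C
    using that by (intro gaussian_pair.integrable_const_bound[of _ C]) auto
  have D: "D q = h (W q) /\<^sub>R g (W q) - S (fst q)" for q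
    unfolding D_def S_def p_def G_def W_def ..
  have ex: "g (W q) * (norm (D q))\<^sup>2 = (norm (h (W q)))\<^sup>2 / g (W q) - 2 * (h (W q) \<bullet> S (fst q)) + g (W q) * (norm (S (fst q)))\<^sup>2" for q
  proof -
    have "(norm (D q))\<^sup>2 = (norm (h (W q)))\<^sup>2 / (g (W q))\<^sup>2 - 2 * (h (W q) \<bullet> S (fst q)) / g (W q) + (norm (S (fst q)))\<^sup>2"
      unfolding D power2_norm_eq_inner
      using p0(2)[of "W q"]
      by (simp add: inner_diff_left inner_diff_right inner_commute field_simps power2_eq_square)
    then show ?thesis using p0(2)[of "W q"]
      by (simp add: distrib_left right_diff_distrib power2_eq_square)
  qed
  have i1: "integrable gauss2 (\<lambda>q. (norm (h (W q)))\<^sup>2 / g (W q))"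
    by (rule bd[where C="L\<^sup>2 / \<epsilon>"]) (use h g \<epsilon> L p0 in \<open>auto intro!: frac_le power_mono simp: abs_of_pos\<close>)
  have i2: "integrable gauss2 (\<lambda>q. h (W q) \<bullet> S (fst q))"
  proof (rule bd[where C="L * (L / \<epsilon>)"])
    show "norm (h (W q) \<bullet> S (fst q)) \<le> L * (L / \<epsilon>)" for q
      using order_trans[OF Cauchy_Schwarz_ineq2 mult_mono[OF h Sb L norm_ge_zero], of "W q" "fst q"] by simp
  qed measurable
  have i3: "integrable gauss2 (\<lambda>q. g (W q) * (norm (S (fst q)))\<^sup>2)"
    by (rule bd[where C="M * (L / \<epsilon>)\<^sup>2"])
      (use gb Sb M in \<open>auto intro!: mult_mono power_mono simp: abs_mult\<close>)
  show "integrable gauss2 (\<lambda>p. g (d *\<^sub>R fst p + s *\<^sub>R snd p) * (norm (D p))\<^sup>2)"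
    using i1 i2 i3 unfolding W_def[symmetric] ex by simp
  have 1: "(\<integral>q. (norm (h (W q)))\<^sup>2 / g (W q) \<partial>gauss2) = fisher 1 g h"
    unfolding W_def fisher_def by (subst integral_gauss2_rotate[OF _ cs, of "\<lambda>w. (norm (h w))\<^sup>2 / g w"]) auto
  \<comment> \<open>The cross term and the squared conditional score have the same integral, so the
    expansion collapses to a difference, as for any orthogonal projection.\<close>
  have 2: "(\<integral>q. h (W q) \<bullet> S (fst q) \<partial>gauss2) = fisher d g h"
  proof -
    have "(\<integral>q. h (W q) \<bullet> S (fst q) \<partial>gauss2) = (\<integral>x. (\<integral>y. h (d *\<^sub>R x + s *\<^sub>R y) \<bullet> S x \<partial>gaussian) \<partial>gaussian)"
      using gaussian_pair.integral_fst[of "\<lambda>x y. h (d *\<^sub>R x + s *\<^sub>R y) \<bullet> S x"] i2 unfolding W_def by (simp add: case_prod_beta')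
    also have "\<dots> = (\<integral>x. G x \<bullet> S x \<partial>gaussian)"
      unfolding G_def ou_def s[symmetric]
      by (subst integral_inner_left) (auto intro!: integrable_gaussian_bounded[where C=L] h)
    also have "\<dots> = fisher d g h"
      unfolding fisher_def S_def p_def[symmetric] G_def[symmetric]
      by (simp add: power2_norm_eq_inner divide_inverse mult.commute)
    finally show ?thesis .
  qed
  have 3: "(\<integral>q. g (W q) * (norm (S (fst q)))\<^sup>2 \<partial>gauss2) = fisher d g h"
  proof -
    have "(\<integral>q. g (W q) *\<^sub>R (norm (S (fst q)))\<^sup>2 \<partial>gauss2) = (\<integral>x. p x *\<^sub>R (norm (S x))\<^sup>2 \<partial>gaussian)"
      unfolding p_def W_def by (rule integral_ou_weight[OF d s]) (use i3 in \<open>auto simp: W_def\<close>)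
    also have "(\<lambda>x. p x *\<^sub>R (norm (S x))\<^sup>2) = (\<lambda>x. (norm (G x))\<^sup>2 / p x)"
    proof
      fix x show "p x *\<^sub>R (norm (S x))\<^sup>2 = (norm (G x))\<^sup>2 / p x"
        using p0(1)[of x] by (simp add: S_def power_mult_distrib field_simps power2_eq_square)
    qed
    finally have "(\<integral>q. g (W q) *\<^sub>R (norm (S (fst q)))\<^sup>2 \<partial>gauss2) = (\<integral>x. (norm (G x))\<^sup>2 / p x \<partial>gaussian)" .
    also have "\<dots> = fisher d g h"
      unfolding fisher_def p_def[symmetric] G_def[symmetric] ..
    finally show ?thesis by simp
  qed
  show "(\<integral>p. g (d *\<^sub>R fst p + s *\<^sub>R snd p) * (norm (D p))\<^sup>2 \<partial>gauss2) = fisher 1 g h - fisher d g h"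
    unfolding W_def[symmetric] ex using i1 i2 i3 1 2 3 by simp
qed

text \<open>Differentiability is required only along lines: this is all that the decay estimates
  use, and it passes to \<open>ou c g\<close> by differentiation under the integral.\<close>

locale bounded_pos =
  fixes g :: "real^'n \<Rightarrow> real" and h :: "real^'n \<Rightarrow> real^'n" and \<epsilon> M L :: real
  assumes g_meas [measurable]: "g \<in> borel_measurable borel"
    and h_meas [measurable]: "h \<in> borel_measurable borel"
    and eps_pos: "0 < \<epsilon>"
    and g_lower: "\<epsilon> \<le> g x" and g_upper: "g x \<le> M"
    and h_bound: "norm (h x) \<le> L"
    and line_deriv: "((\<lambda>t. g (x + t *\<^sub>R v)) has_real_derivative v \<bullet> h x) (at 0)"
begin

lemma M_pos: "0 < M" and L_nonneg: "0 \<le> L" and g_pos: "0 < g x" and g_abs: "\<bar>g x\<bar> \<le> M"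
  using eps_pos g_lower[of undefined] g_upper[of undefined] h_bound[of undefined] norm_ge_zero[of "h undefined"]
    g_lower[of x] g_upper[of x] by linarith+

lemma inner_h_bound: "\<bar>u \<bullet> h x\<bar> \<le> norm u * L"
  using Cauchy_Schwarz_ineq2[of u "h x"] h_bound[of x] by (smt (verit) mult_left_mono norm_ge_zero)

lemma ou_bounds: "\<epsilon> \<le> ou c g x" "ou c g x \<le> M" "norm (ou c h x) \<le> L"
  using ou_lower[of g \<epsilon> M] ou_bound[of g M] ou_bound[of h L] g_lower g_abs h_bound
  by (auto simp: abs_le_iff)

lemma ou_inner: "ou c (\<lambda>x. u \<bullet> h x) x = u \<bullet> ou c h x"
  unfolding ou_def by (subst integral_inner_right) (auto intro!: integrable_gaussian_bounded[where C=L] h_bound)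

lemma line_deriv_ou: "((\<lambda>t. ou c g (x + t *\<^sub>R v)) has_real_derivative v \<bullet> (c *\<^sub>R ou c h x)) (at 0)"
proof -
  define s where "s = sqrt (1 - c\<^sup>2)"
  define w where "w t y = c *\<^sub>R (x + t *\<^sub>R v) + s *\<^sub>R y" for t y
  have w: "w t y = (c *\<^sub>R x + s *\<^sub>R y) + t *\<^sub>R (c *\<^sub>R v)" for t y
    by (simp add: w_def algebra_simps)
  have [measurable]: "w t \<in> borel_measurable borel" for t unfolding w_def by measurable
  have "((\<lambda>t. \<integral>y. g (w t y) \<partial>gaussian) has_real_derivative (\<integral>y. (c *\<^sub>R v) \<bullet> h (w 0 y) \<partial>gaussian)) (at 0)"
  proof (rule DERIV_integral_dominated[where B="\<lambda>_. norm (c *\<^sub>R v) * L" and h'="\<lambda>t y. (c *\<^sub>R v) \<bullet> h (w t y)"])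
    show "((\<lambda>t. g (w t y)) has_real_derivative c *\<^sub>R v \<bullet> h (w t y)) (at t)" for t y
      unfolding w by (rule has_real_derivative_shift_line[OF line_deriv])
  qed (use inner_h_bound[of "c *\<^sub>R v"] in \<open>auto intro!: integrable_gaussian_bounded[where C=M] g_abs\<close>)
  also have "(\<lambda>t. \<integral>y. g (w t y) \<partial>gaussian) = (\<lambda>t. ou c g (x + t *\<^sub>R v))"
    by (simp add: ou_def w_def s_def)
  also have "(\<integral>y. (c *\<^sub>R v) \<bullet> h (w 0 y) \<partial>gaussian) = v \<bullet> (c *\<^sub>R ou c h x)"
    by (subst integral_inner_right) (auto intro!: integrable_gaussian_bounded[where C=L] h_bound simp: ou_def w_def s_def)
  finally show ?thesis .
qed

text \<open>Closure under the semigroup with unchanged constants: an estimate for a step from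
  \<open>c = 1\<close> can be restarted at any later time.\<close>

lemma bounded_pos_ou:
  assumes "0 \<le> c" "c \<le> 1"
  shows "bounded_pos (ou c g) (\<lambda>x. c *\<^sub>R ou c h x) \<epsilon> M L"
proof
  have "c * norm (ou c h x) \<le> 1 * L" for x
    using assms ou_bounds(3)[of c x] L_nonneg by (intro mult_mono) auto
  then show "norm (c *\<^sub>R ou c h x) \<le> L" for x using assms by simp
qed (use eps_pos ou_bounds line_deriv_ou in auto)

text \<open>Bookkeeping for such a restart. The gradient of \<open>ou c g\<close> is
  \<open>c\<close> times \<open>ou c h\<close>, whence the square of \<open>c\<close>.\<close>

lemma fisher_semigroup:
  assumes "0 < c" "c \<le> 1" "0 < d" "d \<le> 1"
  shows "fisher d (ou c g) (\<lambda>x. c *\<^sub>R ou c h x) = c\<^sup>2 * fisher (d * c) g h"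
    and "fisher d (ou c g) (\<lambda>x. u \<bullet> (c *\<^sub>R ou c h x)) = c\<^sup>2 * fisher (d * c) g (\<lambda>x. u \<bullet> h x)"
proof -
  have 1: "ou d (ou c g) = ou (d * c) g"
    by (intro ext ou_semigroup[OF _ _ assms, of _ M]) (auto simp: g_abs)
  have 2: "ou d (\<lambda>x. c *\<^sub>R ou c h x) x = c *\<^sub>R ou (d * c) h x" for x
    unfolding ou_semigroup[OF h_meas h_bound assms, symmetric] ou_def[of d] by simp
  interpret N: bounded_pos "ou c g" "\<lambda>x. c *\<^sub>R ou c h x" \<epsilon> M L
    by (rule bounded_pos_ou) (use assms in auto)
  show "fisher d (ou c g) (\<lambda>x. c *\<^sub>R ou c h x) = c\<^sup>2 * fisher (d * c) g h"
    unfolding fisher_def 1 2 by (simp add: power_mult_distrib flip: integral_mult_right_zero)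
  show "fisher d (ou c g) (\<lambda>x. u \<bullet> (c *\<^sub>R ou c h x)) = c\<^sup>2 * fisher (d * c) g (\<lambda>x. u \<bullet> h x)"
    unfolding fisher_def N.ou_inner ou_inner 1 2 
    by (simp add: power_mult_distrib flip: integral_mult_right_zero)
qed

text \<open>Integration by parts for \<open>(u \<bullet> x) * g x\<close> in direction
  \<open>u\<close>; differentiating the linear factor produces the -1 in the excess
  variance.\<close>

lemma integral_score_first_moment:
  assumes u: "norm u = 1"
  shows "(\<integral>x. (u \<bullet> x) * (u \<bullet> h x) \<partial>gaussian) = excess_var u g"
proof -
  have ux: "\<bar>u \<bullet> x\<bar> \<le> norm x" for x using Cauchy_Schwarz_ineq2[of u x] u by simp
  have ux2: "(u \<bullet> x)\<^sup>2 \<le> (norm x)\<^sup>2" for x using ux[of x] by (metis abs_ge_zero power2_abs power_mono)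
  have i1: "integrable gaussian (\<lambda>x. (u \<bullet> x) * g x)"
  proof (rule integrable_gaussian_linear[where C=M])
    show "norm ((u \<bullet> x) * g x) \<le> M * (1 + norm x)" for x
      using mult_mono[OF ux g_abs, of x x] M_pos by (simp add: abs_mult algebra_simps)
  qed measurable
  have i2: "integrable gaussian (\<lambda>x. (u \<bullet> x) * (u \<bullet> h x))"
  proof (rule integrable_gaussian_linear[where C=L])
    show "norm ((u \<bullet> x) * (u \<bullet> h x)) \<le> L * (1 + norm x)" for x
      using mult_mono[OF ux inner_h_bound[of u], of x x] L_nonneg u by (simp add: abs_mult algebra_simps)
  qed measurable
  have i3: "integrable gaussian (\<lambda>x. ((u \<bullet> x)\<^sup>2 - 1) * g x)"
  proof (rule integrable_gaussian_quadratic[where C=M])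
    fix x
    have "\<bar>(u \<bullet> x)\<^sup>2 - 1\<bar> \<le> 1 + (norm x)\<^sup>2" using ux2[of x] zero_le_power2[of "u \<bullet> x"] by linarith
    from mult_mono[OF this g_abs, of x] show "norm (((u \<bullet> x)\<^sup>2 - 1) * g x) \<le> M * (1 + (norm x)\<^sup>2)"
      by (simp add: abs_mult mult.commute)
  qed measurable
  have uu: "u \<bullet> u = 1" using u by (simp add: norm_eq_1)
  have eq: "g x + (u \<bullet> x) * (u \<bullet> h x) - (u \<bullet> x) * ((u \<bullet> x) * g x) = (u \<bullet> x) * (u \<bullet> h x) - ((u \<bullet> x)\<^sup>2 - 1) * g x" for x
    by (simp add: algebra_simps power2_eq_square)
  have "(\<integral>x. (g x + (u \<bullet> x) * (u \<bullet> h x)) - (u \<bullet> x) * ((u \<bullet> x) * g x) \<partial>gaussian) = 0"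
  proof (rule gaussian_ibp[OF i1])
    show "integrable gaussian (\<lambda>x. g x + (u \<bullet> x) * (u \<bullet> h x) - (u \<bullet> x) * ((u \<bullet> x) * g x))"
      unfolding eq using i2 i3 by simp
    have "((\<lambda>t. u \<bullet> (x + t *\<^sub>R u)) has_real_derivative 1) (at 0)" for x
      by (auto intro!: derivative_eq_intros simp: inner_add_right uu)
    from DERIV_mult[OF this line_deriv[of _ u]]
    show "((\<lambda>t. (u \<bullet> (x + t *\<^sub>R u)) * g (x + t *\<^sub>R u)) has_real_derivative g x + (u \<bullet> x) * (u \<bullet> h x)) (at 0)" for x
      by (simp add: mult.commute)
  qed
  then show ?thesis unfolding eq using i2 i3 by simp
qed

text \<open>Integration by parts in the noise variable, which enters \<open>g\<close> only through
  \<open>s *\<^sub>R y\<close> and so yields a factor \<open>s\<close>.\<close>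

lemma integral_noise_weight:
  assumes s: "s = sqrt (1 - d\<^sup>2)"
  shows "(\<integral>y. g (d *\<^sub>R x + s *\<^sub>R y) * (u \<bullet> y) \<partial>gaussian) = s * (u \<bullet> ou d h x)"
proof -
  have eq: "d *\<^sub>R x + s *\<^sub>R (y + t *\<^sub>R u) = (d *\<^sub>R x + s *\<^sub>R y) + t *\<^sub>R (s *\<^sub>R u)" for y t
    by (simp add: algebra_simps)
  have i1: "integrable gaussian (\<lambda>y. (s *\<^sub>R u) \<bullet> h (d *\<^sub>R x + s *\<^sub>R y))"
    using inner_h_bound[of "s *\<^sub>R u"] by (intro integrable_gaussian_bounded[where C="norm (s *\<^sub>R u) * L"]) auto
  have i2: "integrable gaussian (\<lambda>y. (u \<bullet> y) * g (d *\<^sub>R x + s *\<^sub>R y))"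
  proof (rule integrable_gaussian_linear[where C="norm u * M"])
    show "norm ((u \<bullet> y) * g (d *\<^sub>R x + s *\<^sub>R y)) \<le> norm u * M * (1 + norm y)" for y
      using mult_mono[OF norm_inner_le_linear g_abs, of u y "d *\<^sub>R x + s *\<^sub>R y"] by (simp add: abs_mult mult_ac)
  qed measurable
  have "(\<integral>y. (s *\<^sub>R u) \<bullet> h (d *\<^sub>R x + s *\<^sub>R y) - (u \<bullet> y) * g (d *\<^sub>R x + s *\<^sub>R y) \<partial>gaussian) = 0"
  proof (rule gaussian_ibp)
    show "integrable gaussian (\<lambda>y. g (d *\<^sub>R x + s *\<^sub>R y))"
      by (rule integrable_gaussian_bounded[where C=M]) (auto simp: g_abs)
    show "((\<lambda>t. g (d *\<^sub>R x + s *\<^sub>R (y + t *\<^sub>R u))) has_real_derivative s *\<^sub>R u \<bullet> h (d *\<^sub>R x + s *\<^sub>R y)) (at 0)" for y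
      unfolding eq by (rule line_deriv)
  qed (use i1 i2 in auto)
  then have "(\<integral>y. g (d *\<^sub>R x + s *\<^sub>R y) * (u \<bullet> y) \<partial>gaussian) = (\<integral>y. (s *\<^sub>R u) \<bullet> h (d *\<^sub>R x + s *\<^sub>R y) \<partial>gaussian)"
    using i1 i2 by (simp add: mult.commute)
  also have "\<dots> = s * (u \<bullet> ou d h x)"
    by (subst integral_inner_right) (auto intro!: integrable_gaussian_bounded[where C=L] h_bound simp: ou_def s)
  finally show ?thesis .
qed

text \<open>In the reflected coordinates w, z the noise z is centered and independent of w, so it
  integrates to zero against any function of w. Writing x = d w + s z then reduces the first moment
  of \<open>ou d h\<close> to \<open>d\<close> times that of \<open>h\<close>, which is the excess
  variance.\<close>

lemma
  assumes u: "norm u = 1" and d: "0 < d" "d \<le> 1" and s: "s = sqrt (1 - d\<^sup>2)"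
  shows integrable_noise: "integrable gauss2 (\<lambda>q. (u \<bullet> h (d *\<^sub>R fst q + s *\<^sub>R snd q)) * (u \<bullet> (s *\<^sub>R fst q - d *\<^sub>R snd q)))"
    and integral_noise: "(\<integral>q. (u \<bullet> h (d *\<^sub>R fst q + s *\<^sub>R snd q)) * (u \<bullet> (s *\<^sub>R fst q - d *\<^sub>R snd q)) \<partial>gauss2) = 0"
    and integrable_ou_first_moment: "integrable gaussian (\<lambda>x. (u \<bullet> ou d h x) * (u \<bullet> x))"
    and integral_ou_first_moment: "(\<integral>x. (u \<bullet> ou d h x) * (u \<bullet> x) \<partial>gaussian) = d * excess_var u g"
proof -
  note cs = cs_sq[OF d s]
  define hu where "hu x = u \<bullet> h x" for x
  have [measurable]: "hu \<in> borel_measurable borel" unfolding hu_def by measurable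
  have hub: "norm (hu x) \<le> L" for x using inner_h_bound[of u x] u by (simp add: hu_def)
  define w where "w q = d *\<^sub>R fst q + s *\<^sub>R snd q" for q :: "(real^'n) \<times> (real^'n)"
  define z where "z q = s *\<^sub>R fst q - d *\<^sub>R snd q" for q :: "(real^'n) \<times> (real^'n)"
  have [measurable]: "w \<in> borel_measurable (borel \<Otimes>\<^sub>M borel)" "z \<in> borel_measurable (borel \<Otimes>\<^sub>M borel)"
    unfolding w_def z_def by measurable
  have rfl: "reflect d s q = (w q, z q)" for q by (simp add: reflect_def w_def z_def)
  have inv: "d *\<^sub>R w q + s *\<^sub>R z q = fst q" for q
    using arg_cong[OF reflect_involution[OF d s, of q], of fst] unfolding rfl by (simp add: reflect_def w_def)
  have oh: "ou d hu x = u \<bullet> ou d h x" for x unfolding hu_def by (rule ou_inner)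
  have zb: "\<bar>u \<bullet> y\<bar> \<le> 1 + (norm x)\<^sup>2 + (norm y)\<^sup>2" for x y :: "real^'n"
    using Cauchy_Schwarz_ineq2[of u y, unfolded u mult_1] norm_le_one_plus_sq[of y] zero_le_power2[of "norm x"]
    by linarith
  have hz: "integrable gauss2 (\<lambda>p. hu (fst p) * (u \<bullet> snd p))"
  proof (rule integrable_gauss2_quadratic[where C=L])
    show "norm (hu (fst (x, y)) * (u \<bullet> snd (x, y))) \<le> L * (1 + (norm x)\<^sup>2 + (norm y)\<^sup>2)" for x y
      using mult_mono[OF hub[of x] zb[of y x]] L_nonneg by (simp add: abs_mult)
  qed measurable
  have hz0: "integrable gauss2 (\<lambda>q. hu (w q) * (u \<bullet> z q))" "(\<integral>q. hu (w q) * (u \<bullet> z q) \<partial>gauss2) = 0"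
  proof -
    have "(\<integral>p. hu (fst p) * (u \<bullet> snd p) \<partial>gauss2) = 0"
      using gaussian_pair.integral_fst[of "\<lambda>x y. hu x * (u \<bullet> y)"] hz gaussian_mean[of u] by (simp add: case_prod_beta')
    then show "integrable gauss2 (\<lambda>q. hu (w q) * (u \<bullet> z q))" "(\<integral>q. hu (w q) * (u \<bullet> z q) \<partial>gauss2) = 0"
      using integrable_reflect[OF _ cs(1,2), of "\<lambda>p. hu (fst p) * (u \<bullet> snd p)"]
        integral_reflect[OF _ cs(1,2), of "\<lambda>p. hu (fst p) * (u \<bullet> snd p)"] hz
      by (simp_all add: rfl)
  qed
  have uxh: "integrable gaussian (\<lambda>x. (u \<bullet> x) * hu x)"
  proof (rule integrable_gaussian_linear[where C=L])
    show "norm ((u \<bullet> x) * hu x) \<le> L * (1 + norm x)" for x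
      using mult_mono[OF norm_inner_le_linear hub, of u x x] u by (simp add: abs_mult mult.commute)
  qed measurable
  have xG: "integrable gaussian (\<lambda>x. ou d hu x * (u \<bullet> x))" 
    "(\<integral>x. ou d hu x * (u \<bullet> x) \<partial>gaussian) = d * excess_var u g"
  proof -
    have e: "hu (w q) * (u \<bullet> fst q) = d * (hu (w q) * (u \<bullet> w q)) + s * (hu (w q) * (u \<bullet> z q))" for q
      by (subst inv[symmetric]) (simp add: inner_add_right algebra_simps)
    have i: "integrable gauss2 (\<lambda>q. hu (w q) * (u \<bullet> w q))"
      unfolding w_def using uxh by (subst integrable_gauss2_rotate[OF _ cs(1,2), of "\<lambda>x. hu x * (u \<bullet> x)"]) (auto simp: mult.commute)
    have "(\<integral>q. hu (w q) * (u \<bullet> fst q) \<partial>gauss2) = d * (\<integral>q. hu (w q) * (u \<bullet> w q) \<partial>gauss2)"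
      unfolding e using i hz0 by simp
    also have "(\<integral>q. hu (w q) * (u \<bullet> w q) \<partial>gauss2) = (\<integral>x. hu x * (u \<bullet> x) \<partial>gaussian)"
      unfolding w_def by (rule integral_gauss2_rotate[OF _ cs(1,2), of "\<lambda>x. hu x * (u \<bullet> x)"]) measurable
    also have "\<dots> = excess_var u g"
      using integral_score_first_moment[OF u] by (simp add: hu_def mult.commute)
    finally have 1: "(\<integral>q. hu (w q) * (u \<bullet> fst q) \<partial>gauss2) = d * excess_var u g" .
    have 2: "integrable gauss2 (\<lambda>q. hu (w q) * (u \<bullet> fst q))"
      unfolding e using i hz0 by simp
    note W = integral_ou_weight[OF d s, of hu "\<lambda>x. u \<bullet> x"]
    show "integrable gaussian (\<lambda>x. ou d hu x * (u \<bullet> x))"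
      using W(2) 2 by (simp add: w_def)
    show "(\<integral>x. ou d hu x * (u \<bullet> x) \<partial>gaussian) = d * excess_var u g"
      using W(1) 1 2 by (simp add: w_def)
  qed
  show "integrable gauss2 (\<lambda>q. (u \<bullet> h (d *\<^sub>R fst q + s *\<^sub>R snd q)) * (u \<bullet> (s *\<^sub>R fst q - d *\<^sub>R snd q)))"
    "(\<integral>q. (u \<bullet> h (d *\<^sub>R fst q + s *\<^sub>R snd q)) * (u \<bullet> (s *\<^sub>R fst q - d *\<^sub>R snd q)) \<partial>gauss2) = 0"
    "integrable gaussian (\<lambda>x. (u \<bullet> ou d h x) * (u \<bullet> x))"
    "(\<integral>x. (u \<bullet> ou d h x) * (u \<bullet> x) \<partial>gaussian) = d * excess_var u g"
    using hz0 xG unfolding oh by (simp_all add: hu_def w_def z_def)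
qed

text \<open>Cauchy--Schwarz of the score defect \<open>D\<close> against the noise \<open>u \<bullet> z\<close>, where \<open>(w, z)\<close> is the reflection of
  \<open>(x, y)\<close>. The covariance bound enters through the sign of the last integral.\<close>
lemma fisher_step:
  assumes u: "norm u = 1" and d: "0 < d" "d \<le> 1"
  shows "d\<^sup>2 * (1 - d\<^sup>2) * (fisher d g (\<lambda>x. u \<bullet> h x) - excess_var u g)\<^sup>2
      \<le> (fisher 1 g h - fisher d g h) * (\<integral>x. g x \<partial>gaussian)"
    and "fisher d g (\<lambda>x. u \<bullet> h x) \<le> fisher 1 g (\<lambda>x. u \<bullet> h x)"
proof -
  define s where "s = sqrt (1 - d\<^sup>2)"
  note cs = cs_sq[OF d s_def]
  define hu where "hu x = u \<bullet> h x" for x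
  have [measurable]: "hu \<in> borel_measurable borel" unfolding hu_def by measurable
  have hub: "norm (hu x) \<le> L" for x using inner_h_bound[of u x] u by (simp add: hu_def)
  have hui: "integrable gaussian hu" by (rule integrable_gaussian_bounded[OF _ hub]) measurable
  define w where "w q = d *\<^sub>R fst q + s *\<^sub>R snd q" for q :: "(real^'n) \<times> (real^'n)"
  define z where "z q = s *\<^sub>R fst q - d *\<^sub>R snd q" for q :: "(real^'n) \<times> (real^'n)"
  have [measurable]: "w \<in> borel_measurable (borel \<Otimes>\<^sub>M borel)" "z \<in> borel_measurable (borel \<Otimes>\<^sub>M borel)"
    unfolding w_def z_def by measurable
  have rfl: "reflect d s q = (w q, z q)" for q by (simp add: reflect_def w_def z_def)
  have inv: "d *\<^sub>R w q + s *\<^sub>R z q = fst q" for q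
    using arg_cong[OF reflect_involution[OF d s_def, of q], of fst] unfolding rfl by (simp add: reflect_def w_def)
  define D where "D q = hu (w q) /\<^sub>R g (w q) - ou d hu (fst q) /\<^sub>R ou d g (fst q)" for q
  define Dv where "Dv q = h (w q) /\<^sub>R g (w q) - ou d h (fst q) /\<^sub>R ou d g (fst q)" for q
  have [measurable]: "D \<in> borel_measurable (borel \<Otimes>\<^sub>M borel)" unfolding D_def by measurable
  note dec = fisher_decrement[OF g_meas _ eps_pos g_lower g_upper _ d s_def, folded w_def]
  have D1: "integrable gauss2 (\<lambda>q. g (w q) * (norm (D q))\<^sup>2)"
    "(\<integral>q. g (w q) * (norm (D q))\<^sup>2 \<partial>gauss2) = fisher 1 g hu - fisher d g hu"
    unfolding D_def by (rule dec[OF _ hub]; measurable)+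
  have D2: "integrable gauss2 (\<lambda>q. g (w q) * (norm (Dv q))\<^sup>2)"
    "(\<integral>q. g (w q) * (norm (Dv q))\<^sup>2 \<partial>gauss2) = fisher 1 g h - fisher d g h"
    unfolding Dv_def by (rule dec[OF _ h_bound]; measurable)+
  have oh: "ou d hu x = u \<bullet> ou d h x" for x unfolding hu_def by (rule ou_inner)
  \<comment> \<open>Projection onto \<open>u\<close> only shrinks the defect, so the decrement of
    the directional information is at most that of the full one. This transfers a lower bound in
    terms of \<open>u\<close> to the quantity that controls the entropy.\<close>
  have Du: "D q = u \<bullet> Dv q" for q
    by (simp add: D_def Dv_def oh hu_def inner_diff_right)
  have "\<bar>D q\<bar> \<le> norm (Dv q)" for q using Cauchy_Schwarz_ineq2[of u "Dv q"] u by (simp add: Du)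
  then have "g (w q) * (norm (D q))\<^sup>2 \<le> g (w q) * (norm (Dv q))\<^sup>2" for q
    using g_pos[of "w q"] by (intro mult_left_mono power_mono) auto
  from integral_mono[OF D1(1) D2(1) this] have le: "fisher 1 g hu - fisher d g hu \<le> fisher 1 g h - fisher d g h"
    unfolding D1 D2 by simp
  have "0 \<le> (\<integral>q. g (w q) * (norm (D q))\<^sup>2 \<partial>gauss2)"
    using g_pos by (intro integral_nonneg_AE) (auto simp: less_imp_le)
  then show "fisher d g (\<lambda>x. u \<bullet> h x) \<le> fisher 1 g (\<lambda>x. u \<bullet> h x)"
    unfolding D1 hu_def by simp

  \<comment> \<open>The noise has unit variance in direction \<open>u\<close> and is independent of
    w, so its weighted second moment is just the mass of \<open>g\<close>.\<close>
  define N where "N p = g (fst p) * (u \<bullet> snd p)\<^sup>2" for p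
  have [measurable]: "N \<in> borel_measurable (borel \<Otimes>\<^sub>M borel)" unfolding N_def by measurable
  have uq: "(u \<bullet> y)\<^sup>2 \<le> (norm y)\<^sup>2" for y
    using Cauchy_Schwarz_ineq2[of u y] u by (metis abs_ge_zero power2_abs power_mono mult_1)
  have Ni: "integrable gauss2 N"
  proof (rule integrable_gauss2_quadratic[where C=M])
    fix x y
    have "g x * (u \<bullet> y)\<^sup>2 \<le> M * (norm y)\<^sup>2" using g_upper uq g_pos[of x] M_pos by (intro mult_mono) auto
    also have "\<dots> \<le> M * (1 + (norm x)\<^sup>2 + (norm y)\<^sup>2)" using M_pos by simp
    finally show "norm (N (x, y)) \<le> M * (1 + (norm x)\<^sup>2 + (norm y)\<^sup>2)"
      using g_pos[of x] by (simp add: N_def abs_mult)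
  qed measurable
  have N: "(\<integral>p. N p \<partial>gauss2) = (\<integral>x. g x \<partial>gaussian)"
    using gaussian_pair.integral_fst[of "\<lambda>x y. g x * (u \<bullet> y)\<^sup>2"] Ni gaussian_second_moment[of u] u
    unfolding N_def by (simp add: norm_eq_1 case_prod_beta')
  have b2: "integrable gauss2 (\<lambda>q. g (w q) * (u \<bullet> z q)\<^sup>2)" "(\<integral>q. g (w q) * (u \<bullet> z q)\<^sup>2 \<partial>gauss2) = (\<integral>x. g x \<partial>gaussian)"
    using integrable_reflect[OF _ cs(1,2), of N] integral_reflect[OF _ cs(1,2), of N] Ni N
    by (simp_all add: rfl) (simp_all add: N_def)

  have hz0: "integrable gauss2 (\<lambda>q. hu (w q) * (u \<bullet> z q))" "(\<integral>q. hu (w q) * (u \<bullet> z q) \<partial>gauss2) = 0"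
    unfolding hu_def w_def z_def by (fact integrable_noise[OF u d s_def] integral_noise[OF u d s_def])+
  have xG: "integrable gaussian (\<lambda>x. ou d hu x * (u \<bullet> x))"
    "(\<integral>x. ou d hu x * (u \<bullet> x) \<partial>gaussian) = d * excess_var u g"
    unfolding oh by (fact integrable_ou_first_moment[OF u d s_def] integral_ou_first_moment[OF u d s_def])+
  define a where "a q = sqrt (g (w q)) * D q" for q
  define b where "b q = sqrt (g (w q)) * (u \<bullet> z q)" for q
  have [measurable]: "a \<in> borel_measurable (borel \<Otimes>\<^sub>M borel)" "b \<in> borel_measurable (borel \<Otimes>\<^sub>M borel)"
    unfolding a_def b_def by measurable
  have sq: "(a q)\<^sup>2 = g (w q) * (norm (D q))\<^sup>2" "(b q)\<^sup>2 = g (w q) * (u \<bullet> z q)\<^sup>2" for q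
    using g_pos[of "w q"] by (simp_all add: a_def b_def power_mult_distrib)
  have CS: "(\<integral>q. a q * b q \<partial>gauss2)\<^sup>2 \<le> (fisher 1 g hu - fisher d g hu) * (\<integral>x. g x \<partial>gaussian)"
    using Cauchy_Schwarz_integral(3)[of a gauss2 b] D1 b2 by (simp add: sq)

  define S where "S x = ou d hu x / ou d g x" for x
  have [measurable]: "S \<in> borel_measurable borel" unfolding S_def by measurable
  have ab: "a q * b q = hu (w q) * (u \<bullet> z q) - g (w q) * S (fst q) * (u \<bullet> z q)" for q
  proof -
    have "a q * b q = (sqrt (g (w q)))\<^sup>2 * D q * (u \<bullet> z q)" unfolding a_def b_def by (simp add: power2_eq_square)
    also have "(sqrt (g (w q)))\<^sup>2 * D q = hu (w q) - g (w q) * S (fst q)"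
      using g_pos[of "w q"] by (simp add: D_def S_def right_diff_distrib divide_inverse mult.commute)
    finally show ?thesis by (simp add: left_diff_distrib)
  qed
  have abi: "integrable gauss2 (\<lambda>q. a q * b q)"
    using D1(1) b2(1) by (intro Cauchy_Schwarz_integral(1)) (auto simp: sq)
  have gz: "integrable gauss2 (\<lambda>q. g (w q) * S (fst q) * (u \<bullet> z q))"
    using Bochner_Integration.integrable_diff[OF hz0(1) abi] by (simp add: ab)
  have pp: "0 < ou d g x" for x using ou_bounds(1)[of d x] eps_pos by simp
  have SG: "integrable gaussian (\<lambda>x. (norm (ou d hu x))\<^sup>2 / ou d g x)"
  proof (rule integrable_gaussian_bounded[where C="L\<^sup>2 / \<epsilon>"])
    have "norm (ou d hu x) \<le> L" for x by (rule ou_bound[OF _ hub]) measurable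
    then show "norm ((norm (ou d hu x))\<^sup>2 / ou d g x) \<le> L\<^sup>2 / \<epsilon>" for x
    proof -
      assume "\<And>x. norm (ou d hu x) \<le> L"
      then have "(norm (ou d hu x))\<^sup>2 \<le> L\<^sup>2" by (intro power_mono) auto
      then have "(norm (ou d hu x))\<^sup>2 / ou d g x \<le> L\<^sup>2 / \<epsilon>"
        using ou_bounds(1)[of d x] eps_pos by (intro frac_le) auto
      then show "norm ((norm (ou d hu x))\<^sup>2 / ou d g x) \<le> L\<^sup>2 / \<epsilon>"
        using pp[of x] by simp
    qed
  qed measurable
  \<comment> \<open>The noise y is integrated out first. In z = s x - d y the part along x gives the
    first moment of \<open>ou d h\<close>, hence the excess variance; the part along y gives, by
    integration by parts, a squared conditional score, hence \<open>fisher d\<close>.\<close>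
  have "(\<integral>q. g (w q) * S (fst q) * (u \<bullet> z q) \<partial>gauss2) = (\<integral>x. (\<integral>y. g (d *\<^sub>R x + s *\<^sub>R y) * S x * (u \<bullet> (s *\<^sub>R x - d *\<^sub>R y)) \<partial>gaussian) \<partial>gaussian)"
    using gaussian_pair.integral_fst[of "\<lambda>x y. g (w (x,y)) * S x * (u \<bullet> z (x, y))"] gz by (simp add: case_prod_beta' w_def z_def)
  also have "\<dots> = (\<integral>x. s * (ou d hu x * (u \<bullet> x)) - d * s * ((norm (ou d hu x))\<^sup>2 / ou d g x) \<partial>gaussian)"
  proof (rule Bochner_Integration.integral_cong[OF refl])
    fix x
    have gi: "integrable gaussian (\<lambda>y. g (d *\<^sub>R x + s *\<^sub>R y))"
      by (rule integrable_gaussian_bounded[where C=M]) (auto simp: g_abs)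
    have gyi: "integrable gaussian (\<lambda>y. g (d *\<^sub>R x + s *\<^sub>R y) * (u \<bullet> y))"
    proof (rule integrable_gaussian_linear[where C="M"])
      show "norm (g (d *\<^sub>R x + s *\<^sub>R y) * (u \<bullet> y)) \<le> M * (1 + norm y)" for y
        using mult_mono[OF g_abs[of "d *\<^sub>R x + s *\<^sub>R y"] norm_inner_le_linear[of u y]] M_pos u by (simp add: abs_mult)
    qed measurable
    have "(\<integral>y. g (d *\<^sub>R x + s *\<^sub>R y) * S x * (u \<bullet> (s *\<^sub>R x - d *\<^sub>R y)) \<partial>gaussian)
      = (\<integral>y. S x * (s * (u \<bullet> x) * g (d *\<^sub>R x + s *\<^sub>R y) - d * (g (d *\<^sub>R x + s *\<^sub>R y) * (u \<bullet> y))) \<partial>gaussian)"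
      by (simp add: inner_diff_right algebra_simps)
    also have "\<dots> = S x * (s * (u \<bullet> x) * ou d g x - d * (s * (u \<bullet> ou d h x)))"
      using gi gyi integral_noise_weight[OF s_def, of x u] by (simp add: ou_def[of d g] s_def[symmetric])
    also have "\<dots> = s * (ou d hu x * (u \<bullet> x)) - d * s * ((norm (ou d hu x))\<^sup>2 / ou d g x)"
      using pp[of x] by (simp add: S_def oh field_simps power2_eq_square)
    finally show "(\<integral>y. g (d *\<^sub>R x + s *\<^sub>R y) * S x * (u \<bullet> (s *\<^sub>R x - d *\<^sub>R y)) \<partial>gaussian)
      = s * (ou d hu x * (u \<bullet> x)) - d * s * ((norm (ou d hu x))\<^sup>2 / ou d g x)" .
  qed
  also have "\<dots> = s * (d * excess_var u g) - d * s * fisher d g hu"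
    unfolding fisher_def
    by (subst Bochner_Integration.integral_diff[OF integrable_mult_right[OF xG(1)] integrable_mult_right[OF SG]])
      (simp only: integral_mult_right_zero xG(2))
  finally have "(\<integral>q. a q * b q \<partial>gauss2) = d * s * (fisher d g hu - excess_var u g)"
    unfolding ab using hz0 gz by (simp add: algebra_simps)
  with CS have "(d * s * (fisher d g hu - excess_var u g))\<^sup>2
      \<le> (fisher 1 g hu - fisher d g hu) * (\<integral>x. g x \<partial>gaussian)" by simp
  also have "\<dots> \<le> (fisher 1 g h - fisher d g h) * (\<integral>x. g x \<partial>gaussian)"
    using le g_pos by (intro mult_right_mono integral_nonneg_AE) (auto simp: less_imp_le)
  also have "s\<^sup>2 = 1 - d\<^sup>2" using cs(1) by simp
  then have "(d * s * (fisher d g hu - excess_var u g))\<^sup>2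
    = d\<^sup>2 * (1 - d\<^sup>2) * (fisher d g (\<lambda>x. u \<bullet> h x) - excess_var u g)\<^sup>2"
    unfolding hu_def[symmetric] by (simp add: power_mult_distrib)
  finally show "d\<^sup>2 * (1 - d\<^sup>2) * (fisher d g (\<lambda>x. u \<bullet> h x) - excess_var u g)\<^sup>2
      \<le> (fisher 1 g h - fisher d g h) * (\<integral>x. g x \<partial>gaussian)" .
qed

end

section \<open>Entropy production\<close>

context bounded_pos
begin

text \<open>After a restart at \<open>c'\<close> the difference is a conditional variance for the
  ratio \<open>d = c / c'\<close>, hence nonnegative; the common factor c'^2 cancels.\<close>

lemma fisher_mono:
  assumes "0 < c" "c \<le> c'" "c' \<le> 1"
  shows "fisher c g h \<le> fisher c' g h"
    and "norm u = 1 \<Longrightarrow> fisher c g (\<lambda>x. u \<bullet> h x) \<le> fisher c' g (\<lambda>x. u \<bullet> h x)"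
proof -
  define d where "d = c / c'"
  have d: "0 < d" "d \<le> 1" "d * c' = c" and c': "0 < c'" "c' \<le> 1" using assms by (auto simp: d_def)
  interpret N: bounded_pos "ou c' g" "\<lambda>x. c' *\<^sub>R ou c' h x" \<epsilon> M L
    by (rule bounded_pos_ou[OF less_imp_le[OF c'(1)] c'(2)])
  note sg = fisher_semigroup[OF c' d(1,2), unfolded d(3)] fisher_semigroup[OF c', of 1, simplified]
  have "0 \<le> fisher 1 (ou c' g) (\<lambda>x. c' *\<^sub>R ou c' h x) - fisher d (ou c' g) (\<lambda>x. c' *\<^sub>R ou c' h x)"
    unfolding fisher_decrement(2)[OF N.g_meas N.h_meas eps_pos N.g_lower N.g_upper N.h_bound d(1,2) refl, symmetric]
    using N.g_pos by (intro integral_nonneg_AE) (auto simp: less_imp_le)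
  then have "c'\<^sup>2 * fisher c g h \<le> c'\<^sup>2 * fisher c' g h" using sg by simp
  then show "fisher c g h \<le> fisher c' g h" using c' by simp
  show "fisher c g (\<lambda>x. u \<bullet> h x) \<le> fisher c' g (\<lambda>x. u \<bullet> h x)" if "norm u = 1"
  proof -
    have "c'\<^sup>2 * fisher c g (\<lambda>x. u \<bullet> h x) \<le> c'\<^sup>2 * fisher c' g (\<lambda>x. u \<bullet> h x)"
      using N.fisher_step(2)[OF that d(1,2)] sg by simp
    then show ?thesis using c' by simp
  qed
qed

text \<open>The restarted step at time \<open>c\<close>. Directional information and excess variance
  both scale by c^2, so the squared bracket carries c^4 against c^2 on the right, and one factor c^2
  survives on the left.\<close>

lemma fisher_increment:
  assumes u: "norm u = 1" and c: "0 < c" "c \<le> 1" and d: "0 < d" "d \<le> 1"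
  shows "c\<^sup>2 * (d\<^sup>2 * (1 - d\<^sup>2)) * (fisher (d * c) g (\<lambda>x. u \<bullet> h x) - excess_var u g)\<^sup>2
    \<le> (fisher c g h - fisher (d * c) g h) * (\<integral>x. g x \<partial>gaussian)"
proof -
  define V where "V = excess_var u g"
  interpret N: bounded_pos "ou c g" "\<lambda>x. c *\<^sub>R ou c h x" \<epsilon> M L
    by (rule bounded_pos_ou[OF less_imp_le[OF c(1)] c(2)])
  note sg = fisher_semigroup[OF c d] fisher_semigroup[OF c, of 1, simplified]
  have "integrable gaussian g" by (rule integrable_gaussian_bounded[of _ M]) (auto simp: g_abs)
  then have m: "(\<integral>x. ou c g x \<partial>gaussian) = (\<integral>x. g x \<partial>gaussian)"
    by (rule integral_ou[OF c refl])
  have "excess_var u (ou c g) = (\<integral>x. c * ((u \<bullet> ou c h x) * (u \<bullet> x)) \<partial>gaussian)"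
    using N.integral_score_first_moment[OF u] by (simp add: mult_ac)
  also have "\<dots> = c\<^sup>2 * V"
    unfolding V_def by (simp add: integral_ou_first_moment[OF u c refl] power2_eq_square)
  finally have "d\<^sup>2 * (1 - d\<^sup>2) * (c\<^sup>2 * (fisher (d * c) g (\<lambda>x. u \<bullet> h x) - V))\<^sup>2
      \<le> c\<^sup>2 * ((fisher c g h - fisher (d * c) g h) * (\<integral>x. g x \<partial>gaussian))"
    using N.fisher_step(1)[OF u d] unfolding sg m by (simp add: algebra_simps)
  then have "c\<^sup>2 * (c\<^sup>2 * (d\<^sup>2 * (1 - d\<^sup>2)) * (fisher (d * c) g (\<lambda>x. u \<bullet> h x) - V)\<^sup>2)
      \<le> c\<^sup>2 * ((fisher c g h - fisher (d * c) g h) * (\<integral>x. g x \<partial>gaussian))"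
    by (simp add: power_mult_distrib power2_eq_square[of "c\<^sup>2"] mult_ac)
  then show ?thesis using c unfolding V_def by simp
qed

end

section \<open>Entropy along the semigroup, parametrised by an angle\<close>

locale bounded_C1 = bounded_pos g h \<epsilon> M L for g :: "real^'n \<Rightarrow> real" and h \<epsilon> M L +
  assumes gderiv: "GDERIV g x :> h x"
begin

text \<open>With c = cos \<theta> the noise coefficient sqrt (1 - c^2) becomes sin \<theta>, smooth
  up to c = 1, where the square root is not differentiable. The path is curved, so full
  differentiability of \<open>g\<close> is used along it.\<close>

definition arc :: "real \<Rightarrow> real^'n \<Rightarrow> real^'n \<Rightarrow> real^'n" where
  "arc \<theta> x y = cos \<theta> *\<^sub>R x + sin \<theta> *\<^sub>R y"

definition avg :: "real \<Rightarrow> real^'n \<Rightarrow> real" where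
  "avg \<theta> x = (\<integral>y. g (arc \<theta> x y) \<partial>gaussian)"

definition davg :: "real \<Rightarrow> real^'n \<Rightarrow> real" where
  "davg \<theta> x = (\<integral>y. (cos \<theta> *\<^sub>R y - sin \<theta> *\<^sub>R x) \<bullet> h (arc \<theta> x y) \<partial>gaussian)"

lemma arc_meas [measurable]: "(\<lambda>p. arc \<theta> (fst p) (snd p)) \<in> borel_measurable (borel \<Otimes>\<^sub>M borel)"
  "(\<lambda>y. arc \<theta> x y) \<in> borel_measurable borel" "(\<lambda>x. arc \<theta> x y) \<in> borel_measurable borel"
  unfolding arc_def by measurable

lemma avg_meas [measurable]: "avg \<theta> \<in> borel_measurable borel"
  unfolding avg_def arc_def by measurable

lemma davg_meas [measurable]: "davg \<theta> \<in> borel_measurable borel"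
  unfolding davg_def arc_def by measurable

lemma avg_bounds: "\<epsilon> \<le> avg \<theta> x" "avg \<theta> x \<le> M" "0 < avg \<theta> x"
proof -
  have i: "integrable gaussian (\<lambda>y. g (arc \<theta> x y))"
    by (rule integrable_gaussian_bounded[of _ M]) (auto simp: g_abs)
  have "(\<integral>y. \<epsilon> \<partial>(gaussian :: (real^'n) measure)) \<le> avg \<theta> x" "avg \<theta> x \<le> (\<integral>y. M \<partial>(gaussian :: (real^'n) measure))"
    unfolding avg_def by (rule integral_mono; use i g_lower g_upper in auto)+
  then show "\<epsilon> \<le> avg \<theta> x" "avg \<theta> x \<le> M" "0 < avg \<theta> x" using eps_pos by auto
qed

lemma velocity_bound: "\<bar>(cos \<theta> *\<^sub>R y - sin \<theta> *\<^sub>R x) \<bullet> h w\<bar> \<le> L * (norm x + norm y)"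
proof -
  have "norm (cos \<theta> *\<^sub>R y - sin \<theta> *\<^sub>R x) \<le> norm (cos \<theta> *\<^sub>R y) + norm (sin \<theta> *\<^sub>R x)"
    by (rule norm_triangle_ineq4)
  also have "\<dots> \<le> norm y + norm x"
    by (auto intro!: add_mono mult_left_le_one_le)
  finally have "norm (cos \<theta> *\<^sub>R y - sin \<theta> *\<^sub>R x) * L \<le> (norm y + norm x) * L"
    using L_nonneg by (intro mult_right_mono) auto
  then show ?thesis using inner_h_bound[of "cos \<theta> *\<^sub>R y - sin \<theta> *\<^sub>R x" w] by (simp add: mult.commute add.commute)
qed

lemma gnorm_int: "integrable gaussian (\<lambda>y::real^'n. norm y)"
  by (rule integrable_gaussian_linear[where C=1]) auto

lemma gnorm_add_int: "integrable gaussian (\<lambda>y::real^'n. C * (a + norm y))" "integrable gaussian (\<lambda>y::real^'n. C * (norm y + a))"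
  by (intro integrable_mult_right Bochner_Integration.integrable_add gnorm_int gaussian.integrable_const)+

lemma avg_deriv: "((\<lambda>\<theta>. avg \<theta> x) has_real_derivative davg \<theta> x) (at \<theta>)"
  unfolding avg_def davg_def
proof (rule DERIV_integral_dominated[where B="\<lambda>y. L * (norm x + norm y)"])
  show "integrable gaussian (\<lambda>y. g (arc \<theta> x y))" for \<theta>
    by (rule integrable_gaussian_bounded[of _ M]) (auto simp: g_abs)
  show "\<bar>(cos \<theta> *\<^sub>R y - sin \<theta> *\<^sub>R x) \<bullet> h (arc \<theta> x y)\<bar> \<le> L * (norm x + norm y)" for \<theta> y
    by (rule velocity_bound)
  show "integrable gaussian (\<lambda>y::real^'n. L * (norm x + norm y))"
    by (rule gnorm_add_int)
  show "((\<lambda>\<theta>. g (arc \<theta> x y)) has_real_derivative (cos \<theta> *\<^sub>R y - sin \<theta> *\<^sub>R x) \<bullet> h (arc \<theta> x y)) (at \<theta>)" for \<theta> y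
  proof -
    have "((\<lambda>\<theta>. arc \<theta> x y) has_derivative (\<lambda>t. t *\<^sub>R (cos \<theta> *\<^sub>R y - sin \<theta> *\<^sub>R x))) (at \<theta>)"
      unfolding arc_def by (auto intro!: derivative_eq_intros simp: algebra_simps)
    from has_derivative_compose[OF this gderiv[unfolded gderiv_def]]
    show ?thesis
      unfolding has_field_derivative_def by (rule has_derivative_eq_rhs) (simp add: fun_eq_iff mult.commute)
  qed
qed measurable

definition ent :: "real \<Rightarrow> real" where
  "ent \<theta> = (\<integral>x. avg \<theta> x * ln (avg \<theta> x) \<partial>gaussian)"

definition K where "K = \<bar>ln \<epsilon>\<bar> + \<bar>ln M\<bar> + 1"

lemma ln_bound: "\<epsilon> \<le> t \<Longrightarrow> t \<le> M \<Longrightarrow> \<bar>ln t + 1\<bar> \<le> K"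
proof -
  assume t: "\<epsilon> \<le> t" "t \<le> M"
  then have "ln \<epsilon> \<le> ln t" "ln t \<le> ln M" using eps_pos by auto
  then show "\<bar>ln t + 1\<bar> \<le> K" unfolding K_def by linarith
qed

lemma K_pos: "0 < K" unfolding K_def by simp

lemma ent_deriv: "(ent has_real_derivative (\<integral>x. (ln (avg \<theta> x) + 1) * davg \<theta> x \<partial>gaussian)) (at \<theta>)"
  unfolding ent_def[abs_def]
proof (rule DERIV_integral_dominated[where B="\<lambda>x. K * (L * (norm x + (\<integral>y. norm y \<partial>(gaussian::(real^'n) measure))))"])
  show "integrable gaussian (\<lambda>x. avg \<theta> x * ln (avg \<theta> x))" for \<theta>
  proof (rule integrable_gaussian_bounded[where C="M * (K + 1)"])
    fix x
    have "\<bar>ln (avg \<theta> x)\<bar> \<le> K + 1" using ln_bound[OF avg_bounds(1,2)[of \<theta> x]] by linarith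
    then show "norm (avg \<theta> x * ln (avg \<theta> x)) \<le> M * (K + 1)"
      using avg_bounds[of \<theta> x] M_pos by (auto simp: abs_mult intro!: mult_mono)
  qed measurable
  show "((\<lambda>\<theta>. avg \<theta> x * ln (avg \<theta> x)) has_real_derivative (ln (avg \<theta> x) + 1) * davg \<theta> x) (at \<theta>)" for \<theta> x
    using avg_bounds(3)[of \<theta> x]
    by (auto intro!: derivative_eq_intros avg_deriv simp: field_simps)
  show "\<bar>(ln (avg \<theta> x) + 1) * davg \<theta> x\<bar> \<le> K * (L * (norm x + (\<integral>y. norm y \<partial>(gaussian::(real^'n) measure))))" for \<theta> x
  proof -
    have "\<bar>davg \<theta> x\<bar> \<le> (\<integral>y. L * (norm x + norm y) \<partial>(gaussian :: (real^'n) measure))"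
    proof -
      have i: "integrable gaussian (\<lambda>y::real^'n. L * (norm x + norm y))" by (rule gnorm_add_int)
      have i': "integrable gaussian (\<lambda>y. (cos \<theta> *\<^sub>R y - sin \<theta> *\<^sub>R x) \<bullet> h (arc \<theta> x y))"
        by (rule Bochner_Integration.integrable_bound[OF i])
          (use order_trans[OF velocity_bound abs_ge_self] in simp_all)
      have "\<bar>davg \<theta> x\<bar> \<le> (\<integral>y. \<bar>(cos \<theta> *\<^sub>R y - sin \<theta> *\<^sub>R x) \<bullet> h (arc \<theta> x y)\<bar> \<partial>gaussian)"
        unfolding davg_def by (rule integral_abs_bound)
      also have "\<dots> \<le> (\<integral>y. L * (norm x + norm y) \<partial>(gaussian :: (real^'n) measure))"
        by (rule integral_mono[OF integrable_abs[OF i'] i]) (rule velocity_bound)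
      finally show ?thesis .
    qed
    also have "\<dots> = L * (norm x + (\<integral>y. norm y \<partial>(gaussian::(real^'n) measure)))"
      by (simp only: integral_mult_right_zero Bochner_Integration.integral_add[OF gaussian.integrable_const gnorm_int]
          lebesgue_integral_const) simp
    finally show ?thesis
      unfolding abs_mult using ln_bound[OF avg_bounds(1,2)[of \<theta> x]] K_pos by (intro mult_mono) auto
  qed
  show "integrable gaussian (\<lambda>x::real^'n. K * (L * (norm x + (\<integral>y. norm y \<partial>(gaussian::(real^'n) measure)))))"
    by (rule integrable_mult_right) (rule gnorm_add_int)
qed measurable

lemma avg_eq_ou:
  assumes "0 \<le> \<theta>" "\<theta> \<le> pi / 2"
  shows "avg \<theta> = ou (cos \<theta>) g"
proof -
  have "sin \<theta> = sqrt (1 - (cos \<theta>)\<^sup>2)"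
    by (rule sin_cos_sqrt) (use assms in \<open>auto intro!: sin_ge_zero\<close>)
  then show ?thesis by (simp only: fun_eq_iff avg_def ou_def arc_def) simp
qed

text \<open>Passing to \<open>(w, z)\<close> coordinates turns the velocity of the path into the noise \<open>z\<close>, independent of \<open>w\<close>;
  integrating by parts in \<open>z\<close> produces the second derivative of \<open>t ln t\<close>.\<close>
lemma ent_deriv_eq:
  assumes \<theta>: "0 \<le> \<theta>" "\<theta> < pi / 2"
  shows "(\<integral>x. (ln (avg \<theta> x) + 1) * davg \<theta> x \<partial>gaussian) = - (sin \<theta> * cos \<theta> * fisher (cos \<theta>) g h)"
proof -
  define c where "c = cos \<theta>"
  define s where "s = sqrt (1 - c\<^sup>2)"
  have c: "0 < c" "c \<le> 1" unfolding c_def using \<theta> by (auto intro: cos_gt_zero_pi)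
  have s: "sin \<theta> = s" unfolding s_def c_def by (rule sin_cos_sqrt) (use \<theta> in \<open>auto intro!: sin_ge_zero\<close>)
  note cs = cs_sq[OF c s_def]
  have av: "avg \<theta> = ou c g" unfolding c_def by (rule avg_eq_ou) (use \<theta> in auto)
  define \<psi> where "\<psi> x = ln (ou c g x) + 1" for x
  have [measurable]: "\<psi> \<in> borel_measurable borel" unfolding \<psi>_def by measurable
  have \<psi>b: "\<bar>\<psi> x\<bar> \<le> K" for x unfolding \<psi>_def using ou_bounds by (intro ln_bound)
  define T where "T x = ou c h x /\<^sub>R ou c g x" for x
  have [measurable]: "T \<in> borel_measurable borel" unfolding T_def by measurable
  have pp: "0 < ou c g x" for x using ou_bounds(1)[of c x] eps_pos by simp
  have Tb: "norm (T x) \<le> L / \<epsilon>" for x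
  proof -
    have "norm (T x) = norm (ou c h x) / ou c g x" using pp[of x] by (simp add: T_def divide_inverse mult.commute)
    also have "\<dots> \<le> L / \<epsilon>" using ou_bounds[of c x] eps_pos L_nonneg by (intro frac_le) auto
    finally show ?thesis .
  qed
  define w where "w q = c *\<^sub>R fst q + s *\<^sub>R snd q" for q :: "(real^'n) \<times> (real^'n)"
  define z where "z q = s *\<^sub>R fst q - c *\<^sub>R snd q" for q :: "(real^'n) \<times> (real^'n)"
  have [measurable]: "w \<in> borel_measurable (borel \<Otimes>\<^sub>M borel)" "z \<in> borel_measurable (borel \<Otimes>\<^sub>M borel)"
    unfolding w_def z_def by measurable
  have rfl: "reflect c s q = (w q, z q)" for q by (simp add: reflect_def w_def z_def)
  have inv: "w (w q, z q) = fst q" for q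
    using arg_cong[OF reflect_involution[OF c s_def, of q], of fst] unfolding rfl by (simp add: reflect_def w_def)
  define N where "N p = \<psi> (w p) * (h (fst p) \<bullet> snd p)" for p
  have [measurable]: "N \<in> borel_measurable (borel \<Otimes>\<^sub>M borel)" unfolding N_def by measurable
  have hzb: "\<bar>h x \<bullet> y\<bar> \<le> L * norm y" for x y
    using order_trans[OF Cauchy_Schwarz_ineq2 mult_right_mono[OF h_bound]] by simp
  have Nb: "\<bar>N (x, y)\<bar> \<le> K * L * norm y" for x y
    using mult_mono[OF \<psi>b hzb] K_pos by (simp add: N_def abs_mult mult.assoc)
  have Ni: "integrable gauss2 N"
  proof (rule integrable_gauss2_quadratic[where C="K * L"])
    fix x y :: "real^'n"
    have "norm y \<le> 1 + (norm x)\<^sup>2 + (norm y)\<^sup>2"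
      using norm_le_one_plus_sq[of y] zero_le_power2[of "norm x"] by linarith
    from order_trans[OF Nb mult_left_mono[OF this]] K_pos L_nonneg
    show "norm (N (x, y)) \<le> K * L * (1 + (norm x)\<^sup>2 + (norm y)\<^sup>2)" by simp
  qed measurable
  have Ni2: "integrable gauss2 (\<lambda>q. N (w q, z q))"
    using integrable_reflect[OF _ cs(1,2), of N] Ni by (simp add: rfl)
  have hT: "integrable gauss2 (\<lambda>p. h (fst p) \<bullet> T (w p))" "integrable gauss2 (\<lambda>p. h (w p) \<bullet> T (fst p))"
  proof -
    have b: "\<bar>h x \<bullet> T y\<bar> \<le> L * (L / \<epsilon>)" for x y
      using order_trans[OF Cauchy_Schwarz_ineq2 mult_mono[OF h_bound Tb L_nonneg norm_ge_zero]] .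
    show "integrable gauss2 (\<lambda>p. h (fst p) \<bullet> T (w p))" "integrable gauss2 (\<lambda>p. h (w p) \<bullet> T (fst p))"
      using b by (auto intro!: gaussian_pair.integrable_const_bound[of _ "L * (L / \<epsilon>)"])
  qed
  have "(\<integral>x. (ln (avg \<theta> x) + 1) * davg \<theta> x \<partial>gaussian)
      = (\<integral>x. (\<integral>y. - N (w (x, y), z (x, y)) \<partial>gaussian) \<partial>gaussian)"
  proof (rule Bochner_Integration.integral_cong[OF refl])
    fix x
    have e: "- N (w (x, y), z (x, y)) = \<psi> x * ((cos \<theta> *\<^sub>R y - sin \<theta> *\<^sub>R x) \<bullet> h (arc \<theta> x y))" for y
    proof -
      have "w (x, y) = arc \<theta> x y" by (simp add: w_def arc_def s c_def)
      moreover have "cos \<theta> *\<^sub>R y - sin \<theta> *\<^sub>R x = - z (x, y)" by (simp add: z_def s c_def)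
      ultimately show ?thesis
        using inv[of "(x, y)"] by (simp add: N_def inner_commute)
    qed
    show "(ln (avg \<theta> x) + 1) * davg \<theta> x = (\<integral>y. - N (w (x, y), z (x, y)) \<partial>gaussian)"
      unfolding e by (simp add: davg_def av \<psi>_def)
  qed
  also have "\<dots> = - (\<integral>p. N (w p, z p) \<partial>gauss2)"
    using gaussian_pair.integral_fst[of "\<lambda>x y. N (w (x, y), z (x, y))"] Ni2 by (simp add: case_prod_beta')
  also have "(\<integral>p. N (w p, z p) \<partial>gauss2) = (\<integral>p. N p \<partial>gauss2)"
    using integral_reflect[OF _ cs(1,2), of N] by (simp add: rfl)
  also have "\<dots> = (\<integral>x. (\<integral>y. N (x, y) \<partial>gaussian) \<partial>gaussian)"
    using gaussian_pair.integral_fst[of "\<lambda>x y. N (x, y)"] Ni by (simp add: case_prod_beta')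
  also have "\<dots> = (\<integral>x. (\<integral>y. s * c * (h x \<bullet> T (w (x, y))) \<partial>gaussian) \<partial>gaussian)"
  proof (rule Bochner_Integration.integral_cong[OF refl])
    fix x
    have i1: "integrable gaussian (\<lambda>y. N (x, y))"
    proof (rule integrable_gaussian_linear[where C="K * L"])
      show "norm (N (x, y)) \<le> K * L * (1 + norm y)" for y
        using order_trans[OF Nb mult_left_mono[of "norm y" "1 + norm y" "K * L"]] K_pos L_nonneg by simp
    qed measurable
    have i2: "integrable gaussian (\<lambda>y. s * c * (h x \<bullet> T (w (x, y))))"
      using order_trans[OF Cauchy_Schwarz_ineq2 mult_mono[OF h_bound Tb L_nonneg norm_ge_zero]]
      by (intro integrable_mult_right integrable_gaussian_bounded[of _ "L * (L / \<epsilon>)"]) auto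
    have "(\<integral>y. s * c * (h x \<bullet> T (w (x, y))) - (h x \<bullet> y) * \<psi> (w (x, y)) \<partial>gaussian) = 0"
    proof (rule gaussian_ibp)
      show "integrable gaussian (\<lambda>y. \<psi> (w (x, y)))"
        by (rule integrable_gaussian_bounded[of _ K]) (auto simp: \<psi>b)
      show "integrable gaussian (\<lambda>y. s * c * (h x \<bullet> T (w (x, y))) - (h x \<bullet> y) * \<psi> (w (x, y)))"
        using i1 i2 unfolding N_def by (simp add: mult.commute)
      show "((\<lambda>t. \<psi> (w (x, y + t *\<^sub>R h x))) has_real_derivative s * c * (h x \<bullet> T (w (x, y)))) (at 0)" for y
      proof -
        have e: "w (x, y + t *\<^sub>R h x) = w (x, y) + t *\<^sub>R (s *\<^sub>R h x)" for t
          by (simp add: w_def algebra_simps)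
        have "((\<lambda>t. ln (ou c g (w (x, y) + t *\<^sub>R (s *\<^sub>R h x))) + 1) has_real_derivative
            1 / ou c g (w (x, y) + 0 *\<^sub>R (s *\<^sub>R h x)) * ((s *\<^sub>R h x) \<bullet> (c *\<^sub>R ou c h (w (x, y)))) + 0) (at 0)"
          by (intro DERIV_add DERIV_const DERIV_chain2[OF DERIV_ln_divide line_deriv_ou] pp)
        then show ?thesis
          unfolding \<psi>_def e by (simp add: T_def divide_inverse mult_ac)
      qed
    qed
    also have "(\<lambda>y. s * c * (h x \<bullet> T (w (x, y))) - (h x \<bullet> y) * \<psi> (w (x, y))) = (\<lambda>y. s * c * (h x \<bullet> T (w (x, y))) - N (x, y))"
      by (simp add: N_def mult.commute)
    finally show "(\<integral>y. N (x, y) \<partial>gaussian) = (\<integral>y. s * c * (h x \<bullet> T (w (x, y))) \<partial>gaussian)"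
      unfolding Bochner_Integration.integral_diff[OF i2 i1] by linarith
  qed
  also have "\<dots> = s * c * (\<integral>p. h (fst p) \<bullet> T (w p) \<partial>gauss2)"
    using gaussian_pair.integral_fst[of "\<lambda>x y. h x \<bullet> T (w (x, y))"] hT by (simp add: case_prod_beta')
  \<comment> \<open>Reflecting once more makes \<open>T\<close> depend on the outer variable alone,
    so that the inner integral of \<open>h\<close> becomes \<open>ou c h\<close>.\<close>
  also have "(\<integral>p. h (fst p) \<bullet> T (w p) \<partial>gauss2) = (\<integral>p. h (w p) \<bullet> T (fst p) \<partial>gauss2)"
    using integral_reflect[OF _ cs(1,2), of "\<lambda>p. h (fst p) \<bullet> T (w p)"] by (simp add: rfl inv)
  also have "\<dots> = (\<integral>x. (\<integral>y. h (c *\<^sub>R x + s *\<^sub>R y) \<bullet> T x \<partial>gaussian) \<partial>gaussian)"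
    using gaussian_pair.integral_fst[of "\<lambda>x y. h (c *\<^sub>R x + s *\<^sub>R y) \<bullet> T x"] hT unfolding w_def by (simp add: case_prod_beta')
  also have "\<dots> = (\<integral>x. ou c h x \<bullet> T x \<partial>gaussian)"
    unfolding ou_def[of c h] s_def[symmetric]
    by (subst integral_inner_left) (auto intro!: integrable_gaussian_bounded[where C=L] h_bound)
  also have "\<dots> = fisher c g h"
    unfolding fisher_def T_def by (simp add: power2_norm_eq_inner divide_inverse mult.commute)
  finally show ?thesis by (simp add: s c_def)
qed

text \<open>On the interval the Fisher information is at most its value at \<open>a\<close>, and the
  remaining factor sin cos has an explicit primitive. Monotonicity thus gives an upper Riemann
  estimate without any continuity in time.\<close>

lemma ent_decrement:
  assumes "0 \<le> a" "a \<le> b" "b \<le> pi / 2"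
  shows "ent a - ent b \<le> fisher (cos a) g h * ((cos a)\<^sup>2 - (cos b)\<^sup>2) / 2"
proof (cases "a = b")
  case False
  then have ab: "a < b" using assms by simp
  define G where "G t = ent t - fisher (cos a) g h * (cos t)\<^sup>2 / 2" for t
  have dG: "(G has_real_derivative ((\<integral>x. (ln (avg t x) + 1) * davg t x \<partial>gaussian) + fisher (cos a) g h * (sin t * cos t))) (at t)" for t
    unfolding G_def by (auto intro!: derivative_eq_intros ent_deriv simp: power2_eq_square)
  \<comment> \<open>Signs are checked at interior angles only, because the derivative formula
    excludes pi / 2.\<close>
  have "G a \<le> G b"
  proof (rule DERIV_nonneg_imp_increasing_open[OF assms(2)])
    fix t assume t: "a < t" "t < b"
    have ca: "cos a \<le> 1" "0 < cos t" "cos t \<le> cos a"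
      using t assms cos_gt_zero[of t] cos_mono_le_eq[of t a] by auto
    have "0 \<le> (fisher (cos a) g h - fisher (cos t) g h) * (sin t * cos t)"
      using fisher_mono(1)[of "cos t" "cos a"] ca t assms by (auto intro!: mult_nonneg_nonneg sin_ge_zero)
    also have "\<dots> = (\<integral>x. (ln (avg t x) + 1) * davg t x \<partial>gaussian) + fisher (cos a) g h * (sin t * cos t)"
      using ent_deriv_eq[of t] t assms by (simp add: algebra_simps)
    finally show "\<exists>y. (G has_real_derivative y) (at t) \<and> y \<ge> 0" using dG by blast
  next
    show "continuous_on {a..b} G"
      by (rule DERIV_continuous_on[OF has_field_derivative_at_within[OF dG]])
  qed
  then show ?thesis by (simp add: G_def algebra_simps diff_divide_distrib)
qed auto

text \<open>The angle pi / 2 stands for infinite time, where the density has become the constant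
  equal to its mass. The last summand pays for the stretch from the final grid point to there, and
  the mass logarithm remains because \<open>g\<close> is not normalised.\<close>

lemma entropy_le_grid_sum:
  assumes d: "0 < d" "d \<le> 1"
  shows "(\<integral>x. g x * ln (g x) \<partial>gaussian) - (\<integral>x. g x \<partial>gaussian) * ln (\<integral>x. g x \<partial>gaussian)
    \<le> ((\<Sum>k<N. fisher (d ^ k) g h * ((d ^ k)\<^sup>2 - (d ^ Suc k)\<^sup>2)) + fisher (d ^ N) g h * (d ^ N)\<^sup>2) / 2"
proof -
  define \<theta> where "\<theta> k = arccos (d ^ k)" for k
  have dk: "0 < d ^ k" "d ^ k \<le> 1" for k using d by (auto simp: power_le_one)
  have th: "cos (\<theta> k) = d ^ k" "0 \<le> \<theta> k" "\<theta> k \<le> pi / 2" for k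
  proof -
    show "cos (\<theta> k) = d ^ k" unfolding \<theta>_def using dk[of k] by (intro cos_arccos) auto
    show "0 \<le> \<theta> k" unfolding \<theta>_def using dk[of k] by (intro arccos_lbound) auto
    show "\<theta> k \<le> pi / 2" unfolding \<theta>_def using dk[of k] by (intro arccos_le_pi2) auto
  qed
  have mono: "\<theta> k \<le> \<theta> (Suc k)" for k
  proof -
    have "d ^ Suc k \<le> d ^ k" using d by (intro power_decreasing) auto
    then show ?thesis unfolding \<theta>_def using dk[of k] dk[of "Suc k"] by (intro arccos_le_arccos) auto
  qed
  have e0: "ent (\<theta> 0) = (\<integral>x. g x * ln (g x) \<partial>gaussian)"
    by (simp add: ent_def \<theta>_def avg_eq_ou)
  have e1: "ent (pi / 2) = (\<integral>x. g x \<partial>gaussian) * ln (\<integral>x. g x \<partial>gaussian)"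
    by (simp add: ent_def avg_eq_ou ou_def)
  have "ent (\<theta> 0) - ent (\<theta> N) = (\<Sum>k<N. ent (\<theta> k) - ent (\<theta> (Suc k)))"
    by (rule sum_lessThan_telescope'[symmetric])
  also have "\<dots> \<le> (\<Sum>k<N. fisher (d ^ k) g h * ((d ^ k)\<^sup>2 - (d ^ Suc k)\<^sup>2) / 2)"
    using ent_decrement[OF th(2) mono th(3)] by (intro sum_mono) (simp add: th(1))
  finally have "ent (\<theta> 0) - ent (\<theta> N) \<le> (\<Sum>k<N. fisher (d ^ k) g h * ((d ^ k)\<^sup>2 - (d ^ Suc k)\<^sup>2)) / 2"
    by (simp add: sum_divide_distrib)
  moreover have "ent (\<theta> N) - ent (pi / 2) \<le> fisher (d ^ N) g h * (d ^ N)\<^sup>2 / 2"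
    using ent_decrement[OF th(2,3)[of N]] by (simp add: th(1))
  ultimately show ?thesis unfolding e0[symmetric] e1[symmetric] by (simp add: add_divide_distrib)
qed

end

section \<open>Removing the regularity assumptions\<close>

text \<open>The weighted Cauchy-Schwarz inequality on each slice bounds the quotient of averages by
  the average of the quotients, so \<open>ou c F\<close> is an integrable majorant uniform in
  \<open>n\<close>.\<close>

lemma fisher_tendsto:
  fixes g :: "real^'n \<Rightarrow> real" and h :: "real^'n \<Rightarrow> 'b::{banach, second_countable_topology}"
    and gn :: "nat \<Rightarrow> real^'n \<Rightarrow> real" and hn :: "nat \<Rightarrow> real^'n \<Rightarrow> 'b"
  assumes [measurable]: "\<And>n. gn n \<in> borel_measurable borel" "\<And>n. hn n \<in> borel_measurable borel"
      "g \<in> borel_measurable borel" "h \<in> borel_measurable borel"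
    and gn0: "\<And>n x. 0 \<le> gn n x" and g0: "\<And>x. 0 \<le> g x"
    and lim: "\<And>x. (\<lambda>n. gn n x) \<longlonglongrightarrow> g x" "\<And>x. (\<lambda>n. hn n x) \<longlonglongrightarrow> h x"
    and zero: "\<And>n x. gn n x = 0 \<Longrightarrow> hn n x = 0" "\<And>n x. g x = 0 \<Longrightarrow> hn n x = 0"
    and bound: "\<And>n x. gn n x \<le> D x" "\<And>n x. norm (hn n x) \<le> E x" "\<And>n x. (norm (hn n x))\<^sup>2 / gn n x \<le> F x"
    and int: "integrable gaussian D" "integrable gaussian E" "integrable gaussian F"
    and c: "0 < c" "c \<le> 1"
  shows "(\<lambda>n. fisher c (gn n) (hn n)) \<longlonglongrightarrow> fisher c g h"
    and "integrable gaussian (\<lambda>x. (norm (ou c h x))\<^sup>2 / ou c g x)"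
proof -
  define s where "s = sqrt (1 - c\<^sup>2)"
  have [measurable]: "D \<in> borel_measurable borel" "E \<in> borel_measurable borel" "F \<in> borel_measurable borel"
    using int[THEN borel_measurable_integrable] by (simp_all cong: measurable_cong_sets)
  have F0: "0 \<le> F x" for x
    using order_trans[OF _ bound(3)[of 0 x]] gn0[of 0 x] by simp
  have ae: "AE x in gaussian. (\<lambda>n. (norm (ou c (hn n) x))\<^sup>2 / ou c (gn n) x) \<longlonglongrightarrow> (norm (ou c h x))\<^sup>2 / ou c g x
      \<and> (\<forall>n. norm ((norm (ou c (hn n) x))\<^sup>2 / ou c (gn n) x) \<le> ou c F x)"
    using AE_integrable_ou[OF c s_def int(1)] AE_integrable_ou[OF c s_def int(2)] AE_integrable_ou[OF c s_def int(3)]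
  proof eventually_elim
    case (elim x)
    define w where "w y = c *\<^sub>R x + s *\<^sub>R y" for y
    note el = elim[folded w_def]
    have [measurable]: "w \<in> borel_measurable borel" unfolding w_def by measurable
    have og: "ou c k x = (\<integral>y. k (w y) \<partial>gaussian)" for k :: "real^'n \<Rightarrow> real"
      by (simp add: ou_def w_def s_def)
    have oh: "ou c k x = (\<integral>y. k (w y) \<partial>gaussian)" for k :: "real^'n \<Rightarrow> 'b"
      by (simp add: ou_def w_def s_def)
    have gi: "integrable gaussian (\<lambda>y. gn n (w y))" for n
      by (rule Bochner_Integration.integrable_bound[OF el(1)])
        (use gn0 order_trans[OF bound(1) abs_ge_self] in auto)
    have hgi: "integrable gaussian (\<lambda>y. (norm (hn n (w y)))\<^sup>2 / gn n (w y))" for n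
      by (rule Bochner_Integration.integrable_bound[OF el(3)])
        (use gn0 order_trans[OF bound(3) abs_ge_self] in auto)
    have L1: "(\<lambda>n. ou c (gn n) x) \<longlonglongrightarrow> ou c g x" unfolding og
      by (rule integral_dominated_convergence[OF _ _ el(1)]) (use lim gn0 bound in auto)
    have L2: "(\<lambda>n. ou c (hn n) x) \<longlonglongrightarrow> ou c h x" unfolding oh
      by (rule integral_dominated_convergence[OF _ _ el(2)]) (use lim bound in auto)
    have gi': "integrable gaussian (\<lambda>y. g (w y))"
      by (rule integrable_dominated_convergence[OF _ _ el(1), of _ "\<lambda>n y. gn n (w y)"]) (use lim gn0 bound in auto)
    \<comment> \<open>If the limiting denominator is zero, then \<open>g\<close> vanishes almost
      everywhere on the slice, hence so does every \<open>hn n\<close>, and all the quotients are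
      zero.\<close>
    have A: "(\<lambda>n. (norm (ou c (hn n) x))\<^sup>2 / ou c (gn n) x) \<longlonglongrightarrow> (norm (ou c h x))\<^sup>2 / ou c g x"
    proof (cases "ou c g x = 0")
      case True
      then have "AE y in gaussian. g (w y) = 0"
        unfolding og using gi' g0 by (subst (asm) integral_nonneg_eq_0_iff_AE) auto
      then have "AE y in gaussian. hn n (w y) = 0" for n
        by eventually_elim (rule zero(2))
      then have z: "ou c (hn n) x = 0" for n
        unfolding oh by (simp add: integral_eq_zero_AE)
      then have "ou c h x = 0" using LIMSEQ_unique[OF L2] by (simp add: tendsto_const)
      then show ?thesis by (simp add: z)
    next
      case False
      then show ?thesis by (intro tendsto_intros L1 L2)
    qed
    have B: "norm ((norm (ou c (hn n) x))\<^sup>2 / ou c (gn n) x) \<le> ou c F x" for n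
    proof (cases "ou c (gn n) x = 0")
      case True
      then show ?thesis unfolding og using F0 by (simp add: integral_nonneg_AE)
    next
      case False
      have "0 \<le> ou c (gn n) x" unfolding og by (rule integral_nonneg_AE) (simp add: gn0)
      with False have pos: "0 < ou c (gn n) x" by simp
      have "(norm (ou c (hn n) x))\<^sup>2 \<le> ou c (gn n) x * (\<integral>y. (norm (hn n (w y)))\<^sup>2 / gn n (w y) \<partial>gaussian)"
        unfolding og oh by (rule Cauchy_Schwarz_weighted(2)) (use gi hgi gn0 zero in auto)
      also have "\<dots> \<le> ou c (gn n) x * ou c F x"
        unfolding og[of F] using pos bound(3) by (intro mult_left_mono integral_mono hgi el(3)) auto
      finally show ?thesis using pos by (simp add: divide_le_eq mult.commute)
    qed
    show ?case using A B by blast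
  qed
  have w: "integrable gaussian (ou c F)" by (rule integrable_ou[OF c s_def int(3)])
  show "(\<lambda>n. fisher c (gn n) (hn n)) \<longlonglongrightarrow> fisher c g h"
    unfolding fisher_def by (rule integral_dominated_convergence[OF _ _ w]) (use ae in \<open>auto elim: eventually_mono\<close>)
  show "integrable gaussian (\<lambda>x. (norm (ou c h x))\<^sup>2 / ou c g x)"
    by (rule integrable_dominated_convergence[OF _ _ w, of _ "\<lambda>n x. (norm (ou c (hn n) x))\<^sup>2 / ou c (gn n) x"])
      (use ae in \<open>auto elim: eventually_mono\<close>)
qed

text \<open>Cruder than the sharp -1/e, but it makes the entropy integrand plus one nonnegative, as
  needed for Fatou.\<close>

lemma mult_ln_ge: "- 1 \<le> t * ln t" if "0 \<le> (t::real)"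
proof (cases "t = 0")
  case False
  then have t: "0 < t" using that by simp
  have "ln (1 / t) \<le> 1 / t - 1" using t by (intro ln_le_minus_one) auto
  then have "t * (- ln t) \<le> t * (1 / t - 1)" using t by (intro mult_left_mono) (auto simp: ln_div)
  then show ?thesis using t by (simp add: algebra_simps)
qed simp

lemma tendsto_mult_ln:
  fixes X :: "nat \<Rightarrow> real"
  assumes X: "X \<longlonglongrightarrow> a" and pos: "\<And>n. 0 < X n" and a: "0 \<le> a"
  shows "(\<lambda>n. X n * ln (X n)) \<longlonglongrightarrow> a * ln a"
proof (cases "a = 0")
  case True
  have l: "((\<lambda>t::real. t * ln t) \<longlongrightarrow> 0) (at_right 0)" by real_asymp
  have "X n \<noteq> 0" for n using pos[of n] by simp
  then have "filterlim X (at_right 0) sequentially"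
    using X pos True by (auto simp: filterlim_at intro!: always_eventually)
  from filterlim_compose[OF l this] show ?thesis using True by simp
next
  case False
  then show ?thesis using a by (intro tendsto_intros X) auto
qed

text \<open>What the hypotheses become once the barycenter has been moved to the origin: the
  covariance bound is a bound on second moments.\<close>

locale C1_density =
  fixes f :: "real^'n \<Rightarrow> real" and f' :: "real^'n \<Rightarrow> real^'n"
  assumes gderiv: "GDERIV f x :> f' x"
    and cont': "continuous_on UNIV f'"
    and nonneg: "0 \<le> f x"
    and int: "integrable gaussian f"
    and prob: "(\<integral>x. f x \<partial>gaussian) = 1"
    and fisher_int: "integrable gaussian (\<lambda>x. (norm (f' x))\<^sup>2 / f x)"
    and moment_int: "integrable gaussian (\<lambda>x. (norm x)\<^sup>2 * f x)"
    and cov: "norm u = 1 \<Longrightarrow> (\<integral>x. (u \<bullet> x)\<^sup>2 * f x \<partial>gaussian) \<le> 1"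
begin

lemma cont: "continuous_on UNIV f"
  using gderiv unfolding gderiv_def
  by (auto intro!: continuous_at_imp_continuous_on has_derivative_continuous)

lemma f_meas [measurable]: "f \<in> borel_measurable borel" and f'_meas [measurable]: "f' \<in> borel_measurable borel"
  using cont cont' by (auto intro: borel_measurable_continuous_onI)

text \<open>A zero of a nonnegative function is a minimum. Hence the value 0 / 0 = 0 in the Fisher
  integrand hides nothing.\<close>

lemma f'_zero: "f x = 0 \<Longrightarrow> f' x = 0"
proof -
  assume z: "f x = 0"
  have "f' x \<bullet> f' x = 0"
    by (rule DERIV_local_min[OF GDERIV_line[OF gderiv, of x "f' x"], of 1]) (auto simp: z nonneg)
  then show "f' x = 0" by simp
qed

lemma f'_int: "integrable gaussian f'"
  by (rule Cauchy_Schwarz_weighted(1)[OF int _ fisher_int]) (auto simp: nonneg f'_zero)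

section \<open>Approximation by densities bounded below, above and in gradient\<close>

definition cut :: "real \<Rightarrow> real^'n \<Rightarrow> real" where
  "cut N x = max 0 (1 - (norm x)\<^sup>2 / N\<^sup>2)"

text \<open>The summand 1 / N gives the lower bound, the map t / (1 + t / N) truncates smoothly at
  height N while staying below t, and the squared cutoff confines the gradient to a ball.\<close>

definition apx :: "nat \<Rightarrow> real^'n \<Rightarrow> real" where
  "apx n x = (let N = real (Suc n) in 1 / N + (cut N x)\<^sup>2 * (f x / (1 + f x / N)))"

definition apx' :: "nat \<Rightarrow> real^'n \<Rightarrow> real^'n" where
  "apx' n x = (let N = real (Suc n) in
     ((cut N x)\<^sup>2 / (1 + f x / N)\<^sup>2) *\<^sub>R f' x - ((f x / (1 + f x / N)) * (4 / N\<^sup>2 * cut N x)) *\<^sub>R x)"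

lemma cut_bounds: "0 \<le> cut N x" "cut N x \<le> 1"
  by (auto simp: cut_def)

lemma cut_support: "0 < N \<Longrightarrow> cut N x \<noteq> 0 \<Longrightarrow> norm x \<le> N"
proof -
  assume "0 < N" "cut N x \<noteq> 0"
  have "max 0 (1 - r) \<noteq> 0 \<Longrightarrow> r < 1" for r :: real by (simp add: max_def split: if_splits)
  with \<open>cut N x \<noteq> 0\<close> have "(norm x)\<^sup>2 / N\<^sup>2 < 1" unfolding cut_def by blast
  then have "(norm x / N)\<^sup>2 < 1" by (simp only: power_divide)
  then show ?thesis using \<open>0 < N\<close> by (simp only: abs_square_less_1) (simp add: divide_less_eq)
qed

lemma cut_cont: "continuous_on UNIV (cut N)"
  unfolding cut_def divide_inverse by (intro continuous_intros)

lemma one_plus_pos: "0 < N \<Longrightarrow> 1 \<le> 1 + f x / N"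
  using nonneg by simp

lemma trunc_bounds:
  assumes "0 < N"
  shows "0 \<le> f x / (1 + f x / N)" "f x / (1 + f x / N) \<le> f x" "f x / (1 + f x / N) \<le> N"
proof -
  have p: "0 < 1 + f x / N" "1 \<le> 1 + f x / N" using one_plus_pos[OF assms, of x] by linarith+
  show "0 \<le> f x / (1 + f x / N)" using p nonneg by (intro divide_nonneg_pos)
  show "f x / (1 + f x / N) \<le> f x" using frac_le[OF nonneg order_refl _ p(2), of x] by simp
  have "f x \<le> N * (1 + f x / N)" using assms by (simp add: distrib_left)
  then show "f x / (1 + f x / N) \<le> N" by (simp add: pos_divide_le_eq[OF p(1)])
qed

text \<open>The square removes the kink of the cutoff. It also makes the gradient proportional to
  the cutoff itself, so the squared gradient is controlled by the squared cutoff and the Fisher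
  information stays bounded.\<close>

lemma GDERIV_cut_sq: "GDERIV (\<lambda>x. (cut N x)\<^sup>2) x :> (- (4 / N\<^sup>2 * cut N x)) *\<^sub>R x"
proof -
  have 1: "((\<lambda>r::real. (max 0 r)\<^sup>2) has_real_derivative 2 * max 0 r) (at r)" for r
  proof -
    consider "r < 0" | "r = 0" | "0 < r" by linarith
    then show ?thesis
    proof cases
      case 1
      have "((\<lambda>r::real. 0) has_real_derivative 2 * max 0 r) (at r)" using 1 by simp
      then show ?thesis
        by (rule DERIV_cong_ev[THEN iffD2, OF refl _ refl, rotated])
          (use eventually_nhds_in_open[of "{..<0}" r] 1 in \<open>auto elim!: eventually_mono\<close>)
    next
      case 3
      have "((\<lambda>r::real. r\<^sup>2) has_real_derivative 2 * max 0 r) (at r)" using 3 by (auto intro!: derivative_eq_intros)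
      then show ?thesis
        by (rule DERIV_cong_ev[THEN iffD2, OF refl _ refl, rotated])
          (use eventually_nhds_in_open[of "{0<..}" r] 3 in \<open>auto elim!: eventually_mono\<close>)
    next
      case 2
      have "((\<lambda>t::real. (max 0 t)\<^sup>2 / t) \<longlongrightarrow> 0) (at 0)"
      proof (rule Lim_null_comparison)
        show "\<forall>\<^sub>F t in at (0::real). norm ((max 0 t)\<^sup>2 / t) \<le> \<bar>t\<bar>"
          by (auto simp: max_def power2_eq_square intro!: always_eventually)
        show "((\<lambda>t::real. \<bar>t\<bar>) \<longlongrightarrow> 0) (at 0)" by (auto intro!: tendsto_eq_intros)
      qed
      then show ?thesis using 2 by (simp add: has_field_derivative_iff)
    qed
  qed
  have "((\<lambda>x. 1 - (norm x)\<^sup>2 / N\<^sup>2) has_derivative (\<lambda>k. k \<bullet> (- (2 / N\<^sup>2)) *\<^sub>R x)) (at x)"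
    unfolding power2_norm_eq_inner divide_inverse
    by (auto intro!: derivative_eq_intros simp: inner_commute algebra_simps fun_eq_iff)
  then have "GDERIV (\<lambda>x. 1 - (norm x)\<^sup>2 / N\<^sup>2) x :> (- (2 / N\<^sup>2)) *\<^sub>R x" by (simp add: gderiv_def)
  from GDERIV_DERIV_compose[OF this 1] show ?thesis
    unfolding cut_def by (rule GDERIV_subst) simp
qed

lemma apx_gderiv: "GDERIV (apx n) x :> apx' n x"
proof -
  define N where "N = real (Suc n)"
  have N: "0 < N" by (simp add: N_def)
  have p: "1 + f x / N \<noteq> 0" using one_plus_pos[OF N, of x] by linarith
  have "((\<lambda>t. t / (1 + t / N)) has_real_derivative 1 / (1 + f x / N)\<^sup>2) (at (f x))"
    using p N by (auto intro!: derivative_eq_intros simp: power2_eq_square field_simps)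
  from GDERIV_DERIV_compose[OF gderiv this]
  have T: "GDERIV (\<lambda>x. f x / (1 + f x / N)) x :> (1 / (1 + f x / N)\<^sup>2) *\<^sub>R f' x" .
  show ?thesis
    unfolding apx_def[abs_def] apx'_def Let_def N_def[symmetric]
    by (rule GDERIV_subst[OF GDERIV_add[OF GDERIV_const GDERIV_mult[OF GDERIV_cut_sq T]]])
      (simp add: algebra_simps divide_inverse)
qed

lemma apx_cont: "continuous_on UNIV (apx n)" and apx'_cont: "continuous_on UNIV (apx' n)"
proof -
  have p: "1 + f x / real (Suc n) \<noteq> 0" for x using one_plus_pos[of "real (Suc n)" x] by linarith
  show "continuous_on UNIV (apx n)"
    unfolding apx_def Let_def using p by (intro continuous_intros cut_cont cont) auto
  show "continuous_on UNIV (apx' n)"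
    unfolding apx'_def Let_def using p by (intro continuous_intros cut_cont cont cont') auto
qed

lemma apx_meas [measurable]: "apx n \<in> borel_measurable borel" and apx'_meas [measurable]: "apx' n \<in> borel_measurable borel"
  using apx_cont apx'_cont by (auto intro: borel_measurable_continuous_onI)

lemma apx_lower: "1 / real (Suc n) \<le> apx n x"
  unfolding apx_def Let_def using nonneg[of x] one_plus_pos[of "real (Suc n)" x] by simp

lemma apx_upper: "apx n x \<le> 1 / real (Suc n) + real (Suc n)" "apx n x \<le> 1 + f x"
proof -
  define N where "N = real (Suc n)"
  have N: "1 \<le> N" by (simp add: N_def)
  have p: "1 \<le> 1 + f x / N" using one_plus_pos[of N x] N by simp
  have T: "f x / (1 + f x / N) \<le> N" "f x / (1 + f x / N) \<le> f x" "0 \<le> f x / (1 + f x / N)"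
    using trunc_bounds[of N x] N by auto
  have "(cut N x)\<^sup>2 * (f x / (1 + f x / N)) \<le> 1 * (f x / (1 + f x / N))"
    using cut_bounds[of N x] T by (intro mult_right_mono) (auto simp: power_le_one)
  moreover have "1 / N \<le> 1" using N by simp
  ultimately show "apx n x \<le> 1 / real (Suc n) + real (Suc n)" "apx n x \<le> 1 + f x"
    unfolding apx_def Let_def N_def[symmetric] using T by linarith+
qed

text \<open>A continuous gradient that vanishes outside a compact ball.\<close>

lemma apx'_bounded: "\<exists>L. \<forall>x. norm (apx' n x) \<le> L"
proof -
  define N where "N = real (Suc n)"
  have "compact (apx' n ` cball 0 N)"
    by (rule compact_continuous_image) (auto intro: continuous_on_subset[OF apx'_cont])
  then obtain B where "\<forall>y\<in>apx' n ` cball 0 N. norm y \<le> B"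
    by (auto dest!: compact_imp_bounded simp: bounded_iff)
  then have B: "norm (apx' n x) \<le> B" if "norm x \<le> N" for x using that by simp
  have "norm (apx' n x) \<le> max B 0" for x
  proof (cases "norm x \<le> N")
    case False
    then have "cut N x = 0" using cut_support[of N x] by (auto simp: N_def)
    then show ?thesis by (simp add: apx'_def Let_def N_def)
  qed (use B[of x] in auto)
  then show ?thesis by blast
qed

lemma apx_bounded_C1: "\<exists>L. bounded_C1 (apx n) (apx' n) (1 / real (Suc n)) (1 / real (Suc n) + real (Suc n)) L"
proof -
  obtain L where L: "\<And>x. norm (apx' n x) \<le> L" using apx'_bounded by blast
  have "bounded_C1 (apx n) (apx' n) (1 / real (Suc n)) (1 / real (Suc n) + real (Suc n)) L"
    by unfold_locales (use apx_lower apx_upper(1) L apx_gderiv GDERIV_line[OF apx_gderiv] in auto)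
  then show ?thesis by blast
qed

text \<open>On the support of the cutoff the norm of x is at most N \<le> N^2, so the factor 4 / N^2
  in its gradient leaves a bound uniform in \<open>n\<close>.\<close>

lemma apx'_parts:
  fixes n x
  defines "N \<equiv> real (Suc n)"
  defines "T \<equiv> f x / (1 + f x / N)"
  shows "norm (apx' n x) \<le> (cut N x)\<^sup>2 / (1 + f x / N)\<^sup>2 * norm (f' x) + T * (4 * cut N x)"
    and "0 \<le> T" "T \<le> f x"
proof -
  have N: "1 \<le> N" by (simp add: N_def)
  have p: "1 \<le> 1 + f x / N" using one_plus_pos[of N x] N by simp
  show T: "0 \<le> T" "T \<le> f x"
    unfolding T_def using trunc_bounds[of N x] N by auto
  have "norm (apx' n x) \<le> norm (((cut N x)\<^sup>2 / (1 + f x / N)\<^sup>2) *\<^sub>R f' x) + norm ((T * (4 / N\<^sup>2 * cut N x)) *\<^sub>R x)"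
    unfolding apx'_def Let_def N_def[symmetric] T_def by (rule norm_triangle_ineq4)
  also have "norm (((cut N x)\<^sup>2 / (1 + f x / N)\<^sup>2) *\<^sub>R f' x) = (cut N x)\<^sup>2 / (1 + f x / N)\<^sup>2 * norm (f' x)"
    by simp
  also have "norm ((T * (4 / N\<^sup>2 * cut N x)) *\<^sub>R x) \<le> T * (4 * cut N x)"
  proof (cases "cut N x = 0")
    case False
    then have "norm x \<le> N" using cut_support N by simp
    also have "N \<le> N\<^sup>2" using N by (simp add: power2_eq_square)
    finally have "norm x / N\<^sup>2 \<le> 1" using N by simp
    then have "T * 4 * cut N x * (norm x / N\<^sup>2) \<le> T * 4 * cut N x * 1"
      using T cut_bounds[of N x] by (intro mult_left_mono) auto
    then show ?thesis using T cut_bounds[of N x] by (simp add: abs_mult mult_ac)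
  qed simp
  finally show "norm (apx' n x) \<le> (cut N x)\<^sup>2 / (1 + f x / N)\<^sup>2 * norm (f' x) + T * (4 * cut N x)" by simp
qed

lemma apx'_zero: "f x = 0 \<Longrightarrow> apx' n x = 0"
  by (simp add: apx'_def Let_def f'_zero)

lemma apx'_norm: "norm (apx' n x) \<le> norm (f' x) + 4 * f x"
proof -
  define N where "N = real (Suc n)"
  note P = apx'_parts[where n=n and x=x, folded N_def]
  have p: "1 \<le> 1 + f x / N" using one_plus_pos[of N x] by (simp add: N_def)
  have "(cut N x)\<^sup>2 / (1 + f x / N)\<^sup>2 \<le> 1 / 1"
    using cut_bounds[of N x] p by (intro frac_le) (auto simp: power_le_one)
  then have "(cut N x)\<^sup>2 / (1 + f x / N)\<^sup>2 * norm (f' x) \<le> 1 * norm (f' x)"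
    by (intro mult_right_mono) auto
  moreover have "f x / (1 + f x / N) * (4 * cut N x) \<le> f x * (4 * 1)"
    using P(2,3) cut_bounds[of N x] nonneg[of x] by (intro mult_mono) auto
  ultimately show ?thesis using P(1) by simp
qed

text \<open>Both parts of the gradient, once squared, retain a factor
  \<open>\<eta>\<^sup>2 * T\<close>, which is at most \<open>apx n x\<close> and cancels the
  denominator. The truncation contributes through \<open>T = f x / B\<close> and B^4 \<ge> B, the
  cutoff through (4 T)^2 \<le> 16 f T; the split of the square doubles both.\<close>

lemma apx_fisher: "(norm (apx' n x))\<^sup>2 / apx n x \<le> 2 * ((norm (f' x))\<^sup>2 / f x) + 32 * f x"
proof (cases "f x = 0")
  case True then show ?thesis by (simp add: apx'_zero)
next
  case False
  then have fx: "0 < f x" using nonneg[of x] by simp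
  define N where "N = real (Suc n)"
  define T where "T = f x / (1 + f x / N)"
  define \<eta> where "\<eta> = cut N x"
  define B where "B = 1 + f x / N"
  note P = apx'_parts[where n=n and x=x, folded N_def, folded T_def]
  have p: "1 \<le> B" using one_plus_pos[of N x] by (simp add: N_def B_def)
  have e: "0 \<le> \<eta>" "\<eta> \<le> 1" using cut_bounds by (auto simp: \<eta>_def)
  have T0: "0 < T" using fx p unfolding T_def B_def[symmetric] by simp
  have ap: "\<eta>\<^sup>2 * T \<le> apx n x" "0 < apx n x"
    using apx_lower[of n x] less_le_trans[of 0 "1 / real (Suc n)" "apx n x"]
    by (auto simp: apx_def Let_def \<eta>_def T_def N_def)
  have main: "(norm (apx' n x))\<^sup>2 \<le> (2 * ((norm (f' x))\<^sup>2 / f x) + 32 * f x) * (\<eta>\<^sup>2 * T)"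
  proof -
    have sq: "(a + b)\<^sup>2 \<le> 2 * a\<^sup>2 + 2 * b\<^sup>2" for a b :: real
      using sum_squares_bound[of a b] by (simp add: power2_sum)
    have "(norm (apx' n x))\<^sup>2 \<le> (\<eta>\<^sup>2 / B\<^sup>2 * norm (f' x) + T * (4 * \<eta>))\<^sup>2"
      using P(1) unfolding \<eta>_def B_def by (intro power_mono) auto
    also have "\<dots> \<le> 2 * (\<eta>\<^sup>2 / B\<^sup>2 * norm (f' x))\<^sup>2 + 2 * (T * (4 * \<eta>))\<^sup>2" by (rule sq)
    also have "(\<eta>\<^sup>2 / B\<^sup>2 * norm (f' x))\<^sup>2 \<le> ((norm (f' x))\<^sup>2 / f x) * (\<eta>\<^sup>2 * T)"
    proof -
      have "(\<eta>\<^sup>2 / B\<^sup>2 * norm (f' x))\<^sup>2 = (norm (f' x))\<^sup>2 * \<eta>\<^sup>2 * (\<eta>\<^sup>2 / (B\<^sup>2 * B\<^sup>2))"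
        by (simp add: power_mult_distrib power_divide power2_eq_square)
      also have "\<dots> \<le> (norm (f' x))\<^sup>2 * \<eta>\<^sup>2 * (1 / B)"
      proof (intro mult_left_mono frac_le)
        have "B * 1 \<le> B * B ^ 3" using p one_le_power[OF p, of 3] by (intro mult_left_mono) auto
        then show "B \<le> B\<^sup>2 * B\<^sup>2" by (simp add: power2_eq_square power3_eq_cube mult.assoc)
      qed (use e p in \<open>auto simp: power_le_one\<close>)
      also have "\<dots> = ((norm (f' x))\<^sup>2 / f x) * (\<eta>\<^sup>2 * T)" using fx by (simp add: T_def B_def)
      finally show ?thesis .
    qed
    also have "(T * (4 * \<eta>))\<^sup>2 = 16 * T * (\<eta>\<^sup>2 * T)" by (simp add: power2_eq_square)
    also have "16 * T * (\<eta>\<^sup>2 * T) \<le> 16 * f x * (\<eta>\<^sup>2 * T)"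
      using P(2,3) e by (intro mult_right_mono) auto
    finally show ?thesis by (simp add: algebra_simps)
  qed
  also have "\<dots> \<le> (2 * ((norm (f' x))\<^sup>2 / f x) + 32 * f x) * apx n x"
    using ap fx by (intro mult_left_mono) auto
  finally show ?thesis using ap by (simp add: divide_le_eq)
qed

lemma cut_tendsto: "(\<lambda>n. cut (real (Suc n)) x) \<longlonglongrightarrow> 1"
proof -
  define r where "r n = inverse (real (Suc n))" for n
  have r: "r \<longlonglongrightarrow> 0" unfolding r_def by (rule LIMSEQ_inverse_real_of_nat)
  have "(\<lambda>n. max 0 (1 - (norm x)\<^sup>2 * (r n)\<^sup>2)) \<longlonglongrightarrow> max 0 (1 - (norm x)\<^sup>2 * 0\<^sup>2)"
    by (intro tendsto_intros r)
  then show ?thesis by (simp add: cut_def divide_inverse power_inverse r_def)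
qed

lemma apx_tendsto: "(\<lambda>n. apx n x) \<longlonglongrightarrow> f x" and apx'_tendsto: "(\<lambda>n. apx' n x) \<longlonglongrightarrow> f' x"
proof -
  define r where "r n = inverse (real (Suc n))" for n
  have r: "r \<longlonglongrightarrow> 0" unfolding r_def by (rule LIMSEQ_inverse_real_of_nat)
  define e where "e n = cut (real (Suc n)) x" for n
  have e: "e \<longlonglongrightarrow> 1" unfolding e_def by (rule cut_tendsto)
  have "(\<lambda>n. r n + (e n)\<^sup>2 * (f x * inverse (1 + f x * r n))) \<longlonglongrightarrow> 0 + 1\<^sup>2 * (f x * inverse (1 + f x * 0))"
    by (intro tendsto_intros r e) simp
  then show "(\<lambda>n. apx n x) \<longlonglongrightarrow> f x" by (simp add: apx_def Let_def divide_inverse r_def e_def)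
  have "(\<lambda>n. ((e n)\<^sup>2 * inverse ((1 + f x * r n)\<^sup>2)) *\<^sub>R f' x
       - ((f x * inverse (1 + f x * r n)) * (4 * (r n)\<^sup>2 * e n)) *\<^sub>R x)
     \<longlonglongrightarrow> (1\<^sup>2 * inverse ((1 + f x * 0)\<^sup>2)) *\<^sub>R f' x - ((f x * inverse (1 + f x * 0)) * (4 * 0\<^sup>2 * 1)) *\<^sub>R x"
    by (intro tendsto_intros r e) simp_all
  then show "(\<lambda>n. apx' n x) \<longlonglongrightarrow> f' x"
    by (simp add: apx'_def Let_def divide_inverse power_inverse r_def e_def)
qed

lemma apx_pos: "0 < apx n x"
  using less_le_trans[OF _ apx_lower[of n x]] by simp

lemma fisher_dom_int: "integrable gaussian (\<lambda>x. 2 * ((norm (f' x))\<^sup>2 / f x) + 32 * f x)"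
  by (intro Bochner_Integration.integrable_add integrable_mult_right fisher_int int)

section \<open>Passage to the limit\<close>

lemma fisher_conv:
  assumes c: "0 < c" "c \<le> 1"
  shows "(\<lambda>n. fisher c (apx n) (apx' n)) \<longlonglongrightarrow> fisher c f f'"
proof -
  note T = fisher_tendsto[of apx apx' f f' "\<lambda>x. 1 + f x" "\<lambda>x. norm (f' x) + 4 * f x" "\<lambda>x. 2 * ((norm (f' x))\<^sup>2 / f x) + 32 * f x" c,
      OF apx_meas apx'_meas f_meas f'_meas less_imp_le[OF apx_pos] nonneg apx_tendsto apx'_tendsto
      _ apx'_zero apx_upper(2) apx'_norm apx_fisher _ _ fisher_dom_int c]
  show ?thesis
    by (rule T(1)) (use int f'_int apx_pos in \<open>auto simp: less_le\<close>)
qed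

lemma
  assumes u: "norm u = 1" and c: "0 < c" "c \<le> 1"
  shows fisher_conv_dir: "(\<lambda>n. fisher c (apx n) (\<lambda>x. u \<bullet> apx' n x)) \<longlonglongrightarrow> fisher c f (\<lambda>x. u \<bullet> f' x)"
    and fisher_dir_int: "integrable gaussian (\<lambda>x. (norm (ou c (\<lambda>x. u \<bullet> f' x) x))\<^sup>2 / ou c f x)"
proof -
  have b: "norm (u \<bullet> y) \<le> norm y" for y using Cauchy_Schwarz_ineq2[of u y] u by simp
  have F: "(norm (u \<bullet> apx' n x))\<^sup>2 / apx n x \<le> 2 * ((norm (f' x))\<^sup>2 / f x) + 32 * f x" for n x
    by (rule order_trans[OF divide_right_mono[OF power_mono[OF b]] apx_fisher])
      (use apx_pos[of n x] in auto)
  note T = fisher_tendsto[of apx "\<lambda>n x. u \<bullet> apx' n x" f "\<lambda>x. u \<bullet> f' x" "\<lambda>x. 1 + f x" "\<lambda>x. norm (f' x) + 4 * f x" "\<lambda>x. 2 * ((norm (f' x))\<^sup>2 / f x) + 32 * f x" c,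
      OF apx_meas _ f_meas _ less_imp_le[OF apx_pos] nonneg apx_tendsto tendsto_inner[OF tendsto_const apx'_tendsto]
      _ _ apx_upper(2) order_trans[OF b apx'_norm] F _ _ fisher_dom_int c]
  show "(\<lambda>n. fisher c (apx n) (\<lambda>x. u \<bullet> apx' n x)) \<longlonglongrightarrow> fisher c f (\<lambda>x. u \<bullet> f' x)"
    by (rule T(1)) (use int f'_int apx_pos apx'_zero in \<open>auto simp: less_le\<close>)
  show "integrable gaussian (\<lambda>x. (norm (ou c (\<lambda>x. u \<bullet> f' x) x))\<^sup>2 / ou c f x)"
    by (rule T(2)) (use int f'_int apx_pos apx'_zero in \<open>auto simp: less_le\<close>)
qed

lemma mass_tendsto: "(\<lambda>n. \<integral>x. apx n x \<partial>gaussian) \<longlonglongrightarrow> 1"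
  unfolding prob[symmetric]
proof (rule integral_dominated_convergence[where w="\<lambda>x. 1 + f x"])
  show "AE x in gaussian. norm (apx n x) \<le> 1 + f x" for n
    using apx_upper(2) apx_pos by (auto simp: abs_of_pos)
qed (use int apx_tendsto in auto)

lemma moment_weight_int:
  assumes u: "norm u = 1"
  shows "integrable gaussian (\<lambda>x. (u \<bullet> x)\<^sup>2 * f x)"
proof (rule Bochner_Integration.integrable_bound[OF moment_int])
  have "(u \<bullet> x)\<^sup>2 \<le> (norm x)\<^sup>2" for x
    using Cauchy_Schwarz_ineq2[of u x] u by (metis abs_ge_zero power2_abs power_mono mult_1)
  then show "AE x in gaussian. norm ((u \<bullet> x)\<^sup>2 * f x) \<le> norm ((norm x)\<^sup>2 * f x)"
    using nonneg by (auto simp: abs_mult intro!: mult_right_mono)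
qed measurable

text \<open>The approximations may have excess variance of either sign; only the limit is known to
  be nonpositive, by the covariance bound.\<close>

lemma variance_defect_tendsto:
  assumes u: "norm u = 1"
  shows "\<exists>V\<le>0. (\<lambda>n. excess_var u (apx n)) \<longlonglongrightarrow> V"
proof (intro exI conjI)
  have i: "integrable gaussian (\<lambda>x. (u \<bullet> x)\<^sup>2 * f x)" by (rule moment_weight_int[OF u])
  have "excess_var u f = (\<integral>x. (u \<bullet> x)\<^sup>2 * f x \<partial>gaussian) - 1"
    using i int prob by (simp add: left_diff_distrib)
  then show "excess_var u f \<le> 0" using cov[OF u] by simp
  show "(\<lambda>n. excess_var u (apx n)) \<longlonglongrightarrow> excess_var u f"
  proof (rule integral_dominated_convergence[where w="\<lambda>x. ((u \<bullet> x)\<^sup>2 + 1) * (1 + f x)"])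
    show "integrable gaussian (\<lambda>x. ((u \<bullet> x)\<^sup>2 + 1) * (1 + f x))"
      using i int integrable_gaussian_inner_sq[of u] by (simp add: distrib_left distrib_right)
    have "\<bar>(u \<bullet> x)\<^sup>2 - 1\<bar> \<le> (u \<bullet> x)\<^sup>2 + 1" for x
      using zero_le_power2[of "u \<bullet> x"] by linarith
    then show "AE x in gaussian. norm (((u \<bullet> x)\<^sup>2 - 1) * apx n x) \<le> ((u \<bullet> x)\<^sup>2 + 1) * (1 + f x)" for n
      using apx_upper(2) apx_pos by (auto simp: abs_mult abs_of_pos intro!: mult_mono less_imp_le[OF apx_pos])
    show "AE x in gaussian. (\<lambda>n. ((u \<bullet> x)\<^sup>2 - 1) * apx n x) \<longlonglongrightarrow> ((u \<bullet> x)\<^sup>2 - 1) * f x"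
      by (intro always_eventually allI tendsto_intros apx_tendsto)
  qed measurable
qed

lemma fisher_nonneg:
  assumes "0 \<le> c"
  shows "0 \<le> fisher c f h"
  unfolding fisher_def ou_def[of c f] using nonneg by (intro integral_nonneg_AE) (auto intro!: divide_nonneg_nonneg integral_nonneg_AE)

lemma fisher_increment:
  assumes u: "norm u = 1" and c: "0 < c" "c \<le> 1" and d: "0 < d" "d \<le> 1"
  shows "c\<^sup>2 * (d\<^sup>2 * (1 - d\<^sup>2)) * (fisher (d * c) f (\<lambda>x. u \<bullet> f' x))\<^sup>2 \<le> fisher c f f' - fisher (d * c) f f'"
proof -
  obtain V where V: "V \<le> 0" "(\<lambda>n. excess_var u (apx n)) \<longlonglongrightarrow> V"
    using variance_defect_tendsto[OF u] by blast
  have dc: "0 < d * c" "d * c \<le> 1" using c d by (auto simp: mult_le_one)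
  have "c\<^sup>2 * (d\<^sup>2 * (1 - d\<^sup>2)) * (fisher (d * c) f (\<lambda>x. u \<bullet> f' x) - V)\<^sup>2 \<le> (fisher c f f' - fisher (d * c) f f') * 1"
  proof (rule LIMSEQ_le)
    show "(\<lambda>n. c\<^sup>2 * (d\<^sup>2 * (1 - d\<^sup>2)) * (fisher (d * c) (apx n) (\<lambda>x. u \<bullet> apx' n x) - excess_var u (apx n))\<^sup>2)
      \<longlonglongrightarrow> c\<^sup>2 * (d\<^sup>2 * (1 - d\<^sup>2)) * (fisher (d * c) f (\<lambda>x. u \<bullet> f' x) - V)\<^sup>2"
      by (intro tendsto_intros fisher_conv_dir u dc V)
    show "(\<lambda>n. (fisher c (apx n) (apx' n) - fisher (d * c) (apx n) (apx' n)) * (\<integral>x. apx n x \<partial>gaussian))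
      \<longlonglongrightarrow> (fisher c f f' - fisher (d * c) f f') * 1"
      by (intro tendsto_intros fisher_conv mass_tendsto c dc)
    have "c\<^sup>2 * (d\<^sup>2 * (1 - d\<^sup>2)) * (fisher (d * c) (apx n) (\<lambda>x. u \<bullet> apx' n x) - excess_var u (apx n))\<^sup>2
      \<le> (fisher c (apx n) (apx' n) - fisher (d * c) (apx n) (apx' n)) * (\<integral>x. apx n x \<partial>gaussian)" for n
    proof -
      obtain L where "bounded_C1 (apx n) (apx' n) (1 / real (Suc n)) (1 / real (Suc n) + real (Suc n)) L"
        using apx_bounded_C1 by blast
      then interpret bounded_C1 "apx n" "apx' n" "1 / real (Suc n)" "1 / real (Suc n) + real (Suc n)" L .
      show ?thesis by (rule fisher_increment[OF u c d])
    qed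
    then show "\<exists>N. \<forall>n\<ge>N. c\<^sup>2 * (d\<^sup>2 * (1 - d\<^sup>2)) * (fisher (d * c) (apx n) (\<lambda>x. u \<bullet> apx' n x) - excess_var u (apx n))\<^sup>2
      \<le> (fisher c (apx n) (apx' n) - fisher (d * c) (apx n) (apx' n)) * (\<integral>x. apx n x \<partial>gaussian)" by blast
  qed
  \<comment> \<open>Since the limit \<open>V\<close> is nonpositive and the information nonnegative,
    dropping \<open>V\<close> only decreases the square.\<close>
  moreover have "c\<^sup>2 * (d\<^sup>2 * (1 - d\<^sup>2)) * (fisher (d * c) f (\<lambda>x. u \<bullet> f' x))\<^sup>2 \<le> c\<^sup>2 * (d\<^sup>2 * (1 - d\<^sup>2)) * (fisher (d * c) f (\<lambda>x. u \<bullet> f' x) - V)\<^sup>2"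
    using V(1) fisher_nonneg[of "d * c" "\<lambda>x. u \<bullet> f' x"] dc c d
    by (intro mult_left_mono power_mono) (auto simp: power_le_one)
  ultimately show ?thesis by simp
qed

lemma fisher_dir_mono:
  assumes u: "norm u = 1" and c: "0 < c" "c \<le> c'" "c' \<le> 1"
  shows "fisher c f (\<lambda>x. u \<bullet> f' x) \<le> fisher c' f (\<lambda>x. u \<bullet> f' x)"
proof (rule LIMSEQ_le)
  show "(\<lambda>n. fisher c (apx n) (\<lambda>x. u \<bullet> apx' n x)) \<longlonglongrightarrow> fisher c f (\<lambda>x. u \<bullet> f' x)"
    "(\<lambda>n. fisher c' (apx n) (\<lambda>x. u \<bullet> apx' n x)) \<longlonglongrightarrow> fisher c' f (\<lambda>x. u \<bullet> f' x)"
    using c by (auto intro!: fisher_conv_dir u)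
  have "fisher c (apx n) (\<lambda>x. u \<bullet> apx' n x) \<le> fisher c' (apx n) (\<lambda>x. u \<bullet> apx' n x)" for n
  proof -
    obtain L where "bounded_C1 (apx n) (apx' n) (1 / real (Suc n)) (1 / real (Suc n) + real (Suc n)) L"
      using apx_bounded_C1 by blast
    then interpret bounded_C1 "apx n" "apx' n" "1 / real (Suc n)" "1 / real (Suc n) + real (Suc n)" L .
    show ?thesis by (rule fisher_mono(2)[OF c u])
  qed
  then show "\<exists>N. \<forall>n\<ge>N. fisher c (apx n) (\<lambda>x. u \<bullet> apx' n x) \<le> fisher c' (apx n) (\<lambda>x. u \<bullet> apx' n x)" by blast
qed

text \<open>Fatou for t ln t + 1, which is nonnegative, gives lower semicontinuity of the entropy,
  exactly the direction needed for an upper bound. Finiteness of the entropy thus follows from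
  finite Fisher information.\<close>

lemma
  assumes d: "0 < d" "d \<le> 1"
  shows entropy_int: "integrable gaussian (\<lambda>x. f x * ln (f x))"
    and entropy_le_grid_sum: "(\<integral>x. f x * ln (f x) \<partial>gaussian)
      \<le> ((\<Sum>k<N. fisher (d ^ k) f f' * ((d ^ k)\<^sup>2 - (d ^ Suc k)\<^sup>2)) + fisher (d ^ N) f f' * (d ^ N)\<^sup>2) / 2"
proof -
  define B where "B g h = ((\<Sum>k<N. fisher (d ^ k) g h * ((d ^ k)\<^sup>2 - (d ^ Suc k)\<^sup>2)) + fisher (d ^ N) g h * (d ^ N)\<^sup>2) / 2"
    for g :: "real^'n \<Rightarrow> real" and h :: "real^'n \<Rightarrow> real^'n"
  define m where "m n = (\<integral>x. apx n x \<partial>gaussian)" for n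
  have dk: "0 < d ^ k" "d ^ k \<le> 1" for k using d by (auto simp: power_le_one)
  have ai: "integrable gaussian (\<lambda>x. apx n x * ln (apx n x))"
    and ab: "(\<integral>x. apx n x * ln (apx n x) \<partial>gaussian) \<le> m n * ln (m n) + B (apx n) (apx' n)" 
    and mpos: "0 < m n" for n
  proof -
    obtain L where "bounded_C1 (apx n) (apx' n) (1 / real (Suc n)) (1 / real (Suc n) + real (Suc n)) L"
      using apx_bounded_C1 by blast
    then interpret bounded_C1 "apx n" "apx' n" "1 / real (Suc n)" "1 / real (Suc n) + real (Suc n)" L .
    have "\<bar>apx n x * ln (apx n x)\<bar> \<le> (1 / real (Suc n) + real (Suc n)) * (K + 1)" for x
    proof -
      have "\<bar>ln (apx n x)\<bar> \<le> K + 1" using ln_bound[OF g_lower g_upper, of x] by linarith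
      then show ?thesis using mult_mono[OF g_abs[of x], of "\<bar>ln (apx n x)\<bar>" "K + 1"] M_pos by (simp add: abs_mult)
    qed
    then show "integrable gaussian (\<lambda>x. apx n x * ln (apx n x))"
      by (intro integrable_gaussian_bounded) auto
    show "(\<integral>x. apx n x * ln (apx n x) \<partial>gaussian) \<le> m n * ln (m n) + B (apx n) (apx' n)"
      using entropy_le_grid_sum[OF d, of N] unfolding B_def m_def by linarith
    have "(\<integral>x. 1 / real (Suc n) \<partial>(gaussian :: (real^'n) measure)) \<le> m n" unfolding m_def
      by (rule integral_mono) (use g_lower in \<open>auto intro!: integrable_gaussian_bounded[OF _ g_abs[unfolded real_norm_def[symmetric]]]\<close>)
    then have "1 / real (Suc n) \<le> m n" by simp
    then show "0 < m n" by (rule less_le_trans[rotated]) simp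
  qed
  have "(\<lambda>n. B (apx n) (apx' n)) \<longlonglongrightarrow> B f f'"
    unfolding B_def by (intro tendsto_intros fisher_conv dk) simp
  moreover have "(\<lambda>n. m n * ln (m n)) \<longlonglongrightarrow> 1 * ln 1"
    unfolding m_def by (rule tendsto_mult_ln[OF mass_tendsto mpos[unfolded m_def]]) simp
  ultimately have lim: "(\<lambda>n. m n * ln (m n) + B (apx n) (apx' n) + 1) \<longlonglongrightarrow> 1 * ln 1 + B f f' + 1"
    by (intro tendsto_add tendsto_const)
  have "(\<integral>\<^sup>+x. ennreal (f x * ln (f x) + 1) \<partial>gaussian) = (\<integral>\<^sup>+x. liminf (\<lambda>n. ennreal (apx n x * ln (apx n x) + 1)) \<partial>gaussian)"
  proof (rule nn_integral_cong)
    fix x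
    have "(\<lambda>n. ennreal (apx n x * ln (apx n x) + 1)) \<longlonglongrightarrow> ennreal (f x * ln (f x) + 1)"
      by (intro tendsto_ennrealI tendsto_intros tendsto_mult_ln apx_tendsto apx_pos nonneg)
    then show "ennreal (f x * ln (f x) + 1) = liminf (\<lambda>n. ennreal (apx n x * ln (apx n x) + 1))"
      by (simp add: lim_imp_Liminf)
  qed
  also have "\<dots> \<le> liminf (\<lambda>n. \<integral>\<^sup>+x. ennreal (apx n x * ln (apx n x) + 1) \<partial>gaussian)"
    by (rule nn_integral_liminf) measurable
  also have "\<dots> \<le> liminf (\<lambda>n. ennreal (m n * ln (m n) + B (apx n) (apx' n) + 1))"
  proof (intro Liminf_mono always_eventually allI)
    fix n
    have "(\<integral>\<^sup>+x. ennreal (apx n x * ln (apx n x) + 1) \<partial>gaussian) = ennreal (\<integral>x. apx n x * ln (apx n x) + 1 \<partial>gaussian)"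
    proof (rule nn_integral_eq_integral)
      show "AE x in gaussian. 0 \<le> apx n x * ln (apx n x) + 1"
        using mult_ln_ge[OF less_imp_le[OF apx_pos[of n]]] by (intro always_eventually allI) (smt (verit))
    qed (use ai in simp)
    also have "\<dots> \<le> ennreal (m n * ln (m n) + B (apx n) (apx' n) + 1)"
      using ab[of n] ai[of n] by (intro ennreal_leI) simp
    finally show "(\<integral>\<^sup>+x. ennreal (apx n x * ln (apx n x) + 1) \<partial>gaussian) \<le> ennreal (m n * ln (m n) + B (apx n) (apx' n) + 1)" .
  qed
  also have "\<dots> = ennreal (B f f' + 1)"
    using tendsto_ennrealI[OF lim] by (simp add: lim_imp_Liminf)
  finally have le: "(\<integral>\<^sup>+x. ennreal (f x * ln (f x) + 1) \<partial>gaussian) \<le> ennreal (B f f' + 1)" .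
  have nn: "0 \<le> f x * ln (f x) + 1" for x using mult_ln_ge[OF nonneg[of x]] by simp
  have i1: "integrable gaussian (\<lambda>x. f x * ln (f x) + 1)"
    by (rule integrableI_nonneg) (use nn le in \<open>auto intro: le_less_trans\<close>)
  then have "integrable gaussian (\<lambda>x. (f x * ln (f x) + 1) - 1)"
    by (rule Bochner_Integration.integrable_diff) simp
  then show i: "integrable gaussian (\<lambda>x. f x * ln (f x))" by simp
  \<comment> \<open>\<open>ennreal\<close> truncates negative values, so the bound must be
    nonnegative before the inequality is read back over the reals.\<close>
  have B0: "0 \<le> B f f'"
    unfolding B_def using d by (intro divide_nonneg_nonneg add_nonneg_nonneg sum_nonneg mult_nonneg_nonneg fisher_nonneg)
      (auto simp: power_decreasing power_mono mult_left_le_one_le power_mult_distrib power_le_one)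
  have "ennreal (\<integral>x. f x * ln (f x) + 1 \<partial>gaussian) \<le> ennreal (B f f' + 1)"
    using le nn i1 by (subst nn_integral_eq_integral[symmetric]) auto
  then have "(\<integral>x. f x * ln (f x) + 1 \<partial>gaussian) \<le> B f f' + 1"
    using B0 by (subst (asm) ennreal_le_iff) auto
  then show "(\<integral>x. f x * ln (f x) \<partial>gaussian)
      \<le> ((\<Sum>k<N. fisher (d ^ k) f f' * ((d ^ k)\<^sup>2 - (d ^ Suc k)\<^sup>2)) + fisher (d ^ N) f f' * (d ^ N)\<^sup>2) / 2"
    using i unfolding B_def[symmetric] by simp
qed

end

section \<open>The deficit in terms of the directional Fisher information\<close>

text \<open>The kernel of \<open>phi_of\<close> is the exponential law of rate 4, so
  \<open>phi_of \<psi>\<close> is an expectation and Jensen-type bounds cost no constant.\<close>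

definition expo :: "real measure" where
  "expo = density lborel (\<lambda>t. ennreal (exponential_density 4 t))"

lemma sets_expo [simp, measurable_cong]: "sets expo = sets borel"
  by (simp add: expo_def)

lemma space_expo [simp]: "space expo = UNIV"
  by (simp add: expo_def)

interpretation expo: prob_space expo
  unfolding expo_def by (rule prob_space_exponential_density) simp

lemma emeasure_expo_Ioc:
  assumes "0 \<le> a" "a \<le> b"
  shows "emeasure expo {a<..b} = ennreal (exp (- 4 * a) - exp (- 4 * b))"
proof -
  have *: "emeasure expo {..t} = ennreal (1 - exp (- 4 * t))" if "0 \<le> t" for t
    using emeasure_erlang_density[of 4 0 t] that by (simp add: expo_def erlang_CDF_def)
  have "{a<..b} = {..b} - {..a}" using assms by auto
  then have "emeasure expo {a<..b} = emeasure expo {..b} - emeasure expo {..a}"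
    using assms by (simp only:) (rule emeasure_Diff; auto simp: *)
  also have "\<dots> = ennreal ((1 - exp (- 4 * b)) - (1 - exp (- 4 * a)))"
    using assms by (simp only: * order_trans[OF assms]) (rule ennreal_minus, simp)
  finally show ?thesis by simp
qed

lemma AE_expo_pos: "AE t in expo. 0 < t"
proof -
  have "emeasure expo {..0} = 0"
    using emeasure_erlang_density[of 4 0 0] by (simp add: expo_def erlang_CDF_def)
  then have "{..0} \<in> null_sets expo" by auto
  from AE_not_in[OF this] show ?thesis by eventually_elim simp
qed

lemma integral_expo:
  fixes F :: "real \<Rightarrow> real"
  assumes [measurable]: "F \<in> borel_measurable borel"
  shows "(\<integral>t. F t \<partial>expo) = 4 * set_lebesgue_integral lborel {0..} (\<lambda>t. exp (- 4 * t) * F t)"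
proof -
  have "(\<integral>t. F t \<partial>expo) = (\<integral>t. exponential_density 4 t *\<^sub>R F t \<partial>lborel)"
    unfolding expo_def by (subst integral_density) auto
  also have "\<dots> = (\<integral>t. 4 * (indicator {0..} t *\<^sub>R (exp (- 4 * t) * F t)) \<partial>lborel)"
    by (rule Bochner_Integration.integral_cong) (auto simp: exponential_density_def mult_ac split: split_indicator)
  finally show ?thesis by (simp add: set_lebesgue_integral_def)
qed

lemma interval_grid:
  fixes t h :: real
  assumes "0 < t" "t \<le> real N * h"
  shows "\<exists>k<N. real k * h < t \<and> t \<le> real (Suc k) * h"
  using assms
proof (induction N)
  case (Suc N)
  show ?case
  proof (cases "t \<le> real N * h")
    case True
    then show ?thesis using Suc by (meson less_SucI)
  next
    case False
    then show ?thesis using Suc.prems by (intro exI[of _ N]) auto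
  qed
qed simp

text \<open>Summation by parts: it converts the Riemann sum that bounds the entropy into a sum of
  decrements of the Fisher information, to which the increment estimate applies.\<close>

lemma abel_sum:
  fixes A w :: "nat \<Rightarrow> real"
  shows "(\<Sum>k<N. A k * (w k - w (Suc k))) + A N * w N = A 0 * w 0 - (\<Sum>k<N. w (Suc k) * (A k - A (Suc k)))"
  by (induction N) (auto simp: algebra_simps)

section \<open>From the grid to an integral bound by the deficit\<close>

context C1_density
begin

definition gap :: real where
  "gap = fisher 1 f f' / 2 - (\<integral>x. f x * ln (f x) \<partial>gaussian)"

context
  fixes u :: "real^'n"
  assumes u: "norm u = 1"
begin

text \<open>Of the fourth power, one square is the weight in the summation by parts and the other is
  the scaling of the increment estimate. The sum of weighted decrements equals the initial Fisher
  information minus the Riemann sum, and the latter is at least twice the entropy.\<close>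

lemma sum_le_deficit:
  assumes d: "0 < d" "d \<le> 1"
  shows "(1 - d\<^sup>2) * (\<Sum>k<N. (d ^ Suc k) ^ 4 * (fisher (d ^ Suc k) f (\<lambda>x. u \<bullet> f' x))\<^sup>2) \<le> 2 * gap"
proof -
  have dk: "0 < d ^ k" "d ^ k \<le> 1" for k using d by (auto simp: power_le_one)
  define A where "A k = fisher (d ^ k) f f'" for k
  define a where "a k = fisher (d ^ k) f (\<lambda>x. u \<bullet> f' x)" for k
  have "(1 - d\<^sup>2) * (\<Sum>k<N. (d ^ Suc k) ^ 4 * (a (Suc k))\<^sup>2) = (\<Sum>k<N. (d ^ Suc k)\<^sup>2 * ((d ^ k)\<^sup>2 * (d\<^sup>2 * (1 - d\<^sup>2)) * (a (Suc k))\<^sup>2))"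
    unfolding sum_distrib_left
  proof (rule sum.cong[OF refl])
    fix k
    have "(d ^ Suc k) ^ 4 = (d ^ Suc k)\<^sup>2 * ((d ^ k)\<^sup>2 * d\<^sup>2)"
      by (simp add: power4_eq_xxxx power2_eq_square mult_ac)
    then show "(1 - d\<^sup>2) * ((d ^ Suc k) ^ 4 * (a (Suc k))\<^sup>2) = (d ^ Suc k)\<^sup>2 * ((d ^ k)\<^sup>2 * (d\<^sup>2 * (1 - d\<^sup>2)) * (a (Suc k))\<^sup>2)"
      by (simp only: mult_ac)
  qed
  also have "\<dots> \<le> (\<Sum>k<N. (d ^ Suc k)\<^sup>2 * (A k - A (Suc k)))"
    unfolding A_def a_def using fisher_increment[OF u dk d]
    by (intro sum_mono mult_left_mono) (auto simp: mult.commute)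
  also have "\<dots> = A 0 - ((\<Sum>k<N. A k * ((d ^ k)\<^sup>2 - (d ^ Suc k)\<^sup>2)) + A N * (d ^ N)\<^sup>2)"
    using abel_sum[of A "\<lambda>k. (d ^ k)\<^sup>2" N] by simp
  also have "\<dots> \<le> 2 * gap"
    using entropy_le_grid_sum[OF d, of N] unfolding A_def gap_def by simp
  finally show ?thesis unfolding a_def .
qed

text \<open>The empty grid: the bound behind it is then the logarithmic Sobolev inequality.\<close>

lemma gap_nonneg: "0 \<le> gap"
  using sum_le_deficit[of 1 0] by simp

text \<open>The truncation at \<open>0\<close> makes the function monotone, hence measurable, on the whole line.\<close>
definition dir_info :: "real \<Rightarrow> real" where
  "dir_info t = fisher (exp (- max 0 t)) f (\<lambda>x. u \<bullet> f' x)"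

lemma dir_info_nonneg: "0 \<le> dir_info t" and dir_info_le: "dir_info t \<le> fisher 1 f (\<lambda>x. u \<bullet> f' x)"
  and dir_info_antimono: "s \<le> t \<Longrightarrow> dir_info t \<le> dir_info s"
  unfolding dir_info_def by (auto intro!: fisher_nonneg fisher_dir_mono[OF u])

lemma dir_info_meas [measurable]: "dir_info \<in> borel_measurable borel"
proof -
  have "(\<lambda>t. - dir_info t) \<in> borel_measurable borel"
    by (rule borel_measurable_mono) (auto simp: mono_def dir_info_antimono)
  then show ?thesis by simp
qed

lemma dir_info_bounded: "integrable expo (\<lambda>t. dir_info t ^ k)"
proof (rule expo.integrable_const_bound)
  show "AE t in expo. norm (dir_info t ^ k) \<le> (fisher 1 f (\<lambda>x. u \<bullet> f' x)) ^ k"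
    using dir_info_nonneg dir_info_le by (auto intro!: power_mono)
qed measurable

text \<open>On each cell monotonicity bounds the integrand by its left endpoint value, whereas the
  grid sum controls the values at positive multiples of \<open>h\<close>. The unmatched value at 0
  is left over with weight 1 - d^4, which vanishes as the mesh is refined.\<close>

lemma dir_info_grid_bound:
  assumes T: "0 < T" and N: "0 < N"
  defines "d \<equiv> exp (- (T / real N))"
  shows "(\<integral>\<^sup>+t. ennreal ((dir_info t)\<^sup>2) * indicator {0<..T} t \<partial>expo) \<le> ennreal ((1 - d ^ 4) * (dir_info 0)\<^sup>2 + 4 * gap)"
proof -
  define h where "h = T / real N"
  have h: "0 < h" "T = real N * h" using T N by (auto simp: h_def)
  have dh: "d = exp (- h)" by (simp add: d_def h_def)
  have d: "0 < d" "d \<le> 1" using h(1) by (auto simp: dh)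
  have dk: "exp (- (real k * h)) = d ^ k" for k
    by (simp add: dh exp_of_nat_mult[symmetric])
  have alk: "dir_info (real k * h) = fisher (d ^ k) f (\<lambda>x. u \<bullet> f' x)" for k
  proof -
    have "max 0 (real k * h) = real k * h" using h(1) by (intro max_absorb2 mult_nonneg_nonneg) auto
    then show ?thesis unfolding dir_info_def by (simp only: dk)
  qed
  have dk4: "exp (- 4 * (real k * h)) = (d ^ k) ^ 4" for k
    unfolding dk[symmetric] exp_of_nat_mult[symmetric] by simp
  have mdec: "(d ^ Suc k) ^ 4 \<le> (d ^ k) ^ 4" for k
    using d by (intro power_mono power_decreasing) auto
  have "(\<integral>\<^sup>+t. ennreal ((dir_info t)\<^sup>2) * indicator {0<..T} t \<partial>expo)
    \<le> (\<integral>\<^sup>+t. (\<Sum>k<N. ennreal ((dir_info (real k * h))\<^sup>2) * indicator {real k * h<..real (Suc k) * h} t) \<partial>expo)"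
  proof (rule nn_integral_mono)
    fix t
    show "ennreal ((dir_info t)\<^sup>2) * indicator {0<..T} t \<le> (\<Sum>k<N. ennreal ((dir_info (real k * h))\<^sup>2) * indicator {real k * h<..real (Suc k) * h} t)"
    proof (cases "t \<in> {0<..T}")
      case True
      then obtain k where k: "k < N" "real k * h < t" "t \<le> real (Suc k) * h"
        using interval_grid[of t N h] h by auto
      have "ennreal ((dir_info t)\<^sup>2) * indicator {0<..T} t \<le> ennreal ((dir_info (real k * h))\<^sup>2) * indicator {real k * h<..real (Suc k) * h} t"
        using True k dir_info_antimono[of "real k * h" t] dir_info_nonneg[of t] by (auto intro!: ennreal_leI power_mono)
      also have "\<dots> \<le> (\<Sum>k<N. ennreal ((dir_info (real k * h))\<^sup>2) * indicator {real k * h<..real (Suc k) * h} t)"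
        using k by (intro member_le_sum) auto
      finally show ?thesis .
    qed simp
  qed
  also have "\<dots> = (\<Sum>k<N. ennreal ((dir_info (real k * h))\<^sup>2) * emeasure expo {real k * h<..real (Suc k) * h})"
    by (subst nn_integral_sum) (auto simp: nn_integral_cmult_indicator)
  also have "\<dots> = (\<Sum>k<N. ennreal ((dir_info (real k * h))\<^sup>2 * ((d ^ k) ^ 4 - (d ^ Suc k) ^ 4)))"
  proof (rule sum.cong[OF refl])
    fix k
    have "emeasure expo {real k * h<..real (Suc k) * h} = ennreal ((d ^ k) ^ 4 - (d ^ Suc k) ^ 4)"
      unfolding dk4[symmetric] using h by (intro emeasure_expo_Ioc mult_nonneg_nonneg mult_right_mono) auto
    then show "ennreal ((dir_info (real k * h))\<^sup>2) * emeasure expo {real k * h<..real (Suc k) * h}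
      = ennreal ((dir_info (real k * h))\<^sup>2 * ((d ^ k) ^ 4 - (d ^ Suc k) ^ 4))"
      using mdec[of k] by (simp add: ennreal_mult)
  qed
  also have "\<dots> = ennreal (\<Sum>k<N. (dir_info (real k * h))\<^sup>2 * ((d ^ k) ^ 4 - (d ^ Suc k) ^ 4))"
    using mdec by (intro sum_ennreal) (auto intro!: mult_nonneg_nonneg)
  also have "\<dots> \<le> ennreal ((1 - d ^ 4) * (dir_info 0)\<^sup>2 + 4 * gap)"
  proof (rule ennreal_leI)
    define S where "S = (\<Sum>k<N. (d ^ Suc k) ^ 4 * (dir_info (real (Suc k) * h))\<^sup>2)"
    have S0: "0 \<le> S" unfolding S_def by (intro sum_nonneg) (auto intro!: mult_nonneg_nonneg zero_le_power simp: d less_imp_le)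
    have "(\<Sum>k<N. (dir_info (real k * h))\<^sup>2 * ((d ^ k) ^ 4 - (d ^ Suc k) ^ 4)) = (1 - d ^ 4) * (\<Sum>k<N. (d ^ k) ^ 4 * (dir_info (real k * h))\<^sup>2)"
      unfolding sum_distrib_left by (intro sum.cong refl) (simp add: power_mult_distrib algebra_simps)
    also have "(\<Sum>k<N. (d ^ k) ^ 4 * (dir_info (real k * h))\<^sup>2) \<le> (\<Sum>k<Suc N. (d ^ k) ^ 4 * (dir_info (real k * h))\<^sup>2)"
      using d by simp
    also have "(\<Sum>k<Suc N. (d ^ k) ^ 4 * (dir_info (real k * h))\<^sup>2) = (dir_info 0)\<^sup>2 + S"
      unfolding S_def by (subst sum.lessThan_Suc_shift) simp
    \<comment> \<open>The cell weights produce 1 - d^4 but the grid sum carries 1 - d^2; the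
      quotient 1 + d^2 \<le> 2 doubles the bound to four times the gap.\<close>
    also have "(1 - d ^ 4) * ((dir_info 0)\<^sup>2 + S) = (1 - d ^ 4) * (dir_info 0)\<^sup>2 + (1 + d\<^sup>2) * ((1 - d\<^sup>2) * S)"
      by (simp add: algebra_simps power2_eq_square power4_eq_xxxx)
    also have "(1 + d\<^sup>2) * ((1 - d\<^sup>2) * S) \<le> 2 * (2 * gap)"
    proof (rule mult_mono)
      show "(1 - d\<^sup>2) * S \<le> 2 * gap"
        using sum_le_deficit[OF d, of N] unfolding S_def alk .
    qed (use d S0 in \<open>auto simp: power_le_one\<close>)
    finally show "(\<Sum>k<N. (dir_info (real k * h))\<^sup>2 * ((d ^ k) ^ 4 - (d ^ Suc k) ^ 4)) \<le> (1 - d ^ 4) * (dir_info 0)\<^sup>2 + 4 * gap"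
      using d by (simp add: mult_left_mono power_le_one)
  qed
  finally show ?thesis .
qed

text \<open>The mesh is refined at a fixed horizon \<open>T\<close> first, and Fatou then lets the
  horizon grow.\<close>

lemma integral_al_sq_le: "(\<integral>t. (dir_info t)\<^sup>2 \<partial>expo) \<le> 4 * gap"
proof -
  have T: "(\<integral>\<^sup>+t. ennreal ((dir_info t)\<^sup>2) * indicator {0<..T} t \<partial>expo) \<le> ennreal (4 * gap)" if "0 < T" for T
  proof -
    have "(\<lambda>N. T * inverse (real (Suc N))) \<longlonglongrightarrow> T * 0"
      by (intro tendsto_mult tendsto_const LIMSEQ_inverse_real_of_nat)
    then have "(\<lambda>N. T / real (Suc N)) \<longlonglongrightarrow> 0" by (simp add: divide_inverse)
    then have "(\<lambda>N. (1 - exp (- (T / real (Suc N))) ^ 4) * (dir_info 0)\<^sup>2 + 4 * gap) \<longlonglongrightarrow> (1 - exp (- 0) ^ 4) * (dir_info 0)\<^sup>2 + 4 * gap"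
      by (intro tendsto_intros)
    then have "(\<lambda>N. ennreal ((1 - exp (- (T / real (Suc N))) ^ 4) * (dir_info 0)\<^sup>2 + 4 * gap)) \<longlonglongrightarrow> ennreal (4 * gap)"
      by (intro tendsto_ennrealI) simp
    then show ?thesis
      by (rule LIMSEQ_le_const) (intro exI[of _ 0] allI impI dir_info_grid_bound[OF that] zero_less_Suc)
  qed
  have "(\<integral>\<^sup>+t. ennreal ((dir_info t)\<^sup>2) \<partial>expo) = (\<integral>\<^sup>+t. liminf (\<lambda>n. ennreal ((dir_info t)\<^sup>2) * indicator {0<..real (Suc n)} t) \<partial>expo)"
  proof (rule nn_integral_cong_AE)
    show "AE t in expo. ennreal ((dir_info t)\<^sup>2) = liminf (\<lambda>n. ennreal ((dir_info t)\<^sup>2) * indicator {0<..real (Suc n)} t)"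
      using AE_expo_pos
    proof eventually_elim
      case (elim t)
      obtain m where m: "t \<le> real m" using real_arch_simple by blast
      have "\<forall>\<^sub>F n in sequentially. ennreal ((dir_info t)\<^sup>2) * indicator {0<..real (Suc n)} t = ennreal ((dir_info t)\<^sup>2)"
        unfolding eventually_sequentially using elim m by (intro exI[of _ m]) (auto split: split_indicator)
      then have "(\<lambda>n. ennreal ((dir_info t)\<^sup>2) * indicator {0<..real (Suc n)} t) \<longlonglongrightarrow> ennreal ((dir_info t)\<^sup>2)"
        by (rule tendsto_eventually)
      then show ?case by (simp add: lim_imp_Liminf)
    qed
  qed
  also have "\<dots> \<le> liminf (\<lambda>n. \<integral>\<^sup>+t. ennreal ((dir_info t)\<^sup>2) * indicator {0<..real (Suc n)} t \<partial>expo)"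
    by (rule nn_integral_liminf) measurable
  also have "\<dots> \<le> liminf (\<lambda>n::nat. ennreal (4 * gap))"
    by (intro Liminf_mono always_eventually allI T) simp
  also have "\<dots> = ennreal (4 * gap)" by (simp add: Liminf_const)
  finally have "ennreal (\<integral>t. (dir_info t)\<^sup>2 \<partial>expo) \<le> ennreal (4 * gap)"
    using dir_info_bounded[of 2] by (subst nn_integral_eq_integral[symmetric]) auto
  then show ?thesis using gap_nonneg by (simp add: ennreal_le_iff)
qed

text \<open>The fourth power is reached by two applications of Cauchy-Schwarz against the constant 1
  of the probability \<open>expo\<close>.\<close>

lemma integral_sqrt_al_le: "(\<integral>t. sqrt (dir_info t) \<partial>expo) ^ 4 \<le> 4 * gap"
proof -
  have 1: "(\<integral>t. sqrt (dir_info t) * 1 \<partial>expo)\<^sup>2 \<le> (\<integral>t. (sqrt (dir_info t))\<^sup>2 \<partial>expo) * (\<integral>t. 1\<^sup>2 \<partial>expo)"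
    using dir_info_bounded[of 1] dir_info_nonneg by (intro Cauchy_Schwarz_integral(3)) (auto)
  have 2: "(\<integral>t. dir_info t * 1 \<partial>expo)\<^sup>2 \<le> (\<integral>t. (dir_info t)\<^sup>2 \<partial>expo) * (\<integral>t. 1\<^sup>2 \<partial>expo)"
    using dir_info_bounded[of 2] by (intro Cauchy_Schwarz_integral(3)) (auto)
  have p: "measure expo UNIV = 1" using expo.prob_space by simp
  have "((\<integral>t. sqrt (dir_info t) \<partial>expo)\<^sup>2)\<^sup>2 \<le> (\<integral>t. dir_info t \<partial>expo)\<^sup>2"
    using 1 dir_info_nonneg p by (intro power_mono) auto
  also have "\<dots> \<le> (\<integral>t. (dir_info t)\<^sup>2 \<partial>expo)" using 2 p by simp
  also have "\<dots> \<le> 4 * gap" by (rule integral_al_sq_le)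
  finally show ?thesis by simp
qed

end

end

section \<open>The Stein pairing\<close>

lemma GDERIV_grad:
  fixes g :: "real^'n \<Rightarrow> real"
  assumes "g differentiable (at x)"
  shows "GDERIV g x :> grad g x"
proof -
  have D: "(g has_derivative frechet_derivative g (at x)) (at x)"
    using assms by (simp add: frechet_derivative_works)
  then have lin: "linear (frechet_derivative g (at x))"
    by (rule has_derivative_linear)
  have "frechet_derivative g (at x) k = k \<bullet> grad g x" for k
  proof -
    have "frechet_derivative g (at x) k = frechet_derivative g (at x) (\<Sum>i\<in>UNIV. (k $ i) *\<^sub>R axis i 1)"
      using basis_expansion[of k] by (simp add: scalar_mult_eq_scaleR)
    also have "\<dots> = (\<Sum>i\<in>UNIV. (k $ i) * partial i g x)"
      by (simp add: linear_sum[OF lin] linear_scale[OF lin] partial_def)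
    also have "\<dots> = k \<bullet> grad g x"
      by (simp add: inner_vec_def grad_def)
    finally show ?thesis .
  qed
  then have "frechet_derivative g (at x) = (\<lambda>k. k \<bullet> grad g x)" by (rule ext)
  then show ?thesis using D by (simp add: gderiv_def)
qed

text \<open>If \<open>k\<close> is not integrable, its Bochner integral is 0 by convention and the
  bound persists. This matters for \<open>\<psi>\<close>, for which integrability is not known on
  every slice.\<close>

lemma (in prob_space) square_integral_le:
  fixes k :: "'a \<Rightarrow> real"
  assumes [measurable]: "k \<in> borel_measurable M"
  shows "ennreal ((\<integral>x. k x \<partial>M)\<^sup>2) \<le> (\<integral>\<^sup>+x. ennreal ((k x)\<^sup>2) \<partial>M)"
proof (cases "integrable M k")
  case True
  have "ennreal ((\<integral>x. k x \<partial>M)\<^sup>2) = (ennreal (norm (\<integral>x. k x \<partial>M)))\<^sup>2"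
    by (simp add: ennreal_power)
  also have "\<dots> \<le> (\<integral>\<^sup>+x. ennreal (norm (k x)) \<partial>M)\<^sup>2"
    by (intro power_mono integral_norm_bound_ennreal True) auto
  also have "\<dots> = (\<integral>\<^sup>+x. ennreal (norm (k x)) * 1 \<partial>M)\<^sup>2" by simp
  also have "\<dots> \<le> (\<integral>\<^sup>+x. (ennreal (norm (k x)))\<^sup>2 \<partial>M) * (\<integral>\<^sup>+x. 1\<^sup>2 \<partial>M)"
    by (rule Cauchy_Schwarz_nn_integral) auto
  also have "\<dots> = (\<integral>\<^sup>+x. ennreal ((k x)\<^sup>2) \<partial>M)"
    by (simp add: ennreal_power emeasure_space_1)
  finally show ?thesis .
qed (simp add: not_integrable_integral_eq)

context C1_density
begin

text \<open>Symmetry of the semigroup for nonnegative functions, with no integrability of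
  \<open>k\<close>: the reflection exchanges x with c x + s y.\<close>

lemma nn_integral_weight_swap:
  fixes k :: "real^'n \<Rightarrow> ennreal"
  assumes [measurable]: "k \<in> borel_measurable borel" and c: "0 < c" "c \<le> 1" and s: "s = sqrt (1 - c\<^sup>2)"
  shows "(\<integral>\<^sup>+p. ennreal (f (fst p)) * k (c *\<^sub>R fst p + s *\<^sub>R snd p) \<partial>gauss2) = (\<integral>\<^sup>+w. k w * ennreal (ou c f w) \<partial>gaussian)"
proof -
  note cs = cs_sq[OF c s]
  have inv: "c *\<^sub>R fst (reflect c s p) + s *\<^sub>R snd (reflect c s p) = fst p" for p :: "(real^'n) \<times> (real^'n)"
    using arg_cong[OF reflect_involution[OF c s, of p], of fst] by (simp add: reflect_def)
  have "(\<integral>\<^sup>+p. ennreal (f (fst p)) * k (c *\<^sub>R fst p + s *\<^sub>R snd p) \<partial>gauss2)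
      = (\<integral>\<^sup>+p. ennreal (f (fst (reflect c s p))) * k (fst p) \<partial>gauss2)"
    using nn_integral_reflect[OF _ cs(1,2), of "\<lambda>p. ennreal (f (fst p)) * k (c *\<^sub>R fst p + s *\<^sub>R snd p)"]
    unfolding inv by simp
  also have "\<dots> = (\<integral>\<^sup>+w. \<integral>\<^sup>+z. ennreal (f (c *\<^sub>R w + s *\<^sub>R z)) * k w \<partial>gaussian \<partial>gaussian)"
    by (subst gaussian.nn_integral_fst[symmetric]) (auto simp: reflect_def)
  also have "\<dots> = (\<integral>\<^sup>+w. k w * ennreal (ou c f w) \<partial>gaussian)"
  proof (rule nn_integral_cong_AE)
    show "AE w in gaussian. (\<integral>\<^sup>+z. ennreal (f (c *\<^sub>R w + s *\<^sub>R z)) * k w \<partial>gaussian) = k w * ennreal (ou c f w)"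
      using AE_integrable_ou[OF c s int]
    proof eventually_elim
      case (elim w)
      have "(\<integral>\<^sup>+z. ennreal (f (c *\<^sub>R w + s *\<^sub>R z)) * k w \<partial>gaussian) = (\<integral>\<^sup>+z. ennreal (f (c *\<^sub>R w + s *\<^sub>R z)) \<partial>gaussian) * k w"
        by (rule nn_integral_multc) measurable
      also have "(\<integral>\<^sup>+z. ennreal (f (c *\<^sub>R w + s *\<^sub>R z)) \<partial>gaussian) = ennreal (ou c f w)"
        unfolding ou_def s[symmetric] by (rule nn_integral_eq_integral[OF elim]) (simp add: nonneg)
      finally show ?case by (simp add: mult.commute)
    qed
  qed
  finally show ?thesis .
qed

lemma ou_f_nonneg: "0 \<le> ou c f x"
  unfolding ou_def by (rule integral_nonneg_AE) (simp add: nonneg)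

context
  fixes u :: "real^'n" and \<psi> :: "real^'n \<Rightarrow> real"
  assumes u: "norm u = 1" and \<psi>_meas [measurable]: "\<psi> \<in> borel_measurable borel"
    and adm: "\<And>t. 0 \<le> t \<Longrightarrow> (\<integral>\<^sup>+x. ennreal ((\<psi> x)\<^sup>2 * OU t f x) \<partial>gaussian) \<le> 1"
begin

lemma dir_score_int: "integrable gaussian (\<lambda>x. (u \<bullet> f' x)\<^sup>2 / f x)"
proof (rule Bochner_Integration.integrable_bound[OF fisher_int])
  have "(u \<bullet> y)\<^sup>2 \<le> (norm y)\<^sup>2" for y
    using Cauchy_Schwarz_ineq2[of u y] u by (metis abs_ge_zero power2_abs power_mono mult_1)
  then show "AE x in gaussian. norm ((u \<bullet> f' x)\<^sup>2 / f x) \<le> norm ((norm (f' x))\<^sup>2 / f x)"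
    using nonneg by (auto intro!: divide_right_mono)
qed measurable

text \<open>Admissibility puts the semigroup on the density; symmetry converts it into a square
  bound for \<open>\<psi>\<close> at the noisy point with weight \<open>f\<close> at the clean
  one.\<close>

lemma weighted_sq_le:
  assumes t: "0 \<le> t" and c: "c = exp (- t)" and s: "s = sqrt (1 - c\<^sup>2)"
  shows "(\<integral>\<^sup>+p. ennreal (f (fst p) * (\<psi> (c *\<^sub>R fst p + s *\<^sub>R snd p))\<^sup>2) \<partial>gauss2) \<le> 1"
proof -
  have cc: "0 < c" "c \<le> 1" using t c by auto
  have "(\<integral>\<^sup>+p. ennreal (f (fst p) * (\<psi> (c *\<^sub>R fst p + s *\<^sub>R snd p))\<^sup>2) \<partial>gauss2)
    = (\<integral>\<^sup>+p. ennreal (f (fst p)) * ennreal ((\<psi> (c *\<^sub>R fst p + s *\<^sub>R snd p))\<^sup>2) \<partial>gauss2)"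
    by (simp add: ennreal_mult nonneg)
  also have "\<dots> = (\<integral>\<^sup>+x. ennreal ((\<psi> x)\<^sup>2) * ennreal (ou c f x) \<partial>gaussian)"
    by (rule nn_integral_weight_swap[OF _ cc s]) measurable
  also have "\<dots> = (\<integral>\<^sup>+x. ennreal ((\<psi> x)\<^sup>2 * OU t f x) \<partial>gaussian)"
    by (simp add: OU_eq_ou c ennreal_mult ou_f_nonneg)
  finally show ?thesis using adm[OF t] by simp
qed

lemma OU_weighted_sq_le:
  assumes t: "0 \<le> t"
  shows "(\<integral>\<^sup>+x. ennreal (f x * (OU t \<psi> x)\<^sup>2) \<partial>gaussian) \<le> 1"
proof -
  define c where "c = exp (- t)"
  define s where "s = sqrt (1 - c\<^sup>2)"
  have "(\<integral>\<^sup>+x. ennreal (f x * (OU t \<psi> x)\<^sup>2) \<partial>gaussian)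
    \<le> (\<integral>\<^sup>+x. \<integral>\<^sup>+y. ennreal (f x * (\<psi> (c *\<^sub>R x + s *\<^sub>R y))\<^sup>2) \<partial>gaussian \<partial>gaussian)"
  proof (rule nn_integral_mono)
    fix x
    have "ennreal (f x * (OU t \<psi> x)\<^sup>2) = ennreal (f x) * ennreal ((\<integral>y. \<psi> (c *\<^sub>R x + s *\<^sub>R y) \<partial>gaussian)\<^sup>2)"
      by (simp add: OU_eq_ou ou_def c_def s_def ennreal_mult nonneg)
    also have "\<dots> \<le> ennreal (f x) * (\<integral>\<^sup>+y. ennreal ((\<psi> (c *\<^sub>R x + s *\<^sub>R y))\<^sup>2) \<partial>gaussian)"
      by (intro mult_left_mono gaussian.square_integral_le) auto
    also have "\<dots> = (\<integral>\<^sup>+y. ennreal (f x * (\<psi> (c *\<^sub>R x + s *\<^sub>R y))\<^sup>2) \<partial>gaussian)"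
      by (simp add: ennreal_mult nonneg nn_integral_cmult)
    finally show "ennreal (f x * (OU t \<psi> x)\<^sup>2) \<le> (\<integral>\<^sup>+y. ennreal (f x * (\<psi> (c *\<^sub>R x + s *\<^sub>R y))\<^sup>2) \<partial>gaussian)" .
  qed
  also have "\<dots> = (\<integral>\<^sup>+p. ennreal (f (fst p) * (\<psi> (c *\<^sub>R fst p + s *\<^sub>R snd p))\<^sup>2) \<partial>gauss2)"
    by (subst gaussian.nn_integral_fst[symmetric]) auto
  also have "\<dots> \<le> 1" by (rule weighted_sq_le[OF t c_def s_def])
  finally show ?thesis .
qed

text \<open>By symmetry the semigroup is moved from \<open>\<psi>\<close> onto the derivative of the density, where
  Cauchy--Schwarz produces the directional Fisher information at time \<open>t\<close>.\<close>
lemma dual_pairing_bound: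
  assumes t: "0 \<le> t"
  shows "\<bar>\<integral>x. (u \<bullet> f' x) * OU t \<psi> x \<partial>gaussian\<bar> \<le> sqrt (dir_info u t)"
proof -
  define c where "c = exp (- t)"
  define s where "s = sqrt (1 - c\<^sup>2)"
  have c: "0 < c" "c \<le> 1" using t by (auto simp: c_def)
  note cs = cs_sq[OF c s_def]
  define k where "k x = u \<bullet> f' x" for x
  have [measurable]: "k \<in> borel_measurable borel" unfolding k_def by measurable
  have ki: "integrable gaussian k" unfolding k_def using f'_int by simp
  have k0: "f x = 0 \<Longrightarrow> k x = 0" for x by (simp add: k_def f'_zero)
  define w where "w p = c *\<^sub>R fst p + s *\<^sub>R snd p" for p :: "(real^'n) \<times> (real^'n)"
  have [measurable]: "w \<in> borel_measurable (borel \<Otimes>\<^sub>M borel)" unfolding w_def by measurable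
  have inv: "w (reflect c s p) = fst p" "fst (reflect c s p) = w p" for p
    using arg_cong[OF reflect_involution[OF c s_def, of p], of fst] by (simp_all add: reflect_def w_def)
  define J where "J p = k (fst p) * \<psi> (w p)" for p
  have [measurable]: "J \<in> borel_measurable (borel \<Otimes>\<^sub>M borel)" unfolding J_def by measurable
  \<comment> \<open>Cauchy-Schwarz after splitting with \<open>sqrt f\<close>: one factor is square
    integrable by finite Fisher information, the other by admissibility.\<close>
  have Ji: "integrable gauss2 J"
  proof -
    have sq: "(k x / sqrt (f x))\<^sup>2 = (u \<bullet> f' x)\<^sup>2 / f x" "(sqrt (f x) * r)\<^sup>2 = f x * r\<^sup>2" for x r
      using nonneg[of x] by (simp_all add: k_def power_divide power_mult_distrib)
    have 1: "integrable gauss2 (\<lambda>p. (k (fst p) / sqrt (f (fst p)))\<^sup>2)"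
      unfolding sq by (subst integrable_gauss2_fst[of "\<lambda>x. (u \<bullet> f' x)\<^sup>2 / f x"]) (auto intro: dir_score_int)
    have 2: "integrable gauss2 (\<lambda>p. (sqrt (f (fst p)) * \<psi> (w p))\<^sup>2)"
      unfolding sq
    proof (rule integrableI_nonneg)
      show "(\<integral>\<^sup>+p. ennreal (f (fst p) * (\<psi> (w p))\<^sup>2) \<partial>gauss2) < \<infinity>"
        using weighted_sq_le[OF t c_def s_def] unfolding w_def by (rule le_less_trans) simp
    qed (auto simp: nonneg)
    have "integrable gauss2 (\<lambda>p. (k (fst p) / sqrt (f (fst p))) * (sqrt (f (fst p)) * \<psi> (w p)))"
      by (rule Cauchy_Schwarz_integral(1)[OF _ _ 1 2]) measurable
    moreover have "(k (fst p) / sqrt (f (fst p))) * (sqrt (f (fst p)) * \<psi> (w p)) = J p" for p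
      using k0[of "fst p"] nonneg[of "fst p"] by (cases "f (fst p) = 0") (auto simp: J_def)
    ultimately show ?thesis by simp
  qed
  have "(\<integral>x. (u \<bullet> f' x) * OU t \<psi> x \<partial>gaussian) = (\<integral>x. (\<integral>y. k x * \<psi> (w (x, y)) \<partial>gaussian) \<partial>gaussian)"
    by (simp add: OU_eq_ou ou_def k_def w_def c_def s_def)
  also have "\<dots> = (\<integral>p. J p \<partial>gauss2)"
    using gaussian_pair.integral_fst[of "\<lambda>x y. J (x, y)"] Ji[unfolded J_def[abs_def]] by (simp add: J_def case_prod_beta')
  also have "\<dots> = (\<integral>p. k (c *\<^sub>R fst p + s *\<^sub>R snd p) *\<^sub>R \<psi> (fst p) \<partial>gauss2)"
    using integral_reflect[OF _ cs(1,2), of J] by (simp add: J_def inv) (simp add: w_def)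
  also have "\<dots> = (\<integral>x. ou c k x *\<^sub>R \<psi> x \<partial>gaussian)"
  proof (rule integral_ou_weight[OF c s_def])
    show "integrable gauss2 (\<lambda>p. k (c *\<^sub>R fst p + s *\<^sub>R snd p) *\<^sub>R \<psi> (fst p))"
      using integrable_reflect[OF _ cs(1,2), of J] Ji by (simp add: J_def inv) (simp add: w_def)
  qed measurable
  finally have eq: "(\<integral>x. (u \<bullet> f' x) * OU t \<psi> x \<partial>gaussian) = (\<integral>x. ou c k x * \<psi> x \<partial>gaussian)" by simp
  \<comment> \<open>Where the smoothed density vanishes, \<open>b\<close> is 0 by convention; the
    factorisation below is valid because the smoothed derivative vanishes there too.\<close>
  have z: "AE x in gaussian. ou c f x = 0 \<longrightarrow> ou c k x = 0"
    using AE_integrable_ou[OF c s_def int]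
  proof eventually_elim
    case (elim x)
    show ?case
    proof
      assume "ou c f x = 0"
      then have "AE y in gaussian. f (c *\<^sub>R x + s *\<^sub>R y) = 0"
        unfolding ou_def s_def[symmetric] using elim nonneg by (subst (asm) integral_nonneg_eq_0_iff_AE) auto
      then have "AE y in gaussian. k (c *\<^sub>R x + s *\<^sub>R y) = 0" by eventually_elim (rule k0)
      then show "ou c k x = 0" unfolding ou_def s_def[symmetric] by (rule integral_eq_zero_AE)
    qed
  qed
  define a where "a x = \<psi> x * sqrt (ou c f x)" for x
  define b where "b x = ou c k x / sqrt (ou c f x)" for x
  have [measurable]: "a \<in> borel_measurable borel" "b \<in> borel_measurable borel"
    unfolding a_def b_def by measurable
  have a2: "(a x)\<^sup>2 = (\<psi> x)\<^sup>2 * OU t f x" and b2: "(b x)\<^sup>2 = (norm (ou c k x))\<^sup>2 / ou c f x" for x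
    using ou_f_nonneg[of c x] by (simp_all add: a_def b_def power_mult_distrib power_divide OU_eq_ou c_def)
  have a2i: "integrable gaussian (\<lambda>x. (a x)\<^sup>2)"
    by (rule integrableI_nonneg) (use adm[OF t] in \<open>auto simp: a2[symmetric] intro: le_less_trans\<close>)
  have "ennreal (\<integral>x. (a x)\<^sup>2 \<partial>gaussian) \<le> 1"
    using adm[OF t] a2i by (subst nn_integral_eq_integral[symmetric]) (auto simp: a2[symmetric])
  then have a1: "(\<integral>x. (a x)\<^sup>2 \<partial>gaussian) \<le> 1" by (simp add: ennreal_le_1)
  have b2i: "integrable gaussian (\<lambda>x. (b x)\<^sup>2)"
    unfolding b2 using fisher_dir_int[OF u c] by (simp add: k_def[abs_def])
  have b1: "(\<integral>x. (b x)\<^sup>2 \<partial>gaussian) = dir_info u t"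
    unfolding b2 dir_info_def[OF u] fisher_def using t by (simp add: k_def[abs_def] c_def max_def)
  have "(\<integral>x. ou c k x * \<psi> x \<partial>gaussian) = (\<integral>x. a x * b x \<partial>gaussian)"
  proof (rule integral_cong_AE)
    show "AE x in gaussian. ou c k x * \<psi> x = a x * b x"
      using z by eventually_elim (auto simp: a_def b_def)
  qed measurable
  then have "(\<integral>x. (u \<bullet> f' x) * OU t \<psi> x \<partial>gaussian)\<^sup>2 \<le> (\<integral>x. (a x)\<^sup>2 \<partial>gaussian) * (\<integral>x. (b x)\<^sup>2 \<partial>gaussian)"
    unfolding eq using Cauchy_Schwarz_integral(3)[OF _ _ a2i b2i] by simp
  also have "\<dots> \<le> 1 * dir_info u t"
    unfolding b1 using a1 dir_info_nonneg[OF u] by (intro mult_right_mono)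
  finally show ?thesis by (intro real_le_rsqrt[of "\<bar>_\<bar>"]) simp
qed

lemma phi_of_eq: "phi_of \<psi> x = (\<integral>t. OU t \<psi> x \<partial>expo)"
  unfolding phi_of_def by (rule integral_expo[symmetric]) (simp add: OU_def)

text \<open>Integration by parts against the density turns the Stein integrand into
  \<open>\<phi>\<close> times the score. Expanding \<open>\<phi>\<close> as an expectation over time
  then reduces the claim to the pairing at a single time.\<close>

lemma stein_pairing_bound:
  assumes diff: "\<And>x. phi_of \<psi> differentiable (at x)"
    and int_stein: "integrable (density gaussian (\<lambda>x. ennreal (f x))) (\<lambda>x. phi_of \<psi> x *\<^sub>R x - grad (phi_of \<psi>) x)"
  shows "\<bar>u \<bullet> (\<integral>x. (phi_of \<psi> x *\<^sub>R x - grad (phi_of \<psi>) x) \<partial>density gaussian (\<lambda>x. ennreal (f x)))\<bar>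
    \<le> (\<integral>t. sqrt (dir_info u t) \<partial>expo)"
proof -
  define \<phi> where "\<phi> = phi_of \<psi>"
  define \<mu> where "\<mu> = density gaussian (\<lambda>x. ennreal (f x))"
  have s\<mu>[simp, measurable_cong]: "sets \<mu> = sets borel" "space \<mu> = UNIV" by (simp_all add: \<mu>_def)
  have "emeasure \<mu> (space \<mu>) = 1"
    using nn_integral_eq_integral[OF int] nonneg prob by (simp add: \<mu>_def emeasure_density)
  then interpret mu: prob_space \<mu> by (rule prob_spaceI)
  interpret pp: pair_prob_space \<mu> expo ..
  have \<mu>_nn: "(\<integral>\<^sup>+x. ennreal (k x) \<partial>\<mu>) = (\<integral>\<^sup>+x. ennreal (f x * k x) \<partial>gaussian)"
    if [measurable]: "k \<in> borel_measurable borel" for k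
    unfolding \<mu>_def by (subst nn_integral_density) (auto simp: ennreal_mult' nonneg)
  have \<mu>_int: "integrable \<mu> k \<longleftrightarrow> integrable gaussian (\<lambda>x. f x * k x)"
    "(\<integral>x. k x \<partial>\<mu>) = (\<integral>x. f x * k x \<partial>gaussian)" if [measurable]: "k \<in> borel_measurable borel" for k :: "real^'n \<Rightarrow> real"
    unfolding \<mu>_def using nonneg by (subst integrable_density integral_density; simp)+
  have gd: "GDERIV \<phi> x :> grad \<phi> x" for x using diff unfolding \<phi>_def by (rule GDERIV_grad)
  have "continuous_on UNIV \<phi>"
    using diff unfolding \<phi>_def by (auto intro!: continuous_at_imp_continuous_on differentiable_imp_continuous_within)
  then have \<phi>m[measurable]: "\<phi> \<in> borel_measurable borel" by (rule borel_measurable_continuous_onI)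
  define H where "H x t = OU t \<psi> x" for x t
  have Hm[measurable]: "(\<lambda>p. H (fst p) (snd p)) \<in> borel_measurable (borel \<Otimes>\<^sub>M borel)"
    unfolding H_def OU_def by measurable
  have Hm1[measurable]: "(\<lambda>x. H x t) \<in> borel_measurable borel" "H x \<in> borel_measurable borel" for x t
    unfolding H_def[abs_def] OU_def by measurable
  have \<phi>H: "\<phi> x = (\<integral>t. H x t \<partial>expo)" for x unfolding \<phi>_def H_def by (rule phi_of_eq)
  \<comment> \<open>Admissibility averaged over the probability \<open>expo\<close>. It provides the
    square integrability of \<open>\<phi>\<close> and, with the score, the joint integrability for
    Fubini.\<close>
  have Hsq: "(\<integral>\<^sup>+x. \<integral>\<^sup>+t. ennreal ((H x t)\<^sup>2) \<partial>expo \<partial>\<mu>) \<le> 1"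
  proof -
    have "(\<integral>\<^sup>+x. \<integral>\<^sup>+t. ennreal ((H x t)\<^sup>2) \<partial>expo \<partial>\<mu>) = (\<integral>\<^sup>+t. \<integral>\<^sup>+x. ennreal ((H x t)\<^sup>2) \<partial>\<mu> \<partial>expo)"
      by (rule pp.Fubini'[symmetric]) (simp add: case_prod_beta')
    also have "\<dots> \<le> (\<integral>\<^sup>+t. 1 \<partial>expo)"
    proof (rule nn_integral_mono_AE)
      show "AE t in expo. (\<integral>\<^sup>+x. ennreal ((H x t)\<^sup>2) \<partial>\<mu>) \<le> 1"
        using AE_expo_pos
      proof eventually_elim
        case (elim t)
        then show ?case using OU_weighted_sq_le[of t] unfolding H_def[symmetric] by (subst \<mu>_nn) auto
      qed
    qed
    also have "\<dots> = 1" by (simp add: expo.emeasure_space_1[simplified])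
    finally show ?thesis .
  qed
  have H2: "integrable (\<mu> \<Otimes>\<^sub>M expo) (\<lambda>p. (H (fst p) (snd p))\<^sup>2)"
  proof (rule integrableI_nonneg)
    have "(\<integral>\<^sup>+p. ennreal ((H (fst p) (snd p))\<^sup>2) \<partial>(\<mu> \<Otimes>\<^sub>M expo)) = (\<integral>\<^sup>+x. \<integral>\<^sup>+t. ennreal ((H x t)\<^sup>2) \<partial>expo \<partial>\<mu>)"
      by (subst expo.nn_integral_fst[symmetric]) auto
    then show "(\<integral>\<^sup>+p. ennreal ((H (fst p) (snd p))\<^sup>2) \<partial>(\<mu> \<Otimes>\<^sub>M expo)) < \<infinity>"
      using Hsq by (auto intro: le_less_trans)
  qed auto
  have \<phi>2: "integrable \<mu> (\<lambda>x. (\<phi> x)\<^sup>2)"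
  proof (rule integrableI_nonneg)
    have "(\<integral>\<^sup>+x. ennreal ((\<phi> x)\<^sup>2) \<partial>\<mu>) \<le> (\<integral>\<^sup>+x. \<integral>\<^sup>+t. ennreal ((H x t)\<^sup>2) \<partial>expo \<partial>\<mu>)"
      unfolding \<phi>H by (intro nn_integral_mono expo.square_integral_le) auto
    also note Hsq
    also have "(1 :: ennreal) < \<infinity>" by simp
    finally show "(\<integral>\<^sup>+x. ennreal ((\<phi> x)\<^sup>2) \<partial>\<mu>) < \<infinity>" .
  qed auto
  define sc where "sc x = (u \<bullet> f' x) / f x" for x
  have [measurable]: "sc \<in> borel_measurable borel" unfolding sc_def by measurable
  have fsc: "f x * sc x = u \<bullet> f' x" for x
    by (cases "f x = 0") (auto simp: sc_def f'_zero)
  have sc2: "integrable \<mu> (\<lambda>x. (sc x)\<^sup>2)"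
  proof -
    have "f x * (sc x)\<^sup>2 = (u \<bullet> f' x)\<^sup>2 / f x" for x
      by (cases "f x = 0") (auto simp: sc_def power2_eq_square)
    then show ?thesis using dir_score_int by (subst \<mu>_int) auto
  qed
  have sc2': "integrable (\<mu> \<Otimes>\<^sub>M expo) (\<lambda>p. (sc (fst p))\<^sup>2)"
    using sc2 integrable_distr_eq[of fst "\<mu> \<Otimes>\<^sub>M expo" \<mu> "\<lambda>x. (sc x)\<^sup>2"]
      prob_space.distr_pair_fst[OF expo.prob_space_axioms, of \<mu>]
    by simp
  have "integrable (\<mu> \<Otimes>\<^sub>M expo) (\<lambda>p. sc (fst p) * H (fst p) (snd p))"
    by (rule Cauchy_Schwarz_integral(1)[OF _ _ sc2' H2]) measurable
  then have SH: "integrable (\<mu> \<Otimes>\<^sub>M expo) (case_prod (\<lambda>x t. sc x * H x t))" by (simp add: case_prod_beta')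

  have \<phi>i: "integrable \<mu> \<phi>"
    using Cauchy_Schwarz_integral(1)[of \<phi> \<mu> "\<lambda>_. 1"] \<phi>2 by simp
  have \<phi>sc: "integrable \<mu> (\<lambda>x. \<phi> x * sc x)"
    by (rule Cauchy_Schwarz_integral(1)[OF _ _ \<phi>2 sc2]) measurable
  have st: "integrable \<mu> (\<lambda>x. \<phi> x *\<^sub>R x - grad \<phi> x)"
    using int_stein unfolding \<phi>_def \<mu>_def .
  then have sti: "integrable \<mu> (\<lambda>x. u \<bullet> (\<phi> x *\<^sub>R x - grad \<phi> x))" by simp
  have stm[measurable]: "(\<lambda>x. u \<bullet> (\<phi> x *\<^sub>R x - grad \<phi> x)) \<in> borel_measurable borel"
    using borel_measurable_integrable[OF sti] by (simp cong: measurable_cong_sets)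
  have g1: "integrable gaussian (\<lambda>x. f x * \<phi> x)" using \<phi>i by (simp add: \<mu>_int)
  have g2: "integrable gaussian (\<lambda>x. f x * (\<phi> x * sc x))" using \<phi>sc by (simp add: \<mu>_int)
  have g3: "integrable gaussian (\<lambda>x. f x * (u \<bullet> (\<phi> x *\<^sub>R x - grad \<phi> x)))" using sti by (subst (asm) \<mu>_int) auto
  \<comment> \<open>Only \<open>\<phi>\<close> times the score and the Stein integrand are known to
    be integrable; the gradient of \<open>\<phi>\<close> is never separated from the latter.\<close>
  have e: "(f x * (u \<bullet> grad \<phi> x) + (u \<bullet> f' x) * \<phi> x) - (u \<bullet> x) * (f x * \<phi> x)
      = f x * (\<phi> x * sc x) - f x * (u \<bullet> (\<phi> x *\<^sub>R x - grad \<phi> x))" for x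
    unfolding fsc[symmetric] by (simp add: inner_diff_right algebra_simps)
  have "(\<integral>x. (f x * (u \<bullet> grad \<phi> x) + (u \<bullet> f' x) * \<phi> x) - (u \<bullet> x) * (f x * \<phi> x) \<partial>gaussian) = 0"
  proof (rule gaussian_ibp[OF g1])
    show "integrable gaussian (\<lambda>x. (f x * (u \<bullet> grad \<phi> x) + (u \<bullet> f' x) * \<phi> x) - (u \<bullet> x) * (f x * \<phi> x))"
      unfolding e by (rule Bochner_Integration.integrable_diff[OF g2 g3])
    show "((\<lambda>t. f (x + t *\<^sub>R u) * \<phi> (x + t *\<^sub>R u)) has_real_derivative f x * (u \<bullet> grad \<phi> x) + (u \<bullet> f' x) * \<phi> x) (at 0)" for x
      using DERIV_mult[OF GDERIV_line[OF gderiv, of x u] GDERIV_line[OF gd, of x u]] by (simp add: algebra_simps)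
  qed
  then have "(\<integral>x. f x * (u \<bullet> (\<phi> x *\<^sub>R x - grad \<phi> x)) \<partial>gaussian) = (\<integral>x. f x * (\<phi> x * sc x) \<partial>gaussian)"
    unfolding e Bochner_Integration.integral_diff[OF g2 g3] by simp
  then have "(\<integral>x. u \<bullet> (\<phi> x *\<^sub>R x - grad \<phi> x) \<partial>\<mu>) = (\<integral>x. \<phi> x * sc x \<partial>\<mu>)"
    by (simp add: \<mu>_int(2) del: inner_diff_right inner_scaleR_right)
  also have "\<dots> = (\<integral>x. (\<integral>t. sc x * H x t \<partial>expo) \<partial>\<mu>)"
    by (simp add: \<phi>H mult.commute)
  also have "\<dots> = (\<integral>t. (\<integral>x. sc x * H x t \<partial>\<mu>) \<partial>expo)"
    by (rule pp.Fubini_integral[OF SH, symmetric])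
  also have "\<bar>\<dots>\<bar> \<le> (\<integral>t. \<bar>\<integral>x. sc x * H x t \<partial>\<mu>\<bar> \<partial>expo)"
    by (rule integral_abs_bound)
  also have "\<dots> \<le> (\<integral>t. sqrt (dir_info u t) \<partial>expo)"
  proof (rule integral_mono_AE)
    show "integrable expo (\<lambda>t. \<bar>\<integral>x. sc x * H x t \<partial>\<mu>\<bar>)"
      using pp.integrable_snd[OF SH] by simp
    have "integrable expo (\<lambda>t. sqrt (dir_info u t) * 1)"
      using dir_info_bounded[OF u, of 1] dir_info_nonneg[OF u] by (intro Cauchy_Schwarz_integral(1)) (use dir_info_meas[OF u] in auto)
    then show "integrable expo (\<lambda>t. sqrt (dir_info u t))" by simp
    show "AE t in expo. \<bar>\<integral>x. sc x * H x t \<partial>\<mu>\<bar> \<le> sqrt (dir_info u t)"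
      using AE_expo_pos
    proof eventually_elim
      case (elim t)
      have "(\<integral>x. sc x * H x t \<partial>\<mu>) = (\<integral>x. (u \<bullet> f' x) * OU t \<psi> x \<partial>gaussian)"
        unfolding H_def[symmetric] by (subst \<mu>_int(2)) (simp_all add: fsc mult.assoc[symmetric])
      then show ?case using dual_pairing_bound[of t] elim by simp
    qed
  qed
  finally show ?thesis
    using st unfolding \<phi>_def[symmetric] \<mu>_def[symmetric] by (subst integral_inner_right[symmetric]) auto
qed

end

end

section \<open>Recentering and the theorem\<close>

lemma entropy_G_eq:
  fixes f :: "real^'n \<Rightarrow> real"
  assumes "integrable gaussian (\<lambda>x. f x * ln (f x))"
  shows "entropy_G f = ereal (\<integral>x. f x * ln (f x) \<partial>gaussian)"
proof -
  define k where "k x = f x * ln (f x)" for x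
  have k: "integrable gaussian k" using assms by (simp add: k_def[abs_def])
  have i: "integrable gaussian (\<lambda>x. max 0 (k x))" "integrable gaussian (\<lambda>x. max 0 (- k x))"
    using k by auto
  have "(\<integral>x. k x \<partial>gaussian) = (\<integral>x. max 0 (k x) - max 0 (- k x) \<partial>gaussian)"
    by (rule Bochner_Integration.integral_cong) (auto simp: max_def)
  also have "\<dots> = (\<integral>x. max 0 (k x) \<partial>gaussian) - (\<integral>x. max 0 (- k x) \<partial>gaussian)"
    using i by simp
  finally have e: "(\<integral>x. k x \<partial>gaussian) = (\<integral>x. max 0 (k x) \<partial>gaussian) - (\<integral>x. max 0 (- k x) \<partial>gaussian)" .
  have p: "0 \<le> (\<integral>x. max 0 (k x) \<partial>gaussian)" "0 \<le> (\<integral>x. max 0 (- k x) \<partial>gaussian)"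
    by (auto intro!: integral_nonneg_AE)
  have "(\<integral>\<^sup>+x. ennreal (max 0 (k x)) \<partial>gaussian) = ennreal (\<integral>x. max 0 (k x) \<partial>gaussian)"
    "(\<integral>\<^sup>+x. ennreal (max 0 (- k x)) \<partial>gaussian) = ennreal (\<integral>x. max 0 (- k x) \<partial>gaussian)"
    by (rule nn_integral_eq_integral[OF i(1)], simp) (rule nn_integral_eq_integral[OF i(2)], simp)
  then show ?thesis
    unfolding entropy_G_def k_def[symmetric] e using p by (simp only: enn2ereal_ennreal ereal_minus)
qed

lemma (in C1_density) stein_disc_le: "ereal (1/4) * (stein_disc f) ^ 4 \<le> ereal gap"
proof -
  \<comment> \<open>Nonnegativity of the gap was proved relative to a unit vector, so some unit
    vector has to be exhibited.\<close>
  have "norm (axis undefined 1 :: real^'n) = 1" by simp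
  from gap_nonneg[OF this] have d0: "0 \<le> gap" .
  define R where "R = root 4 (4 * gap)"
  have R0: "0 \<le> R" using d0 by (simp add: R_def)
  have R4: "R ^ 4 = 4 * gap" unfolding R_def using d0 by (intro real_root_pow_pos2) auto
  define S where "S = {\<psi>. admissible f \<psi> \<and> (\<forall>x. phi_of \<psi> differentiable (at x))
        \<and> integrable (density gaussian (\<lambda>x. ennreal (f x))) (\<lambda>x. phi_of \<psi> x *\<^sub>R x - grad (phi_of \<psi>) x)}"
  define V where "V \<psi> = (\<integral>x. (phi_of \<psi> x *\<^sub>R x - grad (phi_of \<psi>) x) \<partial>density gaussian (\<lambda>x. ennreal (f x)))" for \<psi>
  have sd: "stein_disc f = (SUP \<psi>\<in>S. ereal (norm (V \<psi>)))"
    unfolding stein_disc_def S_def V_def ..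
  have "norm (V \<psi>) \<le> R" if "\<psi> \<in> S" for \<psi>
  proof (cases "V \<psi> = 0")
    case False
    have "continuous_on UNIV \<psi>"
      using that by (auto simp: S_def admissible_def C1_fun_def intro!: continuous_at_imp_continuous_on differentiable_imp_continuous_within)
    then have \<psi>: "\<psi> \<in> borel_measurable borel" by (rule borel_measurable_continuous_onI)
    \<comment> \<open>Testing along the vector integral itself recovers its Euclidean norm from
      directional bounds.\<close>
    define u where "u = V \<psi> /\<^sub>R norm (V \<psi>)"
    have u: "norm u = 1" using False by (simp add: u_def)
    have "norm (V \<psi>) = u \<bullet> V \<psi>"
      using False by (simp add: u_def power2_norm_eq_inner[symmetric] power2_eq_square)
    also have "\<dots> \<le> \<bar>u \<bullet> V \<psi>\<bar>" by simp
    also have "\<dots> \<le> (\<integral>t. sqrt (dir_info u t) \<partial>expo)"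
      unfolding V_def by (rule stein_pairing_bound[OF u \<psi>]) (use that in \<open>auto simp: S_def admissible_def\<close>)
    finally have "norm (V \<psi>) ^ 4 \<le> (\<integral>t. sqrt (dir_info u t) \<partial>expo) ^ 4" by (intro power_mono) auto
    also have "\<dots> \<le> R ^ 4" unfolding R4 by (rule integral_sqrt_al_le[OF u])
    finally show ?thesis using R0 by (simp add: power_mono_iff)
  qed (simp add: R0)
  then have le: "stein_disc f \<le> ereal R" unfolding sd by (intro SUP_least) auto
  \<comment> \<open>The zero function keeps the supremum away from minus infinity and makes it
    nonnegative, so taking fourth powers preserves the order.\<close>
  have "(\<lambda>_. 0) \<in> S"
  proof -
    have z: "phi_of (\<lambda>_. 0) = (\<lambda>_::real^'n. 0)" by (simp add: phi_of_def OU_def fun_eq_iff)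
    have g: "grad (\<lambda>_. 0) = (\<lambda>_::real^'n. 0)" by (simp add: grad_def partial_def fun_eq_iff vec_eq_iff)
    have p: "partial i (\<lambda>_. 0) = (\<lambda>_::real^'n. 0)" for i by (simp add: partial_def fun_eq_iff)
    show ?thesis by (simp add: S_def admissible_def C1_fun_def z g p)
  qed
  then have ge: "0 \<le> stein_disc f" unfolding sd by (intro SUP_upper2[of "\<lambda>_. 0"]) auto
  obtain r where r: "stein_disc f = ereal r"
    using le ge by (cases "stein_disc f") auto
  have "r ^ 4 \<le> R ^ 4" using le ge r by (intro power_mono) auto
  then show ?thesis by (simp add: r R4)
qed

text \<open>The exponential factor is the Cameron-Martin density: times the Gaussian density at x it
  gives the Gaussian density at x + b, and Lebesgue measure is translation invariant.\<close>

lemma shift_gaussian: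
  fixes k :: "real^'n \<Rightarrow> 'b::{banach, second_countable_topology}"
  assumes [measurable]: "k \<in> borel_measurable borel"
  shows "integrable gaussian (\<lambda>x. exp (- (b \<bullet> x + (norm b)\<^sup>2 / 2)) *\<^sub>R k (x + b)) \<longleftrightarrow> integrable gaussian k"
    and "(\<integral>x. exp (- (b \<bullet> x + (norm b)\<^sup>2 / 2)) *\<^sub>R k (x + b) \<partial>gaussian) = (\<integral>x. k x \<partial>gaussian)"
proof -
  have "gauss_dens x * exp (- (b \<bullet> x + (norm b)\<^sup>2 / 2)) = gauss_dens (x + b)" for x :: "real^'n"
  proof -
    have "- (norm x)\<^sup>2 / 2 + - (b \<bullet> x + (norm b)\<^sup>2 / 2) = - (norm (x + b))\<^sup>2 / 2"
      unfolding power2_norm_eq_inner by (simp add: inner_add_left inner_add_right inner_commute field_simps)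
    then show ?thesis unfolding gauss_dens_def by (simp add: mult.assoc flip: exp_add)
  qed
  then have e: "gauss_dens x *\<^sub>R exp (- (b \<bullet> x + (norm b)\<^sup>2 / 2)) *\<^sub>R k (x + b) = gauss_dens (x + b) *\<^sub>R k (x + b)" for x
    by simp
  show "integrable gaussian (\<lambda>x. exp (- (b \<bullet> x + (norm b)\<^sup>2 / 2)) *\<^sub>R k (x + b)) \<longleftrightarrow> integrable gaussian k"
    using integrable_lborel_translate[of "\<lambda>x. gauss_dens x *\<^sub>R k x" b]
    unfolding e[symmetric] by (subst (1 2) integrable_gaussian) measurable
  show "(\<integral>x. exp (- (b \<bullet> x + (norm b)\<^sup>2 / 2)) *\<^sub>R k (x + b) \<partial>gaussian) = (\<integral>x. k x \<partial>gaussian)"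
    using integral_lborel_translate[of "\<lambda>x. gauss_dens x *\<^sub>R k x" b]
    unfolding e[symmetric] by (subst (1 2) integral_gaussian) measurable
qed

theorem theorem4p1:
  fixes f :: "real^'n::finite \<Rightarrow> real" and b :: "real^'n"
  assumes smooth: "smooth_fun f"
    and nonneg: "\<forall>x. f x \<ge> 0"
    and prob: "(\<integral>\<^sup>+ x. ennreal (f x) \<partial>gaussian) = 1"
    and bary_int: "integrable (density gaussian (\<lambda>x. ennreal (f x))) (\<lambda>x. x)"
    and bary: "(\<integral> x. x \<partial>density gaussian (\<lambda>x. ennreal (f x))) = b"
    and cov_int: "\<forall>i j. integrable (density gaussian (\<lambda>x. ennreal (f x)))
                     (\<lambda>x. (x $ i - b $ i) * (x $ j - b $ j))"
    and cov_le: "\<forall>v::real^'n. v \<bullet> ((\<chi> i j. \<integral> x. (x $ i - b $ i) * (x $ j - b $ j)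
                     \<partial>density gaussian (\<lambda>x. ennreal (f x))) *v v) \<le> v \<bullet> v"
  shows "deficit f \<ge> ereal (1/4) * (stein_disc (shift_dens f b)) ^ 4"
proof (cases "fisher_G f = \<infinity>")
  case True
  then show ?thesis by (simp add: deficit_def)
next
  case False
  have diff: "f differentiable (at x)" for x
    using smooth[unfolded smooth_fun_def, rule_format, of "[]"] by simp
  have gd: "GDERIV f x :> grad f x" for x by (rule GDERIV_grad[OF diff])
  have cont: "continuous_on UNIV f"
    using smooth[unfolded smooth_fun_def, rule_format, of "[]"] by simp
  have cont': "continuous_on UNIV (grad f)"
    unfolding grad_def using smooth[unfolded smooth_fun_def, rule_format, of "[_]"]
    by (intro continuous_on_vec_lambda) simp
  have fm[measurable]: "f \<in> borel_measurable borel" and f'm[measurable]: "grad f \<in> borel_measurable borel"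
    using cont cont' by (auto intro: borel_measurable_continuous_onI)
  have f0: "0 \<le> f x" for x using nonneg by simp
  have zero: "grad f x = 0" if "f x = 0" for x
  proof -
    have "grad f x \<bullet> grad f x = 0"
      by (rule DERIV_local_min[OF GDERIV_line[OF gd, of x "grad f x"], of 1]) (auto simp: that f0)
    then show ?thesis by simp
  qed
  have fi: "integrable gaussian f" by (rule integrableI_nonneg) (auto simp: f0 prob)
  have f1: "(\<integral>x. f x \<partial>gaussian) = 1"
    using nn_integral_eq_integral[OF fi] f0 prob by simp
  have fis: "integrable gaussian (\<lambda>x. (norm (grad f x))\<^sup>2 / f x)"
    using False by (intro integrableI_nonneg) (auto simp: f0 fisher_G_def less_top)
  have f'i: "integrable gaussian (grad f)"
    by (rule Cauchy_Schwarz_weighted(1)[OF fi _ fis]) (auto simp: f0 zero)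
  have xi: "integrable gaussian (\<lambda>x. f x *\<^sub>R x)"
    using bary_int by (subst (asm) integrable_density) (auto simp: f0)
  have xb: "(\<integral>x. f x *\<^sub>R x \<partial>gaussian) = b"
    using bary by (subst (asm) integral_density) (auto simp: f0)
  have ci: "integrable gaussian (\<lambda>x. f x * ((x $ i - b $ i) * (x $ j - b $ j)))" for i j
    using cov_int[rule_format, of i j] by (subst (asm) integrable_density) (auto simp: f0)
  have cv: "(\<integral>x. (x $ i - b $ i) * (x $ j - b $ j) \<partial>density gaussian (\<lambda>x. ennreal (f x)))
      = (\<integral>x. f x * ((x $ i - b $ i) * (x $ j - b $ j)) \<partial>gaussian)" for i j
    by (subst integral_density) (auto simp: f0)

  define e where "e x = exp (- (b \<bullet> x + (norm b)\<^sup>2 / 2))" for x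
  define g where "g = shift_dens f b"
  define g' where "g' x = e x *\<^sub>R (grad f (x + b) - f (x + b) *\<^sub>R b)" for x
  have e0: "0 < e x" for x by (simp add: e_def)
  have g: "g x = e x * f (x + b)" for x by (simp add: g_def shift_dens_def e_def)
  note sh = shift_gaussian[where b=b, folded e_def]
  have bx: "f x * (b \<bullet> x) = b \<bullet> (f x *\<^sub>R x)" for x by simp
  have bxi: "integrable gaussian (\<lambda>x. f x * (b \<bullet> x))" unfolding bx using xi by (rule integrable_inner_right)
  have bxb: "(\<integral>x. f x * (b \<bullet> x) \<partial>gaussian) = b \<bullet> b" unfolding bx using xi xb by (subst integral_inner_right) auto
  have b'i: "integrable gaussian (\<lambda>x. b \<bullet> grad f x)" using f'i by (rule integrable_inner_right)
  \<comment> \<open>Integration by parts along \<open>b\<close> identifies this with the mean of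
    \<open>b \<bullet> x\<close>, that is, with the squared norm of the barycenter.\<close>
  have bb: "(\<integral>x. b \<bullet> grad f x \<partial>gaussian) = b \<bullet> b"
  proof -
    have i: "integrable gaussian (\<lambda>x. (b \<bullet> x) * f x)" using bxi by (simp add: mult.commute)
    have "(\<integral>x. b \<bullet> grad f x - (b \<bullet> x) * f x \<partial>gaussian) = 0"
      by (rule gaussian_ibp[OF fi Bochner_Integration.integrable_diff[OF b'i i] GDERIV_line[OF gd]])
    then show ?thesis using b'i i bxb by (simp add: mult.commute)
  qed

  \<comment> \<open>The Fisher integrand of the recentered density, pulled back to \<open>f\<close>:
    it expands the squared norm of \<open>grad f y - f y *\<^sub>R b\<close> over
    \<open>f y\<close>. The last two terms integrate to -2 + 1 times
    \<open>b \<bullet> b\<close>.\<close>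
  define kI where "kI y = (norm (grad f y))\<^sup>2 / f y - 2 * (b \<bullet> grad f y) + (b \<bullet> b) * f y" for y
  have [measurable]: "kI \<in> borel_measurable borel" unfolding kI_def by measurable
  have kIi: "integrable gaussian kI" and kI: "(\<integral>x. kI x \<partial>gaussian) = (\<integral>x. (norm (grad f x))\<^sup>2 / f x \<partial>gaussian) - b \<bullet> b"
    unfolding kI_def using fis b'i fi bb f1 by simp_all
  have gI: "(norm (g' x))\<^sup>2 / g x = e x * kI (x + b)" for x
  proof (cases "f (x + b) = 0")
    case True
    then show ?thesis by (simp add: g'_def kI_def zero g)
  next
    case fne: False
    have "(norm (g' x))\<^sup>2 = (e x)\<^sup>2 * ((norm (grad f (x + b)))\<^sup>2 - 2 * f (x + b) * (b \<bullet> grad f (x + b)) + (f (x + b))\<^sup>2 * (b \<bullet> b))"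
      unfolding g'_def power2_norm_eq_inner
      by (simp add: inner_diff_left inner_diff_right inner_commute algebra_simps power2_eq_square)
    also have "\<dots> / g x = e x * kI (x + b)"
      using fne e0[of x] by (simp add: g kI_def field_simps power2_eq_square)
    finally show ?thesis .
  qed

  interpret G: C1_density g g'
  proof
    show "GDERIV g x :> g' x" for x
    proof -
      have "((\<lambda>x. x + b) has_derivative (\<lambda>k. k)) (at x)"
        by (auto intro!: derivative_eq_intros)
      from has_derivative_compose[OF this gd[of "x + b", unfolded gderiv_def]]
      have 1: "GDERIV (\<lambda>x. f (x + b)) x :> grad f (x + b)" by (simp only: gderiv_def)
      have "(e has_derivative (\<lambda>k. k \<bullet> (- e x *\<^sub>R b))) (at x)"
        unfolding e_def by (auto intro!: derivative_eq_intros simp: inner_commute fun_eq_iff)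
      then have 2: "GDERIV e x :> - e x *\<^sub>R b" by (simp add: gderiv_def)
      show ?thesis
        unfolding g[abs_def] by (rule GDERIV_subst[OF GDERIV_mult[OF 2 1]]) (simp add: g'_def algebra_simps)
    qed
    show "continuous_on UNIV g'"
      unfolding g'_def e_def
      by (intro continuous_intros continuous_on_compose2[OF cont'] continuous_on_compose2[OF cont]) auto
    show "0 \<le> g x" for x using e0[of x] f0 by (simp add: g less_imp_le)
    show "integrable gaussian g" using sh(1)[of f] fi by (simp add: g[abs_def])
    show "(\<integral>x. g x \<partial>gaussian) = 1" using sh(2)[of f] f1 by (simp add: g)
    show "integrable gaussian (\<lambda>x. (norm (g' x))\<^sup>2 / g x)"
      unfolding gI using sh(1)[of kI] kIi by simp
    show "integrable gaussian (\<lambda>x. (norm x)\<^sup>2 * g x)"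
    proof -
      define k where "k y = f y * (norm (y - b))\<^sup>2" for y
      have [measurable]: "k \<in> borel_measurable borel" unfolding k_def by measurable
      have "k = (\<lambda>y. \<Sum>i\<in>UNIV. f y * ((y $ i - b $ i) * (y $ i - b $ i)))"
        unfolding k_def power2_norm_eq_inner inner_vec_def by (simp add: sum_distrib_left)
      then have "integrable gaussian k" by (simp only:) (intro Bochner_Integration.integrable_sum ci)
      then show ?thesis using sh(1)[of k] by (simp add: k_def g mult_ac)
    qed
    show "(\<integral>x. (u \<bullet> x)\<^sup>2 * g x \<partial>gaussian) \<le> 1" if u: "norm u = 1" for u
    proof -
      \<comment> \<open>Recentering turns the second moment of \<open>g\<close> along
        \<open>u\<close> into the quadratic form of the covariance of \<open>f\<close> at
        \<open>u\<close>.\<close>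
      define k where "k y = f y * (u \<bullet> (y - b))\<^sup>2" for y
      have [measurable]: "k \<in> borel_measurable borel" unfolding k_def by measurable
      have ke: "k y = (\<Sum>i\<in>UNIV. \<Sum>j\<in>UNIV. (u $ i * u $ j) * (f y * ((y $ i - b $ i) * (y $ j - b $ j))))" for y
        by (simp only: k_def power2_eq_square inner_vec_def sum_product) (simp add: sum_distrib_left mult_ac)
      have "(\<integral>x. (u \<bullet> x)\<^sup>2 * g x \<partial>gaussian) = (\<integral>x. e x *\<^sub>R k (x + b) \<partial>gaussian)"
        by (simp add: k_def g mult_ac)
      also have "\<dots> = (\<integral>x. k x \<partial>gaussian)" by (rule sh(2)) measurable
      also have "\<dots> = (\<Sum>i\<in>UNIV. \<Sum>j\<in>UNIV. (u $ i * u $ j) * (\<integral>x. f x * ((x $ i - b $ i) * (x $ j - b $ j)) \<partial>gaussian))"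
        unfolding ke by (subst Bochner_Integration.integral_sum; simp add: ci Bochner_Integration.integral_sum)
      also have "\<dots> = u \<bullet> ((\<chi> i j. \<integral> x. (x $ i - b $ i) * (x $ j - b $ j) \<partial>density gaussian (\<lambda>x. ennreal (f x))) *v u)"
        unfolding cv by (simp add: inner_vec_def matrix_vector_mult_def sum_distrib_left mult_ac)
      also have "\<dots> \<le> u \<bullet> u" using cov_le by blast
      also have "\<dots> = 1" using u by (simp add: norm_eq_1)
      finally show ?thesis .
    qed
  qed

  \<comment> \<open>The entropy integrand of the recentered density, pulled back to
    \<open>f\<close>. The correction integrates to half of \<open>b \<bullet> b\<close>, matching
    half of the loss in Fisher information.\<close>
  define kH where "kH y = f y * ln (f y) - (f y * (b \<bullet> y) - (b \<bullet> b) / 2 * f y)" for y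
  have [measurable]: "kH \<in> borel_measurable borel" unfolding kH_def by measurable
  have gH: "g x * ln (g x) = e x * kH (x + b)" for x
  proof (cases "f (x + b) = 0")
    case fne: False
    then have L: "ln (g x) = ln (f (x + b)) - (b \<bullet> x + (norm b)\<^sup>2 / 2)"
      using e0[of x] f0[of "x + b"] by (simp add: g ln_mult e_def)
    have "kH (x + b) = f (x + b) * (ln (f (x + b)) - (b \<bullet> x + (norm b)\<^sup>2 / 2))"
      by (simp add: kH_def inner_add_right power2_norm_eq_inner algebra_simps)
    then show ?thesis unfolding L by (simp add: g)
  qed (simp add: g kH_def)
  have lin: "integrable gaussian (\<lambda>y. f y * (b \<bullet> y) - (b \<bullet> b) / 2 * f y)"
    using bxi fi by simp
  \<comment> \<open>Integrability of the entropy is known for the recentered density and is carried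
    back to \<open>f\<close> from there.\<close>
  have kHi: "integrable gaussian kH"
    using G.entropy_int[of 1] sh(1)[of kH] by (simp add: gH)
  have Hi: "integrable gaussian (\<lambda>x. f x * ln (f x))"
    using Bochner_Integration.integrable_add[OF kHi lin] by (simp add: kH_def)
  have "(\<integral>x. g x * ln (g x) \<partial>gaussian) = (\<integral>x. kH x \<partial>gaussian)"
    unfolding gH using sh(2)[of kH] by simp
  also have "\<dots> = (\<integral>x. f x * ln (f x) \<partial>gaussian) - b \<bullet> b / 2"
    unfolding kH_def using Hi lin bxi fi bxb f1 by simp
  finally have H: "(\<integral>x. g x * ln (g x) \<partial>gaussian) = (\<integral>x. f x * ln (f x) \<partial>gaussian) - b \<bullet> b / 2" .
  have I: "fisher 1 g g' = (\<integral>x. (norm (grad f x))\<^sup>2 / f x \<partial>gaussian) - b \<bullet> b"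
    unfolding fisher_def ou_one gI using sh(2)[of kI] kI by simp
  have "fisher_G f = ennreal (\<integral>x. (norm (grad f x))\<^sup>2 / f x \<partial>gaussian)"
    unfolding fisher_G_def by (rule nn_integral_eq_integral[OF fis]) (simp add: f0)
  moreover have "0 \<le> (\<integral>x. (norm (grad f x))\<^sup>2 / f x \<partial>gaussian)"
    by (rule integral_nonneg_AE) (simp add: f0)
  ultimately have "deficit f = ereal G.gap"
    unfolding deficit_def G.gap_def entropy_G_eq[OF Hi] H I
    by (simp add: enn2ereal_ennreal field_simps)
  then show ?thesis using G.stein_disc_le by (simp add: g_def)
qed

end
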